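(* Let $(\mathcal{M},\mathcal{W},I,J)$ be a cofibrantly generated model category and let $\mathcal{N}$ be a bicomplete category. Let $F:\mathcal{N}\to\mathcal{M}$ be a functor which is right adjoint to a functor $L:\mathcal{M}\to\mathcal{N}$ and left adjoint to a functor $R:\mathcal{M}\to\mathcal{N}$. If the adjunction $(FL, FR)$ (with $FL:\mathcal{M}\to\mathcal{M}$ the left adjoint and $FR:\mathcal{M}\to\mathcal{M}$ the right adjoint) is a Quillen adjunction, then there exists a right-induced cofibrantly generated model category structure $(\mathcal{N},F^{-1}\mathcal{W},LI,LJ)$ on $\mathcal{N}$. Moreover, with respect to this model structure, both $(L,F)$ and $(F,R)$ are Quillen adjunctions.
   Context: A quadruple $(\mathcal{M},\mathcal{W},I,J)$ denotes a cofibrantly generated model category with subcategory of weak equivalences $\mathcal{W}$, set of generating cofibrations $I$ and set of generating acyclic cofibrations $J$: the sets $I$ and $J$ permit the small object argument, the fibrations are exactly the maps with the right lifting property with respect to every element of $J$, and the acyclic fibrations are exactly the maps with the right lifting property with respect to every element of $I$. Here $LI=\{L(i): i\in I\}$ and $LJ=\{L(j):j\in J\}$, and $F^{-1}\mathcal{W}$ is the class of morphisms $f$ of $\mathcal{N}$ with $F(f)\in\mathcal{W}$. A model structure on $\mathcal{N}$ is right-induced (along $F$) if $F$ creates weak equivalences and fibrations, i.e. a morphism $f$ of $\mathcal{N}$ is a weak equivalence (resp. fibration) if and only if $F(f)$ is a weak equivalence (resp. fibration) in $\mathcal{M}$. *)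

theory Defs
  imports Main
begin

unbundle cardinal_syntax

section \<open>Smallness\<close>

text \<open>
  The set/class distinction is rendered by a Grothendieck universe: a type \<open>'u\<close> whose cardinality
  is an uncountable strongly inaccessible cardinal. A set, of any type, is small if its
  cardinality is below that of \<open>'u\<close>. Small ordinals and small cardinals are then, up to
  isomorphism, exactly the well-orders on \<open>'u\<close> with small field.
\<close>

definition grothendieck_universe :: "'u itself \<Rightarrow> bool" where
  "grothendieck_universe U \<longleftrightarrow>
     natLeq <o |UNIV :: 'u set| \<and>
     regularCard |UNIV :: 'u set| \<and>
     (\<forall>A :: 'u set. |A| <o |UNIV :: 'u set| \<longrightarrow> |Pow A| <o |UNIV :: 'u set| )"

definition small :: "'u itself \<Rightarrow> 'a set \<Rightarrow> bool" where
  "small U A \<longleftrightarrow> |A| <o |UNIV :: 'u set|"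


section \<open>Categories, functors, (co)limits, adjunctions\<close>

record ('o, 'm) cat =
  Ob :: "'o set"
  Arr :: "'m set"
  Dom :: "'m \<Rightarrow> 'o"
  Cod :: "'m \<Rightarrow> 'o"
  Ident :: "'o \<Rightarrow> 'm"
  Comp :: "'m \<Rightarrow> 'm \<Rightarrow> 'm"  (infixl "\<cdot>\<index>" 70)

definition hom :: "('o, 'm) cat \<Rightarrow> 'o \<Rightarrow> 'o \<Rightarrow> 'm set" where
  "hom C x y = {f \<in> Arr C. Dom C f = x \<and> Cod C f = y}"

locale category =
  fixes C :: "('o, 'm) cat" (structure)
  assumes dom_closed: "f \<in> Arr C \<Longrightarrow> Dom C f \<in> Ob C"
    and cod_closed: "f \<in> Arr C \<Longrightarrow> Cod C f \<in> Ob C"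
    and ident_closed: "x \<in> Ob C \<Longrightarrow> Ident C x \<in> hom C x x"
    and comp_closed: "\<lbrakk>f \<in> hom C x y; g \<in> hom C y z\<rbrakk> \<Longrightarrow> g \<cdot> f \<in> hom C x z"
    and ident_left: "f \<in> hom C x y \<Longrightarrow> Ident C y \<cdot> f = f"
    and ident_right: "f \<in> hom C x y \<Longrightarrow> f \<cdot> Ident C x = f"
    and comp_assoc: "\<lbrakk>f \<in> hom C w x; g \<in> hom C x y; h \<in> hom C y z\<rbrakk>
                       \<Longrightarrow> (h \<cdot> g) \<cdot> f = h \<cdot> (g \<cdot> f)"

definition locally_small :: "'u itself \<Rightarrow> ('o, 'm) cat \<Rightarrow> bool" where
  "locally_small U C \<longleftrightarrow> (\<forall>x \<in> Ob C. \<forall>y \<in> Ob C. small U (hom C x y))"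

record ('o, 'm, 'p, 'n) fnctr =
  fob :: "'o \<Rightarrow> 'p"
  fmor :: "'m \<Rightarrow> 'n"

locale cat_functor = source: category C + target: category D
  for C :: "('o, 'm) cat" and D :: "('p, 'n) cat" +
  fixes F :: "('o, 'm, 'p, 'n) fnctr"
  assumes fob_closed: "x \<in> Ob C \<Longrightarrow> fob F x \<in> Ob D"
    and fmor_closed: "f \<in> hom C x y \<Longrightarrow> fmor F f \<in> hom D (fob F x) (fob F y)"
    and fmor_ident: "x \<in> Ob C \<Longrightarrow> fmor F (Ident C x) = Ident D (fob F x)"
    and fmor_comp: "\<lbrakk>f \<in> hom C x y; g \<in> hom C y z\<rbrakk>
                      \<Longrightarrow> fmor F (g \<cdot>\<^bsub>C\<^esub> f) = fmor F g \<cdot>\<^bsub>D\<^esub> fmor F f"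

definition fcomp :: "('p, 'n, 'q, 'k) fnctr \<Rightarrow> ('o, 'm, 'p, 'n) fnctr \<Rightarrow> ('o, 'm, 'q, 'k) fnctr"
    (infixl "\<circ>\<^sub>F" 55) where
  "G \<circ>\<^sub>F F = \<lparr>fob = fob G \<circ> fob F, fmor = fmor G \<circ> fmor F\<rparr>"

definition cocone ::
    "('i, 'j) cat \<Rightarrow> ('o, 'm) cat \<Rightarrow> ('i, 'j, 'o, 'm) fnctr \<Rightarrow> 'o \<Rightarrow> ('i \<Rightarrow> 'm) \<Rightarrow> bool" where
  "cocone D C X c \<iota> \<longleftrightarrow>
     c \<in> Ob C \<and> (\<forall>d \<in> Ob D. \<iota> d \<in> hom C (fob X d) c) \<and>
     (\<forall>a \<in> Arr D. \<iota> (Cod D a) \<cdot>\<^bsub>C\<^esub> fmor X a = \<iota> (Dom D a))"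

definition is_colimit ::
    "('i, 'j) cat \<Rightarrow> ('o, 'm) cat \<Rightarrow> ('i, 'j, 'o, 'm) fnctr \<Rightarrow> 'o \<Rightarrow> ('i \<Rightarrow> 'm) \<Rightarrow> bool" where
  "is_colimit D C X c \<iota> \<longleftrightarrow>
     cocone D C X c \<iota> \<and>
     (\<forall>c' \<iota>'. cocone D C X c' \<iota>' \<longrightarrow>
        (\<exists>!h. h \<in> hom C c c' \<and> (\<forall>d \<in> Ob D. h \<cdot>\<^bsub>C\<^esub> \<iota> d = \<iota>' d)))"

definition cone ::
    "('i, 'j) cat \<Rightarrow> ('o, 'm) cat \<Rightarrow> ('i, 'j, 'o, 'm) fnctr \<Rightarrow> 'o \<Rightarrow> ('i \<Rightarrow> 'm) \<Rightarrow> bool" where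
  "cone D C X c \<pi> \<longleftrightarrow>
     c \<in> Ob C \<and> (\<forall>d \<in> Ob D. \<pi> d \<in> hom C c (fob X d)) \<and>
     (\<forall>a \<in> Arr D. fmor X a \<cdot>\<^bsub>C\<^esub> \<pi> (Dom D a) = \<pi> (Cod D a))"

definition is_limit ::
    "('i, 'j) cat \<Rightarrow> ('o, 'm) cat \<Rightarrow> ('i, 'j, 'o, 'm) fnctr \<Rightarrow> 'o \<Rightarrow> ('i \<Rightarrow> 'm) \<Rightarrow> bool" where
  "is_limit D C X c \<pi> \<longleftrightarrow>
     cone D C X c \<pi> \<and>
     (\<forall>c' \<pi>'. cone D C X c' \<pi>' \<longrightarrow>
        (\<exists>!h. h \<in> hom C c' c \<and> (\<forall>d \<in> Ob D. \<pi> d \<cdot>\<^bsub>C\<^esub> h = \<pi>' d)))"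

text \<open>
  Every small category is isomorphic to one whose objects and arrows are elements of \<open>'u\<close>, so it
  suffices to quantify over index categories of the latter kind. As usual, categories
  are understood to be locally small.
\<close>

definition bicomplete :: "'u itself \<Rightarrow> ('o, 'm) cat \<Rightarrow> bool" where
  "bicomplete U C \<longleftrightarrow>
     category C \<and> locally_small U C \<and>
     (\<forall>(D :: ('u, 'u) cat) X.
        small U (Ob D) \<and> small U (Arr D) \<and> cat_functor D C X \<longrightarrow>
        (\<exists>c \<pi>. is_limit D C X c \<pi>) \<and> (\<exists>c \<iota>. is_colimit D C X c \<iota>))"

definition adjunction ::
    "('o, 'm) cat \<Rightarrow> ('p, 'n) cat \<Rightarrow> ('o, 'm, 'p, 'n) fnctr \<Rightarrow> ('p, 'n, 'o, 'm) fnctr \<Rightarrow> bool" where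
  "adjunction C D L R \<longleftrightarrow>
     cat_functor C D L \<and> cat_functor D C R \<and>
     (\<exists>\<phi>. (\<forall>x \<in> Ob C. \<forall>y \<in> Ob D. bij_betw (\<phi> x y) (hom D (fob L x) y) (hom C x (fob R y))) \<and>
          (\<forall>x \<in> Ob C. \<forall>x' \<in> Ob C. \<forall>y \<in> Ob D. \<forall>y' \<in> Ob D.
             \<forall>h \<in> hom C x' x. \<forall>k \<in> hom D y y'. \<forall>f \<in> hom D (fob L x) y.
               \<phi> x' y' (k \<cdot>\<^bsub>D\<^esub> f \<cdot>\<^bsub>D\<^esub> fmor L h) = fmor R k \<cdot>\<^bsub>C\<^esub> \<phi> x y f \<cdot>\<^bsub>C\<^esub> h))"


section \<open>Transfinite compositions, relative cell complexes and smallness\<close>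

text \<open>Ordinals are well-orders \<open>r\<close> (reflexive, in the library's convention) on their field.\<close>

definition ord_cat :: "'i rel \<Rightarrow> ('i, 'i \<times> 'i) cat" where
  "ord_cat r = \<lparr>Ob = Field r, Arr = r, Dom = fst, Cod = snd,
                Ident = (\<lambda>b. (b, b)), Comp = (\<lambda>g f. (fst f, snd g))\<rparr>"

definition succ_in :: "'i rel \<Rightarrow> 'i \<Rightarrow> 'i \<Rightarrow> bool" where
  "succ_in r b c \<longleftrightarrow>
     (b, c) \<in> r \<and> b \<noteq> c \<and> (\<forall>d. (b, d) \<in> r \<and> (d, c) \<in> r \<longrightarrow> d = b \<or> d = c)"

definition zero_in :: "'i rel \<Rightarrow> 'i \<Rightarrow> bool" where
  "zero_in r a \<longleftrightarrow> a \<in> Field r \<and> Order_Relation.underS r a = {}"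

definition limit_in :: "'i rel \<Rightarrow> 'i \<Rightarrow> bool" where
  "limit_in r c \<longleftrightarrow> c \<in> Field r \<and> \<not> zero_in r c \<and> \<not> (\<exists>b. succ_in r b c)"

definition lambda_sequence ::
    "'i rel \<Rightarrow> ('o, 'm) cat \<Rightarrow> ('i, 'i \<times> 'i, 'o, 'm) fnctr \<Rightarrow> bool" where
  "lambda_sequence r C X \<longleftrightarrow>
     Well_order r \<and> cat_functor (ord_cat r) C X \<and>
     (\<forall>c. limit_in r c \<longrightarrow>
        is_colimit (ord_cat (Restr r (Order_Relation.underS r c))) C X
          (fob X c) (\<lambda>b. fmor X (b, c)))"

definition lambda_sequence_of ::
    "'i rel \<Rightarrow> ('o, 'm) cat \<Rightarrow> 'm set \<Rightarrow> ('i, 'i \<times> 'i, 'o, 'm) fnctr \<Rightarrow> bool" where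
  "lambda_sequence_of r C K X \<longleftrightarrow>
     lambda_sequence r C X \<and> (\<forall>b c. succ_in r b c \<longrightarrow> fmor X (b, c) \<in> K)"

definition transfinite_compositions :: "'u itself \<Rightarrow> ('o, 'm) cat \<Rightarrow> 'm set \<Rightarrow> 'm set" where
  "transfinite_compositions U C K =
     {\<iota> a | (r :: 'u rel) X c \<iota> a.
        small U (Field r) \<and> lambda_sequence_of r C K X \<and>
        is_colimit (ord_cat r) C X c \<iota> \<and> zero_in r a}"

text \<open>\<open>is_pushout C i u f v\<close>: the arrow \<open>f\<close> is the pushout of \<open>i\<close> along \<open>u\<close>.\<close>

definition is_pushout :: "('o, 'm) cat \<Rightarrow> 'm \<Rightarrow> 'm \<Rightarrow> 'm \<Rightarrow> 'm \<Rightarrow> bool" where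
  "is_pushout C i u f v \<longleftrightarrow>
     i \<in> Arr C \<and> u \<in> Arr C \<and> f \<in> Arr C \<and> v \<in> Arr C \<and>
     Dom C u = Dom C i \<and> Dom C f = Cod C u \<and> Dom C v = Cod C i \<and> Cod C v = Cod C f \<and>
     f \<cdot>\<^bsub>C\<^esub> u = v \<cdot>\<^bsub>C\<^esub> i \<and>
     (\<forall>z. \<forall>p \<in> hom C (Cod C u) z. \<forall>q \<in> hom C (Cod C i) z.
        p \<cdot>\<^bsub>C\<^esub> u = q \<cdot>\<^bsub>C\<^esub> i \<longrightarrow>
        (\<exists>!h. h \<in> hom C (Cod C f) z \<and> h \<cdot>\<^bsub>C\<^esub> f = p \<and> h \<cdot>\<^bsub>C\<^esub> v = q))"

definition pushouts :: "('o, 'm) cat \<Rightarrow> 'm set \<Rightarrow> 'm set" where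
  "pushouts C I = {f. \<exists>i \<in> I. \<exists>u v. is_pushout C i u f v}"

definition relative_cell_complexes :: "'u itself \<Rightarrow> ('o, 'm) cat \<Rightarrow> 'm set \<Rightarrow> 'm set" where
  "relative_cell_complexes U C I = transfinite_compositions U C (pushouts C I)"

text \<open>
  The colimit of the sets \<open>hom C w (X b)\<close> over \<open>b\<close> in the ordinal \<open>r\<close>, constructed as the usual
  quotient of the disjoint union, and the comparison map from it to \<open>hom C w c\<close>, which
  sends the class of \<open>f \<in> hom C w (X b)\<close> to the composite of \<open>f\<close> with \<open>\<iota> b\<close>.
\<close>

definition hom_sum ::
    "'i rel \<Rightarrow> ('o, 'm) cat \<Rightarrow> ('i, 'i \<times> 'i, 'o, 'm) fnctr \<Rightarrow> 'o \<Rightarrow> ('i \<times> 'm) set" where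
  "hom_sum r C X w = (SIGMA b : Field r. hom C w (fob X b))"

definition hom_colim ::
    "'i rel \<Rightarrow> ('o, 'm) cat \<Rightarrow> ('i, 'i \<times> 'i, 'o, 'm) fnctr \<Rightarrow> 'o \<Rightarrow> ('i \<times> 'm) set set" where
  "hom_colim r C X w =
     hom_sum r C X w //
       {((b, f), (c, g)). (b, f) \<in> hom_sum r C X w \<and> (c, g) \<in> hom_sum r C X w \<and>
          (\<exists>d. (b, d) \<in> r \<and> (c, d) \<in> r \<and> fmor X (b, d) \<cdot>\<^bsub>C\<^esub> f = fmor X (c, d) \<cdot>\<^bsub>C\<^esub> g)}"

definition hom_colim_map :: "('o, 'm) cat \<Rightarrow> ('i \<Rightarrow> 'm) \<Rightarrow> ('i \<times> 'm) set \<Rightarrow> 'm" where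
  "hom_colim_map C \<iota> E = the_elem ((\<lambda>(b, f). \<iota> b \<cdot>\<^bsub>C\<^esub> f) ` E)"

definition kappa_small_relative ::
    "'u itself \<Rightarrow> 'u rel \<Rightarrow> ('o, 'm) cat \<Rightarrow> 'm set \<Rightarrow> 'o \<Rightarrow> bool" where
  "kappa_small_relative U \<kappa> C K w \<longleftrightarrow>
     (\<forall>r :: 'u rel.
        Card_order r \<and> cinfinite r \<and> regularCard r \<and> small U (Field r) \<and> \<kappa> \<le>o r \<longrightarrow>
        (\<forall>X c \<iota>. lambda_sequence_of r C K X \<and> is_colimit (ord_cat r) C X c \<iota> \<longrightarrow>
           bij_betw (hom_colim_map C \<iota>) (hom_colim r C X w) (hom C w c)))"

definition small_relative :: "'u itself \<Rightarrow> ('o, 'm) cat \<Rightarrow> 'm set \<Rightarrow> 'o \<Rightarrow> bool" where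
  "small_relative U C K w \<longleftrightarrow>
     (\<exists>\<kappa> :: 'u rel. Card_order \<kappa> \<and> small U (Field \<kappa>) \<and> kappa_small_relative U \<kappa> C K w)"

definition permits_small_object_argument :: "'u itself \<Rightarrow> ('o, 'm) cat \<Rightarrow> 'm set \<Rightarrow> bool" where
  "permits_small_object_argument U C I \<longleftrightarrow>
     (\<forall>i \<in> I. small_relative U C (relative_cell_complexes U C I) (Dom C i))"


section \<open>Model categories\<close>

definition lifts_against :: "('o, 'm) cat \<Rightarrow> 'm \<Rightarrow> 'm \<Rightarrow> bool" where
  "lifts_against C i p \<longleftrightarrow>
     (\<forall>f \<in> hom C (Dom C i) (Dom C p). \<forall>g \<in> hom C (Cod C i) (Cod C p).
        p \<cdot>\<^bsub>C\<^esub> f = g \<cdot>\<^bsub>C\<^esub> i \<longrightarrow>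
        (\<exists>h \<in> hom C (Cod C i) (Dom C p). h \<cdot>\<^bsub>C\<^esub> i = f \<and> p \<cdot>\<^bsub>C\<^esub> h = g))"

definition rlp :: "('o, 'm) cat \<Rightarrow> 'm set \<Rightarrow> 'm set" where
  "rlp C K = {p \<in> Arr C. \<forall>i \<in> K. lifts_against C i p}"

definition is_retract :: "('o, 'm) cat \<Rightarrow> 'm \<Rightarrow> 'm \<Rightarrow> bool" where
  "is_retract C f g \<longleftrightarrow>
     f \<in> Arr C \<and> g \<in> Arr C \<and>
     (\<exists>s \<in> hom C (Dom C f) (Dom C g). \<exists>r \<in> hom C (Dom C g) (Dom C f).
      \<exists>s' \<in> hom C (Cod C f) (Cod C g). \<exists>r' \<in> hom C (Cod C g) (Cod C f).
        r \<cdot>\<^bsub>C\<^esub> s = Ident C (Dom C f) \<and> r' \<cdot>\<^bsub>C\<^esub> s' = Ident C (Cod C f) \<and>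
        g \<cdot>\<^bsub>C\<^esub> s = s' \<cdot>\<^bsub>C\<^esub> f \<and> f \<cdot>\<^bsub>C\<^esub> r = r' \<cdot>\<^bsub>C\<^esub> g)"

record 'm model_structure =
  weqs :: "'m set"
  cofs :: "'m set"
  fibs :: "'m set"

locale model_category =
  fixes U :: "'u itself" and C :: "('o, 'm) cat" (structure) and S :: "'m model_structure"
  assumes bicomplete: "bicomplete U C"
    and classes_closed: "weqs S \<subseteq> Arr C" "cofs S \<subseteq> Arr C" "fibs S \<subseteq> Arr C"
    and two_of_three:
      "\<lbrakk>f \<in> hom C x y; g \<in> hom C y z; f \<in> weqs S; g \<in> weqs S\<rbrakk> \<Longrightarrow> g \<cdot> f \<in> weqs S"
      "\<lbrakk>f \<in> hom C x y; g \<in> hom C y z; f \<in> weqs S; g \<cdot> f \<in> weqs S\<rbrakk> \<Longrightarrow> g \<in> weqs S"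
      "\<lbrakk>f \<in> hom C x y; g \<in> hom C y z; g \<in> weqs S; g \<cdot> f \<in> weqs S\<rbrakk> \<Longrightarrow> f \<in> weqs S"
    and retracts:
      "\<lbrakk>is_retract C f g; g \<in> weqs S\<rbrakk> \<Longrightarrow> f \<in> weqs S"
      "\<lbrakk>is_retract C f g; g \<in> cofs S\<rbrakk> \<Longrightarrow> f \<in> cofs S"
      "\<lbrakk>is_retract C f g; g \<in> fibs S\<rbrakk> \<Longrightarrow> f \<in> fibs S"
    and lifting:
      "\<lbrakk>i \<in> cofs S; p \<in> fibs S \<inter> weqs S\<rbrakk> \<Longrightarrow> lifts_against C i p"
      "\<lbrakk>i \<in> cofs S \<inter> weqs S; p \<in> fibs S\<rbrakk> \<Longrightarrow> lifts_against C i p"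
    and factorization:
      "f \<in> hom C x y \<Longrightarrow>
         \<exists>z. \<exists>i \<in> hom C x z. \<exists>p \<in> hom C z y. f = p \<cdot> i \<and> i \<in> cofs S \<and> p \<in> fibs S \<inter> weqs S"
      "f \<in> hom C x y \<Longrightarrow>
         \<exists>z. \<exists>i \<in> hom C x z. \<exists>p \<in> hom C z y. f = p \<cdot> i \<and> i \<in> cofs S \<inter> weqs S \<and> p \<in> fibs S"

locale cofibrantly_generated_model_category = model_category +
  fixes I J
  assumes generators_closed: "I \<subseteq> Arr C" "J \<subseteq> Arr C"
    and generators_small: "small U I" "small U J"
    and small_object_argument:
      "permits_small_object_argument U C I" "permits_small_object_argument U C J"
    and fibs_eq: "fibs S = rlp C J"
    and acyclic_fibs_eq: "fibs S \<inter> weqs S = rlp C I"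

definition quillen_adjunction ::
    "('o, 'm) cat \<Rightarrow> 'm model_structure \<Rightarrow> ('p, 'n) cat \<Rightarrow> 'n model_structure \<Rightarrow>
     ('o, 'm, 'p, 'n) fnctr \<Rightarrow> ('p, 'n, 'o, 'm) fnctr \<Rightarrow> bool" where
  "quillen_adjunction C S D T L R \<longleftrightarrow>
     adjunction C D L R \<and>
     (\<forall>f \<in> cofs S. fmor L f \<in> cofs T) \<and>
     (\<forall>f \<in> cofs S \<inter> weqs S. fmor L f \<in> cofs T \<inter> weqs T)"

text \<open>The structure \<open>T\<close> on \<open>D\<close> is right-induced along \<open>F : D \<rightarrow> C\<close> from the structure \<open>S\<close> on \<open>C\<close>.\<close>

definition right_induced ::
    "('p, 'n) cat \<Rightarrow> 'n model_structure \<Rightarrow> 'm model_structure \<Rightarrow> ('p, 'n, 'o, 'm) fnctr \<Rightarrow> bool" where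
  "right_induced D T S F \<longleftrightarrow>
     (\<forall>f \<in> Arr D. (f \<in> weqs T \<longleftrightarrow> fmor F f \<in> weqs S) \<and> (f \<in> fibs T \<longleftrightarrow> fmor F f \<in> fibs S))"

end

theory Submission
  imports Defs
begin

text \<open>
  Fibrations and acyclic fibrations of \<open>N\<close> have to be the arrows with the right lifting property
  against \<open>LJ\<close> and \<open>LI\<close>: by adjunction (\<open>lifts_against_adjoint\<close>) an arrow \<open>p\<close> has it if and only if \<open>F p\<close> has
  it against \<open>J\<close> or \<open>I\<close>. Cofibrations are then forced too, and what remains is the usual transfer
  argument: the small object argument has to apply to \<open>LI\<close> and \<open>LJ\<close>, and relative \<open>LJ\<close>-cell complexes have
  to be weak equivalences. The right adjoint \<open>R\<close> of \<open>F\<close> gives both.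

  A relative \<open>LJ\<close>-cell complex \<open>f\<close> is sent by \<open>F\<close> to an acyclic cofibration: for a fibration \<open>p\<close> of \<open>M\<close>, lifting
  \<open>F f\<close> against \<open>p\<close> amounts to lifting \<open>f\<close> against \<open>R p\<close>; cell complexes lift against whatever the generators
  \<open>L j\<close> lift against; and \<open>L j\<close> lifts against \<open>R p\<close> because \<open>F L j\<close>, an acyclic cofibration by the Quillen
  hypothesis, lifts against \<open>p\<close> (\<open>cell_complexes_image_llp\<close>). In the same way \<open>F\<close> sends relative \<open>LI\<close>-cell
  complexes to cofibrations.

  For the smallness of \<open>L A\<close>, with \<open>A\<close> a domain of a generator, let \<open>X\<close> be a sequence of relative cell complexes in
  \<open>N\<close>. As a left adjoint \<open>F\<close> preserves its colimit, and arrows \<open>L A \<rightarrow> X b\<close> are arrows \<open>A \<rightarrow> F (X b)\<close>, so it is enough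
  that \<open>A\<close> be small relative to the sequence \<open>F X\<close>. This is a sequence of (acyclic) cofibrations but in general not
  of relative cell complexes, while only smallness relative to the latter is given. The gap is closed by
  \<open>small_relative_llp\<close>: a sequence of cofibrations is a retract of a sequence of relative cell complexes.

  That lemma, and the factorizations in \<open>N\<close>, rest on the small object argument
  (\<open>small_object_argument\<close>). It is carried out by attaching one cell per step, so that the composite of any
  interval of steps is a relative cell complex by definition, without coproducts of generators.
  The sequence runs through all small ordinals, that is, through the well-order \<open>ord\<close> on \<open>'u\<close>; a bookkeeping
  function ensures that each square occurring at some stage is solved at a later one; and since \<open>'u\<close> is
  inaccessible there is a small ordinal \<open>\<beta>\<close>, a limit of regular cofinality large enough for the smallness
  of the domains, such that all the squares over a cofinal set of stages below \<open>\<beta>\<close> are solved at \<open>\<beta>\<close>.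
\<close>

section \<open>Ordinals\<close>

locale well_ordering =
  fixes r :: "'i rel"
  assumes wo: "Well_order r"
begin

abbreviation below :: "'i \<Rightarrow> 'i set" where "below \<equiv> Order_Relation.underS r"

lemma wo_rel: "wo_rel r" using wo unfolding wo_rel_def .

lemma le_refl: "a \<in> Field r \<Longrightarrow> (a, a) \<in> r"
  using wo_rel.REFL[OF wo_rel] unfolding refl_on_def by blast

lemma le_trans: "(a, b) \<in> r \<Longrightarrow> (b, c) \<in> r \<Longrightarrow> (a, c) \<in> r"
  using wo_rel.TRANS[OF wo_rel] unfolding trans_def by blast

lemma le_antisym: "(a, b) \<in> r \<Longrightarrow> (b, a) \<in> r \<Longrightarrow> a = b"
  using wo_rel.ANTISYM[OF wo_rel] unfolding antisym_def by blast

lemma le_total: "a \<in> Field r \<Longrightarrow> b \<in> Field r \<Longrightarrow> (a, b) \<in> r \<or> (b, a) \<in> r"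
  using wo_rel.TOTALS[OF wo_rel] by blast

lemma in_Field: "(a, b) \<in> r \<Longrightarrow> a \<in> Field r \<and> b \<in> Field r"
  by (auto intro: FieldI1 FieldI2)

lemma below_iff: "a \<in> below b \<longleftrightarrow> a \<noteq> b \<and> (a, b) \<in> r"
  by (auto simp: underS_def)

lemma below_Field: "a \<in> below b \<Longrightarrow> a \<in> Field r \<and> b \<in> Field r"
  using in_Field below_iff by blast

lemma below_trans: "a \<in> below b \<Longrightarrow> b \<in> below c \<Longrightarrow> a \<in> below c"
  using le_trans le_antisym by (metis below_iff)

lemma le_below_trans: "(a, b) \<in> r \<Longrightarrow> b \<in> below c \<Longrightarrow> a \<in> below c"
  using le_trans le_antisym by (metis below_iff)

lemma below_le_trans: "a \<in> below b \<Longrightarrow> (b, c) \<in> r \<Longrightarrow> a \<in> below c"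
  using le_trans le_antisym by (metis below_iff)

lemma not_le: "a \<in> Field r \<Longrightarrow> b \<in> Field r \<Longrightarrow> (a, b) \<notin> r \<longleftrightarrow> b \<in> below a"
  using le_total le_antisym le_refl by (metis below_iff)

lemma wf_below: "wf {(a, b). a \<in> below b}"
proof -
  have "{(a, b). a \<in> below b} = r - Id" by (auto simp: below_iff)
  then show ?thesis using wo_rel.WF[OF wo_rel] by simp
qed

lemma least_ex:
  assumes "A \<subseteq> Field r" "A \<noteq> {}"
  obtains m where "m \<in> A" "\<forall>a \<in> A. (m, a) \<in> r"
proof -
  obtain m where m: "m \<in> A" "\<And>y. y \<in> below m \<Longrightarrow> y \<notin> A"
    using wfE_min[OF wf_below] assms(2) by (metis all_not_in_conv case_prodI mem_Collect_eq)
  have "(m, a) \<in> r" if "a \<in> A" for a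
    using m that not_le assms(1) by (meson subsetD)
  then show ?thesis using that m by blast
qed

lemma succ_unique: "succ_in r b c \<Longrightarrow> succ_in r b' c \<Longrightarrow> b = b'"
  unfolding succ_in_def by (metis in_Field le_total)

lemma succ_below: "succ_in r b c \<Longrightarrow> b \<in> below c"
  unfolding succ_in_def by (simp add: below_iff)

lemma below_succ_iff:
  assumes s: "succ_in r b c"
  shows "a \<in> below c \<longleftrightarrow> (a, b) \<in> r"
proof
  assume a: "a \<in> below c"
  show "(a, b) \<in> r"
  proof (rule ccontr)
    assume "(a, b) \<notin> r"
    then have "b \<in> below a"
      using not_le below_Field[OF a] below_Field[OF succ_below[OF s]] by blast
    then show False using s a unfolding succ_in_def by (auto simp: below_iff)
  qed
next
  assume "(a, b) \<in> r"
  then show "a \<in> below c" using succ_below[OF s] by (rule le_below_trans)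
qed

lemma succ_ex:
  assumes "b \<in> below d"
  obtains c where "succ_in r b c" "(c, d) \<in> r"
proof -
  have "{a. b \<in> below a} \<subseteq> Field r" "{a. b \<in> below a} \<noteq> {}"
    using assms below_Field by auto
  then obtain c where c: "b \<in> below c" "\<And>a. b \<in> below a \<Longrightarrow> (c, a) \<in> r"
    by (rule least_ex) auto
  have "succ_in r b c"
    unfolding succ_in_def
  proof (intro conjI allI impI)
    show "(b, c) \<in> r" "b \<noteq> c" using c(1) by (auto simp: below_iff)
    fix d assume d: "(b, d) \<in> r \<and> (d, c) \<in> r"
    then show "d = b \<or> d = c" using c(2)[of d] le_antisym[of d c] by (auto simp: below_iff)
  qed
  then show ?thesis using that c(2) assms by blast
qed

lemma trichotomy:
  assumes "c \<in> Field r"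
  obtains (zero) "zero_in r c" | (succ) b where "succ_in r b c" | (limit) "limit_in r c"
  using assms unfolding limit_in_def by blast

lemma limit_dense:
  assumes "limit_in r c" "b \<in> below c"
  obtains b' where "b \<in> below b'" "b' \<in> below c"
proof -
  obtain b' where b': "succ_in r b b'" "(b', c) \<in> r" using succ_ex[OF assms(2)] .
  then have "b' \<noteq> c" using assms(1) unfolding limit_in_def by blast
  then show ?thesis using that[OF succ_below[OF b'(1)]] b'(2) by (simp add: below_iff)
qed

lemma zero_le:
  assumes "zero_in r a" "b \<in> Field r"
  shows "(a, b) \<in> r"
  using not_le[of a b] assms unfolding zero_in_def by blast

lemma zero_ex:
  assumes "Field r \<noteq> {}"
  obtains a where "zero_in r a"
proof -
  obtain a where a: "a \<in> Field r" "\<forall>b \<in> Field r. (a, b) \<in> r"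
    using least_ex[OF order_refl assms] .
  have "below a = {}"
  proof (rule equals0I)
    fix b assume b: "b \<in> below a"
    then have "(a, b) \<in> r" using a(2) below_Field by blast
    then show False using b le_antisym by (auto simp: below_iff)
  qed
  then have "zero_in r a" unfolding zero_in_def using a(1) by simp
  then show ?thesis by (rule that)
qed

end


section \<open>Small sets\<close>

locale universe =
  fixes U :: "'u itself"
  assumes univ: "grothendieck_universe U"
begin

abbreviation ord :: "'u rel" where "ord \<equiv> |UNIV :: 'u set|"

lemma ord_Card_order: "Card_order ord" by (rule card_of_Card_order)

lemma Field_ord: "Field ord = UNIV" by (rule Field_card_of)

sublocale ord: well_ordering ord
  by unfold_locales (rule card_of_Well_order)

lemma ord_Cinfinite: "Cinfinite ord"
  using univ unfolding grothendieck_universe_def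
  by (blast intro: cinfinite_mono[OF ordLess_imp_ordLeq] natLeq_cinfinite card_of_Card_order)

lemma infinite_u: "infinite (UNIV :: 'u set)"
  using ord_Cinfinite unfolding cinfinite_def by (simp add: Field_ord)

lemma ord_regular: "regularCard ord"
  using univ unfolding grothendieck_universe_def by blast

lemma ord_stable: "stable ord"
  using ord_Cinfinite ord_regular regularCard_stable cinfinite_def by auto

lemma small_nat: "small U (UNIV :: nat set)"
proof -
  have "natLeq <o ord" using univ unfolding grothendieck_universe_def by blast
  then show ?thesis unfolding small_def by (rule ordIso_ordLess_trans[OF card_of_nat])
qed

lemma small_inj:
  assumes "small U B" "inj_on f A" "f ` A \<subseteq> B"
  shows "small U A"
proof -
  have "|A| \<le>o |B|" using assms(2,3) card_of_ordLeq[of A B] by blast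
  then show ?thesis using assms(1) unfolding small_def by (rule ordLeq_ordLess_trans)
qed

lemma small_surj:
  assumes "small U B" "A \<subseteq> f ` B"
  shows "small U A"
  using ordLeq_ordLess_trans[OF ordLeq_transitive[OF card_of_mono1[OF assms(2)] card_of_image]] assms(1)
  unfolding small_def by blast

lemma small_subset: "small U B \<Longrightarrow> A \<subseteq> B \<Longrightarrow> small U A"
  by (rule small_surj[where f = id]) auto

lemma small_finite: "finite A \<Longrightarrow> small U A"
  unfolding small_def
  by (rule finite_ordLess_infinite[OF card_of_Well_order card_of_Well_order])
    (simp_all add: Field_card_of infinite_u)

lemma small_Sigma:
  assumes "small U A" "\<And>a. a \<in> A \<Longrightarrow> small U (B a)"
  shows "small U (SIGMA a : A. B a)"
  using stable_elim[OF ord_stable] assms unfolding small_def by blast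

lemma small_Plus: "small U A \<Longrightarrow> small U B \<Longrightarrow> small U (A <+> B)"
  unfolding small_def using card_of_Plus_ordLess_infinite[OF infinite_u] .

lemma small_Un:
  assumes "small U A" "small U B"
  shows "small U (A \<union> B)"
proof (rule small_surj[OF small_Plus[OF assms], where f = "case_sum id id"], rule subsetI)
  fix x assume "x \<in> A \<union> B"
  then show "x \<in> case_sum id id ` (A <+> B)"
    using rev_image_eqI[of "Inl x" "A <+> B" x "case_sum id id"]
      rev_image_eqI[of "Inr x" "A <+> B" x "case_sum id id"] by auto
qed

lemma small_inj_ex:
  assumes "small U A"
  obtains e :: "'a \<Rightarrow> 'u" where "inj_on e A"
proof -
  have "|A| \<le>o ord" using assms unfolding small_def by (rule ordLess_imp_ordLeq)
  then have "\<exists>e :: 'a \<Rightarrow> 'u. inj_on e A" using card_of_ordLeq[of A "UNIV :: 'u set"] by auto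
  then show ?thesis using that by auto
qed

lemma small_surj_ex:
  assumes "small U A" "A \<noteq> {}"
  shows "\<exists>e :: 'u \<Rightarrow> 'a. e ` UNIV = A"
  using assms(1) card_of_ordLeq2[OF assms(2), where B = "UNIV :: 'u set"] ordLess_imp_ordLeq
  unfolding small_def by blast

lemma small_Pow:
  assumes "small U A"
  shows "small U (Pow A)"
proof -
  obtain e :: "_ \<Rightarrow> 'u" where e: "inj_on e A" using small_inj_ex[OF assms] .
  have "small U (e ` A)" using assms by (rule small_surj) (rule order_refl)
  then have "small U (Pow (e ` A))"
    using univ unfolding grothendieck_universe_def small_def by blast
  moreover have "inj_on ((`) e) (Pow A)" using e by (rule inj_on_image_Pow)
  ultimately show ?thesis by (rule small_inj) blast
qed

text \<open>
  An unbounded set of small ordinals would have the cardinality of \<open>'u\<close>, by regularity.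
\<close>

lemma small_bounded:
  assumes "small U (A :: 'u set)"
  obtains b where "A \<subseteq> ord.below b"
proof -
  have "\<not> |A| =o ord"
    using not_ordLess_ordIso[of "|A|" ord] assms unfolding small_def by blast
  then have "\<not> cofinal A ord"
    using ord_regular unfolding regularCard_def by (auto simp: Field_ord)
  then obtain a where a: "\<And>b. b \<in> A \<Longrightarrow> \<not> (a \<noteq> b \<and> (a, b) \<in> ord)"
    unfolding cofinal_def by blast
  have tot: "(b, a) \<in> ord" if "b \<in> A" for b
    using a[OF that] ord.le_total[of a b] ord.le_refl[of a] Field_ord by auto
  obtain b where b: "a \<in> ord.below b"
    using infinite_Card_order_limit[OF ord_Card_order, of a] infinite_u
    unfolding Field_ord ord.below_iff by blast
  have "c \<in> ord.below b" if "c \<in> A" for c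
    using ord.le_below_trans[OF tot[OF that] b] .
  then show ?thesis using that by blast
qed

lemma small_below: "small U (ord.below b)"
  unfolding small_def by (rule card_of_underS[OF ord_Card_order]) (simp add: Field_ord)

text \<open>
  The cardinal is the successor of the disjoint sum of the given cardinals and \<open>\<nat>\<close>. Successors are
  regular, and this one is still small because it is bounded by a power set.
\<close>

lemma regular_cardinal_above:
  assumes K: "small U K" and \<kappa>: "\<And>i. i \<in> K \<Longrightarrow> Card_order (\<kappa> i) \<and> small U (Field (\<kappa> i :: 'u rel))"
  obtains r :: "'u rel" where "Card_order r" "cinfinite r" "regularCard r" "small U (Field r)"
    "\<forall>i \<in> K. \<kappa> i \<le>o r"
proof -
  define B where "B = (SIGMA i : K. Field (\<kappa> i)) <+> (UNIV :: nat set)"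
  have B: "small U B" unfolding B_def
    using K \<kappa> by (intro small_Plus small_Sigma small_nat) auto
  have inf: "Cinfinite |B|"
    using card_of_Card_order[of B] unfolding cinfinite_def Field_card_of by (simp add: B_def)
  define s where "s = cardSuc |B|"
  have s: "Cinfinite s" "regularCard s"
    unfolding s_def using inf by (simp_all add: Cinfinite_cardSuc regularCard_cardSuc)
  have "s \<le>o |Pow B|" unfolding s_def
    by (rule cardSuc_least[OF card_of_Card_order card_of_Card_order card_of_Pow])
  then have s_small: "s <o ord"
    using small_Pow[OF B] unfolding small_def by (rule ordLeq_ordLess_trans)
  have Fs: "|Field s| =o s" using s by (simp add: card_of_Field_ordIso)
  then have fs: "small U (Field s)" unfolding small_def using s_small by (rule ordIso_ordLess_trans)
  then obtain e :: "_ \<Rightarrow> 'u" where e: "inj_on e (Field s)" by (rule small_inj_ex)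
  have "|Field s| =o |e ` Field s|"
    using inj_on_imp_bij_betw[OF e] card_of_ordIso by metis
  then have iso: "s =o |e ` Field s|" by (rule ordIso_transitive[OF ordIso_symmetric[OF Fs]])
  show ?thesis
  proof (rule that[of "|e ` Field s|"])
    show "Card_order |e ` Field s|" by (rule card_of_Card_order)
    show "cinfinite |e ` Field s|"
      using s e unfolding cinfinite_def by (simp add: finite_image_iff Field_card_of)
    show "regularCard |e ` Field s|" by (rule regularCard_ordIso[OF iso s])
    show "small U (Field |e ` Field s| )"
      using small_surj[OF fs order_refl] by (simp add: Field_card_of)
    show "\<forall>i \<in> K. \<kappa> i \<le>o |e ` Field s|"
    proof
      fix i assume i: "i \<in> K"
      have "\<kappa> i =o |Field (\<kappa> i)|"
        using \<kappa>[OF i] card_of_Field_ordIso[of "\<kappa> i"] by (blast intro: ordIso_symmetric)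
      moreover have "|Field (\<kappa> i)| \<le>o |B|"
      proof -
        have "inj_on (\<lambda>a. Inl (i, a)) (Field (\<kappa> i))" "(\<lambda>a. Inl (i, a)) ` Field (\<kappa> i) \<subseteq> B"
          using i unfolding B_def inj_on_def by auto
        then show ?thesis using card_of_ordLeq[of "Field (\<kappa> i)" B] by blast
      qed
      moreover have "|B| \<le>o s" unfolding s_def by (rule cardSuc_ordLeq[OF card_of_Card_order])
      ultimately have "\<kappa> i \<le>o s" using ordIso_ordLeq_trans ordLeq_transitive by blast
      then show "\<kappa> i \<le>o |e ` Field s|" using iso by (rule ordLeq_ordIso_trans)
    qed
  qed
qed

lemma pairing: obtains f :: "'u \<times> 'u \<Rightarrow> 'u" where "bij f"
proof -
  have "|UNIV \<times> UNIV :: ('u \<times> 'u) set| =o ord"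
    using card_of_Times_same_infinite[OF infinite_u] .
  then obtain f :: "'u \<times> 'u \<Rightarrow> 'u" where "bij f"
    using card_of_ordIso[of "UNIV \<times> UNIV :: ('u \<times> 'u) set" "UNIV :: 'u set"] by auto
  then show ?thesis by (rule that)
qed

text \<open>
  Since \<open>'u \<times> 'u \<times> 'u\<close> has the cardinality of \<open>'u\<close>, there is an enumeration of the pairs that hits
  each of them at unboundedly many ordinals: it drives the bookkeeping in the small object argument.
\<close>

lemma bookkeeping:
  obtains d :: "'u \<Rightarrow> 'u \<times> 'u" where "\<And>\<gamma> t \<alpha>. \<exists>\<beta>. (\<alpha>, \<beta>) \<in> ord \<and> d \<beta> = (\<gamma>, t)"
proof -
  obtain f :: "'u \<times> 'u \<Rightarrow> 'u" where f: "bij f" using pairing .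
  define d where "d = inv f \<circ> fst \<circ> inv f"
  have "\<exists>\<beta>. (\<alpha>, \<beta>) \<in> ord \<and> d \<beta> = (\<gamma>, t)" for \<gamma> t \<alpha>
  proof (rule ccontr)
    assume none: "\<not> (\<exists>\<beta>. (\<alpha>, \<beta>) \<in> ord \<and> d \<beta> = (\<gamma>, t))"
    define g where "g = (\<lambda>s. f (f (\<gamma>, t), s))"
    have "d (g s) = (\<gamma>, t)" for s
      using f unfolding d_def g_def by (simp add: bij_is_inj)
    then have "(\<alpha>, g s) \<notin> ord" for s using none by blast
    then have "g s \<in> ord.below \<alpha>" for s
      using ord.not_le Field_ord by blast
    then have "range g \<subseteq> ord.below \<alpha>" by blast
    moreover have "inj g" using f unfolding g_def inj_on_def
      by (simp add: bij_is_inj inj_eq)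
    ultimately have "small U (UNIV :: 'u set)" using small_inj small_below by blast
    then show False unfolding small_def using ordLess_irreflexive by blast
  qed
  then show ?thesis using that by blast
qed

end

section \<open>Categories and colimits\<close>

lemma homD: "f \<in> hom C x y \<Longrightarrow> f \<in> Arr C \<and> Dom C f = x \<and> Cod C f = y"
  by (simp add: hom_def)

lemma Arr_hom: "f \<in> Arr C \<Longrightarrow> f \<in> hom C (Dom C f) (Cod C f)"
  by (simp add: hom_def)

context category
begin

lemma hom_Ob: "f \<in> hom C x y \<Longrightarrow> x \<in> Ob C \<and> y \<in> Ob C"
  using dom_closed cod_closed by (auto simp: hom_def)

end

lemma ord_cat_simps [simp]:
  "Ob (ord_cat r) = Field r" "Arr (ord_cat r) = r" "Dom (ord_cat r) = fst" "Cod (ord_cat r) = snd"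
  by (simp_all add: ord_cat_def)

lemma category_ord_cat:
  assumes "Refl r" "trans r"
  shows "category (ord_cat r)"
  using assms
  by unfold_locales
    (auto simp: ord_cat_def hom_def refl_on_def FieldI1 FieldI2 dest: transD)

lemma cat_functor_ord_iff:
  assumes "Refl r" "trans r" "category C"
  shows "cat_functor (ord_cat r) C X \<longleftrightarrow>
    (\<forall>a \<in> Field r. fob X a \<in> Ob C \<and> fmor X (a, a) = Ident C (fob X a)) \<and>
    (\<forall>a b. (a, b) \<in> r \<longrightarrow> fmor X (a, b) \<in> hom C (fob X a) (fob X b)) \<and>
    (\<forall>a b c. (a, b) \<in> r \<longrightarrow> (b, c) \<in> r \<longrightarrow>
        fmor X (a, c) = fmor X (b, c) \<cdot>\<^bsub>C\<^esub> fmor X (a, b))"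
proof -
  have D: "category (ord_cat r)" using category_ord_cat assms by blast
  have I: "Ident (ord_cat r) a = (a, a)" "Comp (ord_cat r) g f = (fst f, snd g)" for a g f
    by (simp_all add: ord_cat_def)
  have H: "f \<in> hom (ord_cat r) a b \<longleftrightarrow> f = (a, b) \<and> (a, b) \<in> r" for f a b
    by (auto simp: hom_def)
  show ?thesis
    unfolding cat_functor_def cat_functor_axioms_def
    using D assms(3) by (simp add: H I imp_conjL) blast
qed

lemma cocone_ord_iff:
  "cocone (ord_cat r) C X c \<iota> \<longleftrightarrow>
    c \<in> Ob C \<and> (\<forall>a \<in> Field r. \<iota> a \<in> hom C (fob X a) c) \<and>
    (\<forall>a b. (a, b) \<in> r \<longrightarrow> \<iota> b \<cdot>\<^bsub>C\<^esub> fmor X (a, b) = \<iota> a)"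
  unfolding cocone_def by auto

lemma colimit_cocone: "is_colimit D C X c \<iota> \<Longrightarrow> cocone D C X c \<iota>"
  unfolding is_colimit_def by blast

lemma colimit_desc:
  assumes "is_colimit D C X c \<iota>" "cocone D C X c' \<iota>'"
  obtains h where "h \<in> hom C c c'" "\<And>d. d \<in> Ob D \<Longrightarrow> h \<cdot>\<^bsub>C\<^esub> \<iota> d = \<iota>' d"
  using assms unfolding is_colimit_def by blast

lemma cocone_comp:
  fixes C :: "('o, 'm) cat" (structure)
  assumes "category C" "cat_functor D C X" "cocone D C X c \<iota>" "h \<in> hom C c c'"
  shows "cocone D C X c' (\<lambda>d. h \<cdot> \<iota> d)"
proof -
  interpret C: category C by fact
  interpret X: cat_functor D C X by fact
  show ?thesis unfolding cocone_def
  proof (intro conjI ballI)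
    show "c' \<in> Ob C" using assms(4) C.hom_Ob by blast
    fix d assume "d \<in> Ob D"
    then have "\<iota> d \<in> hom C (fob X d) c" using assms(3) unfolding cocone_def by blast
    then show "h \<cdot> \<iota> d \<in> hom C (fob X d) c'" using assms(4) by (rule C.comp_closed)
  next
    fix a assume a: "a \<in> Arr D"
    then have "fmor X a \<in> hom C (fob X (Dom D a)) (fob X (Cod D a))"
      using X.fmor_closed Arr_hom by metis
    moreover have "\<iota> (Cod D a) \<in> hom C (fob X (Cod D a)) c" "\<iota> (Cod D a) \<cdot> fmor X a = \<iota> (Dom D a)"
      using assms(3) a X.source.cod_closed unfolding cocone_def by blast+
    ultimately show "h \<cdot> \<iota> (Cod D a) \<cdot> fmor X a = h \<cdot> \<iota> (Dom D a)"
      using assms(4) C.comp_assoc by metis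
  qed
qed

lemma colimit_ext:
  fixes C :: "('o, 'm) cat" (structure)
  assumes "category C" "cat_functor D C X" "is_colimit D C X c \<iota>"
    and "h \<in> hom C c c'" "k \<in> hom C c c'"
    and "\<And>d. d \<in> Ob D \<Longrightarrow> h \<cdot> \<iota> d = k \<cdot> \<iota> d"
  shows "h = k"
proof -
  have "cocone D C X c' (\<lambda>d. k \<cdot> \<iota> d)"
    using cocone_comp assms colimit_cocone by metis
  then have "\<exists>!h. h \<in> hom C c c' \<and> (\<forall>d \<in> Ob D. h \<cdot> \<iota> d = k \<cdot> \<iota> d)"
    using assms(3) unfolding is_colimit_def by blast
  then show ?thesis using assms(4-6) by blast
qed

lemma pushout_ext:
  fixes C :: "('o, 'm) cat" (structure)
  assumes "is_pushout C i u f v" "h \<in> hom C (Cod C f) z" "k \<in> hom C (Cod C f) z"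
    and "category C"
    and "h \<cdot> f = k \<cdot> f" "h \<cdot> v = k \<cdot> v"
  shows "h = k"
proof -
  interpret category C by fact
  have A: "i \<in> hom C (Dom C i) (Cod C i)" "u \<in> hom C (Dom C i) (Cod C u)"
    "f \<in> hom C (Cod C u) (Cod C f)" "v \<in> hom C (Cod C i) (Cod C f)" "f \<cdot> u = v \<cdot> i"
    using assms(1) unfolding is_pushout_def by (auto simp: hom_def)
  have "k \<cdot> f \<in> hom C (Cod C u) z" "k \<cdot> v \<in> hom C (Cod C i) z"
    using A assms(3) comp_closed by blast+
  moreover have "k \<cdot> f \<cdot> u = k \<cdot> v \<cdot> i"
    using A assms(3) comp_assoc by metis
  ultimately have "\<exists>!h. h \<in> hom C (Cod C f) z \<and> h \<cdot> f = k \<cdot> f \<and> h \<cdot> v = k \<cdot> v"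
    using assms(1) unfolding is_pushout_def by blast
  then show ?thesis using assms by blast
qed

locale bicomplete_category = universe U + category C
  for U :: "'u itself" and C :: "('o, 'm) cat" (structure) +
  assumes bicomplete: "bicomplete U C"
begin

lemma small_hom: "x \<in> Ob C \<Longrightarrow> y \<in> Ob C \<Longrightarrow> small U (hom C x y)"
  using bicomplete unfolding bicomplete_def locally_small_def by blast

text \<open>
  Index categories with objects and arrows in \<open>'u\<close> include, up to renaming the arrows \<open>(a, b)\<close>, all
  small preorders on \<open>'u\<close>.
\<close>

lemma ord_colimit_ex:
  fixes r :: "'u rel"
  assumes r: "Refl r" "trans r" "small U (Field r)" and X: "cat_functor (ord_cat r) C X"
  obtains c \<iota> where "is_colimit (ord_cat r) C X c \<iota>"
proof -
  obtain g :: "'u \<times> 'u \<Rightarrow> 'u" where g: "bij g" using pairing .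
  have gi [simp]: "inv g (g p) = p" for p using g by (simp add: bij_is_inj)
  define D where "D = \<lparr>Ob = Field r, Arr = g ` r, Dom = fst \<circ> inv g, Cod = snd \<circ> inv g,
    Ident = (\<lambda>a. g (a, a)), Comp = (\<lambda>m n. g (fst (inv g n), snd (inv g m)))\<rparr>"
  define X' where "X' = \<lparr>fob = fob X, fmor = fmor X \<circ> inv g\<rparr>"
  have D [simp]: "Ob D = Field r" "Arr D = g ` r" "Dom D m = fst (inv g m)" "Cod D m = snd (inv g m)"
    "Ident D a = g (a, a)" "Comp D m n = g (fst (inv g n), snd (inv g m))" for m n a
    by (simp_all add: D_def)
  have X' [simp]: "fob X' a = fob X a" "fmor X' m = fmor X (inv g m)" for a m
    by (simp_all add: X'_def)
  have hom: "m \<in> hom D a b \<longleftrightarrow> m = g (a, b) \<and> (a, b) \<in> r" for m a b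
    by (auto simp: hom_def)
  have "category D"
    by unfold_locales
      (use r(1) in \<open>auto simp: hom refl_on_def FieldI1 FieldI2 intro: transD[OF r(2)]\<close>)
  then have "cat_functor D C X'"
    using X category_axioms unfolding cat_functor_ord_iff[OF r(1,2) category_axioms]
    by (intro cat_functor.intro cat_functor_axioms.intro) (auto simp: hom)
  moreover have "small U (Arr D)"
  proof -
    have "small U (Field r \<times> Field r)" using r(3) by (intro small_Sigma)
    then have "small U r" by (rule small_subset) (auto intro: FieldI1 FieldI2)
    then show ?thesis by (rule small_surj[where f = g]) simp
  qed
  ultimately obtain c \<iota> where c: "is_colimit D C X' c \<iota>"
    using bicomplete r(3) D(1) unfolding bicomplete_def by metis
  have "cocone D C X' c \<iota> \<longleftrightarrow> cocone (ord_cat r) C X c \<iota>" for c \<iota>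
    unfolding cocone_def by auto
  then have "is_colimit (ord_cat r) C X c \<iota>" using c unfolding is_colimit_def by simp
  then show ?thesis by (rule that)
qed

lemma pushout_ex:
  assumes i: "i \<in> hom C a b" and u: "u \<in> hom C a x"
  obtains f v y where "is_pushout C i u f v" "f \<in> hom C x y" "v \<in> hom C b y" "f \<cdot> u = v \<cdot> i"
proof -
  \<comment> \<open>The index category is the preorder \<open>2 \<ge> 0 \<le> 1\<close>, copied into \<open>'u\<close>.\<close>
  obtain e :: "nat \<Rightarrow> 'u" where "inj e" using small_inj_ex[OF small_nat] .
  then have e: "e m = e n \<longleftrightarrow> m = n" for m n by (simp add: inj_eq)
  define r :: "'u rel" where
    "r = {(e 0, e 0), (e 1, e 1), (e 2, e 2), (e 0, e 1), (e 0, e 2)}"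
  have F: "Field r = {e 0, e 1, e 2}" unfolding r_def Field_def by auto
  have refl: "Refl r" unfolding refl_on_def F by (auto simp: r_def)
  have trans: "trans r" unfolding trans_def r_def by (auto simp: e)
  have ob: "a \<in> Ob C" "b \<in> Ob C" "x \<in> Ob C" using i u hom_Ob by blast+
  define X :: "('u, 'u \<times> 'u, 'o, 'm) fnctr" where
    "X = \<lparr>fob = (\<lambda>n. if n = e 0 then a else if n = e 1 then x else b),
      fmor = (\<lambda>(m, n). if m = n then Ident C (if n = e 0 then a else if n = e 1 then x else b)
                else if n = e 1 then u else i)\<rparr>"
  have X: "cat_functor (ord_cat r) C X"
    unfolding cat_functor_ord_iff[OF refl trans category_axioms]
    using i u ob ident_closed ident_left ident_right ident_left[OF ident_closed]
    by (auto simp: X_def r_def F e)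
  have "small U (Field r)" unfolding F by (rule small_finite) simp
  then obtain c \<iota> where c: "is_colimit (ord_cat r) C X c \<iota>"
    using ord_colimit_ex[OF refl trans _ X] by blast
  have *: "cocone (ord_cat r) C X c' \<iota>' \<longleftrightarrow> c' \<in> Ob C \<and> \<iota>' (e 0) \<in> hom C a c' \<and> \<iota>' (e 1) \<in> hom C x c' \<and>
      \<iota>' (e 2) \<in> hom C b c' \<and> \<iota>' (e 1) \<cdot> u = \<iota>' (e 0) \<and> \<iota>' (e 2) \<cdot> i = \<iota>' (e 0)" for c' \<iota>'
    unfolding cocone_ord_iff F using ident_right by (auto simp: X_def r_def e)
  have cc: "\<iota> (e 1) \<in> hom C x c" "\<iota> (e 2) \<in> hom C b c" "\<iota> (e 1) \<cdot> u = \<iota> (e 0)" "\<iota> (e 2) \<cdot> i = \<iota> (e 0)"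
    using colimit_cocone[OF c] * by auto
  have "is_pushout C i u (\<iota> (e 1)) (\<iota> (e 2))"
    unfolding is_pushout_def
  proof (intro conjI allI ballI impI)
    fix z p q assume pq: "p \<in> hom C (Cod C u) z" "q \<in> hom C (Cod C i) z" "p \<cdot> u = q \<cdot> i"
    define \<iota>' where "\<iota>' = (\<lambda>n. if n = e 0 then p \<cdot> u else if n = e 1 then p else q)"
    have pq': "p \<in> hom C x z" "q \<in> hom C b z" using pq i u by (auto simp: hom_def)
    have "cocone (ord_cat r) C X z \<iota>'"
      unfolding * using pq' pq(3) hom_Ob[OF pq'(1)] comp_closed[OF u pq'(1)] by (simp add: \<iota>'_def e)
    then have "\<exists>!h. h \<in> hom C c z \<and> (\<forall>d \<in> Ob (ord_cat r). h \<cdot> \<iota> d = \<iota>' d)"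
      using c unfolding is_colimit_def by blast
    moreover have "(\<forall>d \<in> Ob (ord_cat r). h \<cdot> \<iota> d = \<iota>' d) \<longleftrightarrow> h \<cdot> \<iota> (e 1) = p \<and> h \<cdot> \<iota> (e 2) = q"
      if h: "h \<in> hom C c z" for h
      using cc(3) comp_assoc[OF u cc(1) h] by (auto simp: F \<iota>'_def e)
    ultimately have "\<exists>!h. h \<in> hom C c z \<and> h \<cdot> \<iota> (e 1) = p \<and> h \<cdot> \<iota> (e 2) = q" by metis
    moreover have "Cod C (\<iota> (e 1)) = c" using cc by (simp add: hom_def)
    ultimately show "\<exists>!h. h \<in> hom C (Cod C (\<iota> (e 1))) z \<and> h \<cdot> \<iota> (e 1) = p \<and> h \<cdot> \<iota> (e 2) = q" by simp
  qed (use cc i u in \<open>auto simp: hom_def\<close>)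
  then show ?thesis using cc by (intro that[of "\<iota> (e 1)" "\<iota> (e 2)" c]) auto
qed

end

section \<open>Transfinite constructions\<close>

definition natural ::
    "'i rel \<Rightarrow> ('o, 'm) cat \<Rightarrow> ('i, 'i \<times> 'i, 'o, 'm) fnctr \<Rightarrow> ('i, 'i \<times> 'i, 'o, 'm) fnctr \<Rightarrow>
      ('i \<Rightarrow> 'm) \<Rightarrow> bool" where
  "natural r C X Y s \<longleftrightarrow>
     (\<forall>a \<in> Field r. s a \<in> hom C (fob X a) (fob Y a)) \<and>
     (\<forall>a b. (a, b) \<in> r \<longrightarrow> s b \<cdot>\<^bsub>C\<^esub> fmor X (a, b) = fmor Y (a, b) \<cdot>\<^bsub>C\<^esub> s a)"

definition const_functor :: "('o, 'm) cat \<Rightarrow> 'o \<Rightarrow> ('i, 'j, 'o, 'm) fnctr" where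
  "const_functor C y = \<lparr>fob = (\<lambda>_. y), fmor = (\<lambda>_. Ident C y)\<rparr>"

context category
begin

lemma ident_comp_ident [simp]: "x \<in> Ob C \<Longrightarrow> Ident C x \<cdot> Ident C x = Ident C x"
  using ident_closed ident_left by blast

end

lemma Field_Restr_subset: "Refl r \<Longrightarrow> A \<subseteq> Field r \<Longrightarrow> Field (Restr r A) = A"
  by (auto simp: Field_def refl_on_def)

context well_ordering
begin

lemma Refl: "Refl r" and trans: "trans r"
  using wo_rel.REFL[OF wo_rel] wo_rel.TRANS[OF wo_rel] .

lemma well_ordering_Restr: "well_ordering (Restr r A)"
  by unfold_locales (rule Well_order_Restr[OF wo])

lemma functor_iff:
  fixes C :: "('o, 'm) cat" (structure)
  assumes "category C"
  shows "cat_functor (ord_cat r) C X \<longleftrightarrow>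
    (\<forall>a \<in> Field r. fob X a \<in> Ob C \<and> fmor X (a, a) = Ident C (fob X a)) \<and>
    (\<forall>a b. (a, b) \<in> r \<longrightarrow> fmor X (a, b) \<in> hom C (fob X a) (fob X b)) \<and>
    (\<forall>a b c. (a, b) \<in> r \<longrightarrow> (b, c) \<in> r \<longrightarrow>
        fmor X (a, c) = fmor X (b, c) \<cdot> fmor X (a, b))"
  by (rule cat_functor_ord_iff[OF Refl trans assms])

lemma functorD:
  fixes C :: "('o, 'm) cat" (structure)
  assumes "cat_functor (ord_cat r) C X"
  shows "a \<in> Field r \<Longrightarrow> fob X a \<in> Ob C"
    and "a \<in> Field r \<Longrightarrow> fmor X (a, a) = Ident C (fob X a)"
    and "(a, b) \<in> r \<Longrightarrow> fmor X (a, b) \<in> hom C (fob X a) (fob X b)"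
    and "(a, b) \<in> r \<Longrightarrow> (b, c) \<in> r \<Longrightarrow> fmor X (b, c) \<cdot> fmor X (a, b) = fmor X (a, c)"
proof -
  have C: "category C" using assms unfolding cat_functor_def by blast
  show "a \<in> Field r \<Longrightarrow> fob X a \<in> Ob C"
    "a \<in> Field r \<Longrightarrow> fmor X (a, a) = Ident C (fob X a)"
    "(a, b) \<in> r \<Longrightarrow> fmor X (a, b) \<in> hom C (fob X a) (fob X b)"
    "(a, b) \<in> r \<Longrightarrow> (b, c) \<in> r \<Longrightarrow> fmor X (b, c) \<cdot> fmor X (a, b) = fmor X (a, c)"
    using assms unfolding functor_iff[OF C] by simp_all
qed

lemma functor_Restr:
  assumes "cat_functor (ord_cat r) C X"
  shows "cat_functor (ord_cat (Restr r A)) C X"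
proof -
  have C: "category C" using assms unfolding cat_functor_def by blast
  interpret A: well_ordering "Restr r A" by (rule well_ordering_Restr)
  have "a \<in> Field (Restr r A) \<Longrightarrow> a \<in> Field r" for a
    by (auto simp: Field_def)
  then show ?thesis using assms unfolding functor_iff[OF C] A.functor_iff[OF C] by blast
qed

lemma Field_below: "Field (Restr r (below b)) = below b"
  by (rule Field_Restr_subset[OF Refl]) (use below_Field in blast)

lemma const_functor:
  assumes "category C" "y \<in> Ob C"
  shows "cat_functor (ord_cat r) C (const_functor C y)"
proof -
  interpret category C by fact
  show ?thesis
    unfolding functor_iff[OF assms(1)] using assms(2) ident_closed by (simp add: const_functor_def)
qed

end

lemma is_colimit_cong:
  assumes "is_colimit D C X c \<iota>" "category D"
    and "\<And>d. d \<in> Ob D \<Longrightarrow> fob X d = fob X' d \<and> \<iota> d = \<iota>' d"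
    and "\<And>a. a \<in> Arr D \<Longrightarrow> fmor X a = fmor X' a"
  shows "is_colimit D C X' c \<iota>'"
proof -
  interpret D: category D by fact
  have 1: "cocone D C X' c' \<kappa> \<longleftrightarrow> cocone D C X c' \<kappa>" for c' \<kappa>
    using assms(3,4) unfolding cocone_def by auto
  have 2: "cocone D C X c' \<iota> \<longleftrightarrow> cocone D C X c' \<iota>'" for c'
    using assms(3) D.dom_closed D.cod_closed unfolding cocone_def by auto
  have 3: "(\<forall>d \<in> Ob D. h \<cdot>\<^bsub>C\<^esub> \<iota> d = \<kappa> d) \<longleftrightarrow> (\<forall>d \<in> Ob D. h \<cdot>\<^bsub>C\<^esub> \<iota>' d = \<kappa> d)" for h \<kappa>
    using assms(3) by auto
  show ?thesis using assms(1) unfolding is_colimit_def 1 2 3 .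
qed

text \<open>The part of being a sequence over \<open>Z\<close> that concerns the stage \<open>b\<close> and its predecessors.\<close>

definition coherent_at ::
    "'i rel \<Rightarrow> ('o, 'm) cat \<Rightarrow> ('i, 'i \<times> 'i, 'o, 'm) fnctr \<Rightarrow> ('i, 'i \<times> 'i, 'o, 'm) fnctr \<Rightarrow>
      ('i \<Rightarrow> 'm) \<Rightarrow> 'i \<Rightarrow> bool" where
  "coherent_at r C Z X p b \<longleftrightarrow>
     fob X b \<in> Ob C \<and> fmor X (b, b) = Ident C (fob X b) \<and> p b \<in> hom C (fob X b) (fob Z b) \<and>
     (\<forall>a \<in> Order_Relation.underS r b.
        fmor X (a, b) \<in> hom C (fob X a) (fob X b) \<and>
        p b \<cdot>\<^bsub>C\<^esub> fmor X (a, b) = fmor Z (a, b) \<cdot>\<^bsub>C\<^esub> p a \<and>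
        (\<forall>a' \<in> Order_Relation.underS r a. fmor X (a', b) = fmor X (a, b) \<cdot>\<^bsub>C\<^esub> fmor X (a', a)))"

lemma (in well_ordering) coherent_functor:
  fixes C :: "('o, 'm) cat" (structure)
  assumes C: "category C" and Z: "cat_functor (ord_cat r) C Z"
    and A: "A \<subseteq> Field r" "\<And>b. b \<in> A \<Longrightarrow> coherent_at r C Z X p b"
  shows "cat_functor (ord_cat (Restr r A)) C X \<and> natural (Restr r A) C X Z p"
proof -
  interpret category C by fact
  interpret A: well_ordering "Restr r A" by (rule well_ordering_Restr)
  have F: "Field (Restr r A) = A" by (rule Field_Restr_subset[OF Refl A(1)])
  have m: "fmor X (a, b) \<in> hom C (fob X a) (fob X b)"
    and n: "p b \<cdot> fmor X (a, b) = fmor Z (a, b) \<cdot> p a" if "(a, b) \<in> Restr r A" for a b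
  proof -
    have b: "coherent_at r C Z X p b" "b \<in> Field r" using A that by auto
    have "fmor X (a, b) \<in> hom C (fob X a) (fob X b) \<and>
        p b \<cdot> fmor X (a, b) = fmor Z (a, b) \<cdot> p a"
    proof (cases "a = b")
      case True
      then show ?thesis
        using b functorD(2)[OF Z b(2)] ident_closed ident_left ident_right
        unfolding coherent_at_def by auto
    next
      case False
      then have "a \<in> below b" using that by (simp add: below_iff)
      then show ?thesis using b unfolding coherent_at_def by blast
    qed
    then show "fmor X (a, b) \<in> hom C (fob X a) (fob X b)"
      "p b \<cdot> fmor X (a, b) = fmor Z (a, b) \<cdot> p a" by blast+
  qed
  have comp: "fmor X (a, c) = fmor X (b, c) \<cdot> fmor X (a, b)"
    if ab: "(a, b) \<in> Restr r A" and bc: "(b, c) \<in> Restr r A" for a b c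
  proof -
    have *: "fmor X (a, a) = Ident C (fob X a)" "fmor X (c, c) = Ident C (fob X c)"
      using A(2) ab bc unfolding coherent_at_def by blast+
    consider "a = b" | "b = c" | "a \<in> below b" "b \<in> below c"
      using ab bc by (auto simp: below_iff)
    then show ?thesis
    proof cases
      case 3
      then show ?thesis using A(2) bc unfolding coherent_at_def by blast
    qed (use * m[OF ab] m[OF bc] ident_left ident_right in auto)
  qed
  show ?thesis
    unfolding A.functor_iff[OF C] natural_def F
    using m n comp A(2) unfolding coherent_at_def by blast
qed

text \<open>
  Sequences over a diagram \<open>Z\<close> can be built step by step, with arbitrary choices at successors as
  long as each of them depends on the previous stages only; at limits the colimit is taken.
\<close>

theorem (in bicomplete_category) transfinite_construction:
  fixes r :: "'u rel" and Z :: "('u, 'u \<times> 'u, 'o, 'm) fnctr"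
  assumes wo: "Well_order r" and small: "\<And>b. small U (Order_Relation.underS r b)"
    and Z: "cat_functor (ord_cat r) C Z"
    and start: "\<And>a. zero_in r a \<Longrightarrow> pi \<in> hom C xi (fob Z a)"
    and Step_cong: "\<And>b X p X' p' g q.
      \<lbrakk>\<And>a. (a, b) \<in> r \<Longrightarrow> fob X a = fob X' a \<and> p a = p' a \<and> fmor X (a, b) = fmor X' (a, b);
       Step b X p g q\<rbrakk> \<Longrightarrow> Step b X' p' g q"
    and Step_ex: "\<And>b c X p.
      \<lbrakk>succ_in r b c; cat_functor (ord_cat (Restr r (Order_Relation.underS r c))) C X;
       natural (Restr r (Order_Relation.underS r c)) C X Z p\<rbrakk>
      \<Longrightarrow> \<exists>y. \<exists>g \<in> hom C (fob X b) y. \<exists>q \<in> hom C y (fob Z c).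
            q \<cdot> g = fmor Z (b, c) \<cdot> p b \<and> Step b X p g q"
  obtains X :: "('u, 'u \<times> 'u, 'o, 'm) fnctr" and p where
    "lambda_sequence r C X" "natural r C X Z p"
    "\<And>a. zero_in r a \<Longrightarrow> fob X a = xi \<and> p a = pi"
    "\<And>b c. succ_in r b c \<Longrightarrow> Step b X p (fmor X (b, c)) (p c)"
proof -
  interpret R: well_ordering r by unfold_locales (rule wo)
  have Cc: "category C" by (rule category_axioms)
  \<comment> \<open>A stage \<open>b\<close> consists of its object, the arrows from the earlier stages and the arrow to \<open>Z\<close>.\<close>
  define XF :: "('u \<Rightarrow> 'o \<times> ('u \<Rightarrow> 'm) \<times> 'm) \<Rightarrow> ('u, 'u \<times> 'u, 'o, 'm) fnctr" where
    "XF f = \<lparr>fob = (\<lambda>b. fst (f b)), fmor = (\<lambda>(a, b). fst (snd (f b)) a)\<rparr>" for f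
  define PF :: "('u \<Rightarrow> 'o \<times> ('u \<Rightarrow> 'm) \<times> 'm) \<Rightarrow> 'u \<Rightarrow> 'm" where "PF f = (\<lambda>b. snd (snd (f b)))" for f
  have XF [simp]: "fob (XF f) b = fst (f b)" "fmor (XF f) (a, b) = fst (snd (f b)) a"
    and PF [simp]: "PF f b = snd (snd (f b))" for f a b
    by (simp_all add: XF_def PF_def)
  define good where "good X p b \<longleftrightarrow> coherent_at r C Z X p b \<and>
      (zero_in r b \<longrightarrow> fob X b = xi \<and> p b = pi) \<and>
      (\<forall>a. succ_in r a b \<longrightarrow> Step a X p (fmor X (a, b)) (p b)) \<and>
      (limit_in r b \<longrightarrow> is_colimit (ord_cat (Restr r (R.below b))) C X (fob X b) (\<lambda>a. fmor X (a, b)))"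
    for X p b
  \<comment> \<open>Forgetting everything but the history below \<open>b\<close> makes the recursion admissible.\<close>
  define upto where "upto f b y = (\<lambda>a. if a \<in> R.below b then f a else y)"
    for f :: "'u \<Rightarrow> 'o \<times> ('u \<Rightarrow> 'm) \<times> 'm" and b y
  have good_cong: "good (XF f') (PF f') b"
    if good: "good (XF f) (PF f) b" and eq: "\<And>a. (a, b) \<in> r \<Longrightarrow> f a = f' a" and b: "b \<in> Field r"
    for f f' b
  proof -
    have e: "f a = f' a" if "a \<in> R.below b" for a using that eq by (simp add: R.below_iff)
    have eb: "f b = f' b" using eq R.le_refl[OF b] by blast
    have "coherent_at r C Z (XF f') (PF f') b"
      using good eb unfolding good_def coherent_at_def by (auto simp: e)
    moreover have "Step a (XF f') (PF f') (fmor (XF f') (a, b)) (PF f' b)" if s: "succ_in r a b" for a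
    proof -
      have "Step a (XF f) (PF f) (fmor (XF f) (a, b)) (PF f b)"
        using good s unfolding good_def by blast
      moreover have "(a', b) \<in> r" if "(a', a) \<in> r" for a'
        using that R.below_succ_iff[OF s, of a'] by (auto simp: R.below_iff)
      ultimately show ?thesis
        using Step_cong[of a "XF f" "XF f'" "PF f" "PF f'"] eq eb
          R.below_iff R.below_succ_iff[OF s] R.le_refl R.below_Field[OF R.succ_below[OF s]] by auto
    qed
    moreover have "is_colimit (ord_cat (Restr r (R.below b))) C (XF f') (fob (XF f') b)
        (\<lambda>a. fmor (XF f') (a, b))" if l: "limit_in r b"
    proof -
      interpret B: well_ordering "Restr r (R.below b)" by (rule R.well_ordering_Restr)
      have "is_colimit (ord_cat (Restr r (R.below b))) C (XF f) (fob (XF f') b)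
          (\<lambda>a. fmor (XF f) (a, b))"
        using good l eb unfolding good_def by simp
      then show ?thesis
        by (rule is_colimit_cong[OF _ category_ord_cat[OF B.Refl B.trans]])
          (auto simp: R.Field_below e eb)
    qed
    ultimately show ?thesis using good eb unfolding good_def by simp
  qed
  have "\<exists>f. \<forall>b. b \<in> Field r \<longrightarrow> good (XF (upto f b (f b))) (PF (upto f b (f b))) b"
  proof (rule dependent_wf_choice[OF R.wf_below])
    fix f g :: "'u \<Rightarrow> 'o \<times> ('u \<Rightarrow> 'm) \<times> 'm" and b y
    assume "\<And>z. (z, b) \<in> {(a, b). a \<in> R.below b} \<Longrightarrow> f z = g z"
    then have "upto f b y = upto g b y" unfolding upto_def by auto
    then show "(b \<in> Field r \<longrightarrow> good (XF (upto f b y)) (PF (upto f b y)) b) =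
        (b \<in> Field r \<longrightarrow> good (XF (upto g b y)) (PF (upto g b y)) b)" by simp
  next
    fix b f
    assume IH: "\<And>y. (y, b) \<in> {(a, b). a \<in> R.below b} \<Longrightarrow>
        y \<in> Field r \<longrightarrow> good (XF (upto f y (f y))) (PF (upto f y (f y))) y"
    show "\<exists>y. b \<in> Field r \<longrightarrow> good (XF (upto f b y)) (PF (upto f b y)) b"
    proof (cases "b \<in> Field r")
      case b: True
      define X p where "X = XF f" and "p = PF f"
      have "good X p a" if a: "a \<in> R.below b" for a
      proof -
        have "a \<in> Field r" using a R.below_Field by blast
        moreover have "upto f a (f a) a' = f a'" if "(a', a) \<in> r" for a'
          using that by (auto simp: upto_def R.below_iff)
        ultimately show ?thesis unfolding X_def p_def
          using good_cong[of "upto f a (f a)" a f] IH a by auto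
      qed
      then have "cat_functor (ord_cat (Restr r (R.below b))) C X \<and> natural (Restr r (R.below b)) C X Z p"
        using R.below_Field by (intro R.coherent_functor[OF Cc Z]) (auto simp: good_def)
      then have X: "cat_functor (ord_cat (Restr r (R.below b))) C X"
        and p: "natural (Restr r (R.below b)) C X Z p" by blast+
      interpret B: well_ordering "Restr r (R.below b)" by (rule R.well_ordering_Restr)
      have pa: "p a \<in> hom C (fob X a) (fob Z a)" if "a \<in> R.below b" for a
        using p that unfolding natural_def R.Field_below by blast
      have Restr: "(a', a) \<in> Restr r (R.below b)" if "a' \<in> R.below a" "a \<in> R.below b" for a a'
        using that R.below_trans[OF that] R.below_iff[of a' a] by blast
      \<comment> \<open>It remains to find the data \<open>y\<close>, \<open>m\<close>, \<open>q\<close> of the stage \<open>b\<close>.\<close>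
      have mk: "good (XF (upto f b (y, m, q))) (PF (upto f b (y, m, q))) b"
        if "y \<in> Ob C" "m b = Ident C y" "q \<in> hom C y (fob Z b)"
          and m: "\<And>a. a \<in> R.below b \<Longrightarrow> m a \<in> hom C (fob X a) y"
          "\<And>a. a \<in> R.below b \<Longrightarrow> q \<cdot> m a = fmor Z (a, b) \<cdot> p a"
          "\<And>a a'. a \<in> R.below b \<Longrightarrow> a' \<in> R.below a \<Longrightarrow> m a' = m a \<cdot> fmor X (a', a)"
          and zero: "zero_in r b \<Longrightarrow> y = xi \<and> q = pi"
          and succ: "\<And>a. succ_in r a b \<Longrightarrow> Step a X p (m a) q"
          and limit: "limit_in r b \<Longrightarrow> is_colimit (ord_cat (Restr r (R.below b))) C X y m"
        for y m q
      proof -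
        let ?f = "upto f b (y, m, q)"
        have e: "?f a = f a" if "a \<in> R.below b" for a using that by (simp add: upto_def)
        have eb: "?f b = (y, m, q)" by (simp add: upto_def R.below_iff)
        have 1: "coherent_at r C Z (XF ?f) (PF ?f) b"
          unfolding coherent_at_def using that(1-3) m e[OF R.below_trans] e
          unfolding XF PF eb X_def p_def by simp
        have 2: "Step a (XF ?f) (PF ?f) (fmor (XF ?f) (a, b)) (PF ?f b)" if s: "succ_in r a b" for a
        proof -
          have "fob X a' = fob (XF ?f) a' \<and> p a' = PF ?f a' \<and> fmor X (a', a) = fmor (XF ?f) (a', a)"
            if "(a', a) \<in> r" for a'
            using that e[of a'] e[of a] R.below_succ_iff[OF s] R.succ_below[OF s]
            by (simp add: X_def p_def)
          then have "Step a (XF ?f) (PF ?f) (m a) q" using Step_cong[OF _ succ[OF s]] by blast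
          then show ?thesis by (simp add: eb)
        qed
        have 3: "is_colimit (ord_cat (Restr r (R.below b))) C (XF ?f) (fob (XF ?f) b)
            (\<lambda>a. fmor (XF ?f) (a, b))" if l: "limit_in r b"
        proof -
          have "is_colimit (ord_cat (Restr r (R.below b))) C X (fob (XF ?f) b) m"
            using limit[OF l] by (simp add: eb)
          then show ?thesis
            by (rule is_colimit_cong[OF _ category_ord_cat[OF B.Refl B.trans]])
              (auto simp: R.Field_below e eb X_def)
        qed
        have 4: "zero_in r b \<longrightarrow> fob (XF ?f) b = xi \<and> PF ?f b = pi"
          unfolding XF PF eb using zero by simp
        show ?thesis unfolding good_def using 1 2 3 4 by blast
      qed
      have "\<exists>y m q. good (XF (upto f b (y, m, q))) (PF (upto f b (y, m, q))) b"
        using b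
      proof (cases rule: R.trichotomy)
        case zero
        have "R.below b = {}" "\<not> limit_in r b" using zero by (simp_all add: zero_in_def limit_in_def)
        moreover have "\<not> succ_in r a b" for a using R.succ_below[of a b] calculation by auto
        ultimately have "good (XF (upto f b (xi, \<lambda>_. Ident C xi, pi)))
            (PF (upto f b (xi, \<lambda>_. Ident C xi, pi))) b"
          using start[OF zero] hom_Ob[OF start[OF zero]] by (intro mk) auto
        then show ?thesis by blast
      next
        case (succ a)
        have a: "a \<in> R.below b" by (rule R.succ_below[OF succ])
        obtain y g q where g: "g \<in> hom C (fob X a) y" and q: "q \<in> hom C y (fob Z b)"
          and qg: "q \<cdot> g = fmor Z (a, b) \<cdot> p a" and step: "Step a X p g q"
          using Step_ex[OF succ X p] by blast
        \<comment> \<open>Earlier stages reach \<open>b\<close> through its predecessor \<open>a\<close>.\<close>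
        define m where "m a' = (if a' = b then Ident C y else g \<cdot> fmor X (a', a))" for a'
        have Xa: "fmor X (a', a) \<in> hom C (fob X a') (fob X a)" "(a', a) \<in> Restr r (R.below b)"
          if "a' \<in> R.below b" for a'
        proof -
          show "(a', a) \<in> Restr r (R.below b)" using that R.below_succ_iff[OF succ] a by auto
          then show "fmor X (a', a) \<in> hom C (fob X a') (fob X a)" by (rule B.functorD(3)[OF X])
        qed
        have m: "m a' = g \<cdot> fmor X (a', a)" if "a' \<in> R.below b" for a'
          using that by (simp add: m_def R.below_iff)
        have ma: "m a = g"
          using m[OF a] B.functorD(2)[OF X, of a] a g ident_right by (simp add: R.Field_below)
        have "\<not> zero_in r b" using a by (auto simp: zero_in_def)
        moreover have "\<not> limit_in r b" using succ by (auto simp: limit_in_def)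
        moreover have "m a' \<in> hom C (fob X a') y" if a': "a' \<in> R.below b" for a'
          unfolding m[OF a'] using Xa(1)[OF a'] g by (rule comp_closed)
        moreover have "q \<cdot> m a' = fmor Z (a', b) \<cdot> p a'" if a': "a' \<in> R.below b" for a'
        proof -
          have r: "(a', a) \<in> r" "(a, b) \<in> r" using Xa(2)[OF a'] a by (auto simp: R.below_iff)
          have "q \<cdot> m a' = q \<cdot> g \<cdot> fmor X (a', a)"
            unfolding m[OF a'] using comp_assoc[OF Xa(1)[OF a'] g q] by simp
          also have "\<dots> = fmor Z (a, b) \<cdot> (p a \<cdot> fmor X (a', a))"
            unfolding qg by (rule comp_assoc[OF Xa(1)[OF a'] pa[OF a] R.functorD(3)[OF Z r(2)]])
          also have "\<dots> = fmor Z (a, b) \<cdot> (fmor Z (a', a) \<cdot> p a')"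
            using p Xa(2)[OF a'] unfolding natural_def by simp
          also have "\<dots> = fmor Z (a, b) \<cdot> fmor Z (a', a) \<cdot> p a'"
            using comp_assoc[OF pa[OF a'] R.functorD(3)[OF Z r(1)] R.functorD(3)[OF Z r(2)]] by simp
          finally show ?thesis using R.functorD(4)[OF Z r] by simp
        qed
        moreover have "m a'' = m a' \<cdot> fmor X (a'', a')" if a': "a' \<in> R.below b" and a'': "a'' \<in> R.below a'" for a' a''
        proof -
          have b'': "a'' \<in> R.below b" using R.below_trans[OF a'' a'] .
          have X': "fmor X (a'', a') \<in> hom C (fob X a'') (fob X a')"
            using B.functorD(3)[OF X Restr[OF a'' a']] .
          have "m a' \<cdot> fmor X (a'', a') = g \<cdot> (fmor X (a', a) \<cdot> fmor X (a'', a'))"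
            unfolding m[OF a'] by (rule comp_assoc[OF X' Xa(1)[OF a'] g])
          also have "\<dots> = g \<cdot> fmor X (a'', a)"
            using B.functorD(4)[OF X Restr[OF a'' a'] Xa(2)[OF a']] by simp
          finally show ?thesis using m[OF b''] by simp
        qed
        moreover have "Step a' X p (m a') q" if "succ_in r a' b" for a'
          using R.succ_unique[OF that succ] step ma by simp
        ultimately have "good (XF (upto f b (y, m, q))) (PF (upto f b (y, m, q))) b"
          using q hom_Ob[OF q] by (intro mk) (auto simp: m_def[of b])
        then show ?thesis by blast
      next
        case limit
        obtain c \<iota> where c: "is_colimit (ord_cat (Restr r (R.below b))) C X c \<iota>"
          using ord_colimit_ex[OF B.Refl B.trans _ X] small unfolding R.Field_below by blast
        note cc = colimit_cocone[OF c, unfolded cocone_ord_iff R.Field_below]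
        have "cocone (ord_cat (Restr r (R.below b))) C X (fob Z b) (\<lambda>a. fmor Z (a, b) \<cdot> p a)"
          unfolding cocone_ord_iff R.Field_below
        proof (intro conjI ballI allI impI)
          show "fob Z b \<in> Ob C" using R.functorD(1)[OF Z b] .
          show "fmor Z (a, b) \<cdot> p a \<in> hom C (fob X a) (fob Z b)" if a: "a \<in> R.below b" for a
            by (rule comp_closed[OF pa[OF a] R.functorD(3)[OF Z]]) (use a in \<open>simp add: R.below_iff\<close>)
          fix a' a assume r: "(a', a) \<in> Restr r (R.below b)"
          then have a: "a \<in> R.below b" "a' \<in> R.below b" "(a', a) \<in> r" "(a, b) \<in> r"
            by (auto simp: R.below_iff)
          have "fmor Z (a, b) \<cdot> p a \<cdot> fmor X (a', a) = fmor Z (a, b) \<cdot> (p a \<cdot> fmor X (a', a))"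
            by (rule comp_assoc[OF B.functorD(3)[OF X r] pa[OF a(1)] R.functorD(3)[OF Z a(4)]])
          also have "\<dots> = fmor Z (a, b) \<cdot> (fmor Z (a', a) \<cdot> p a')"
            using p r unfolding natural_def by simp
          also have "\<dots> = fmor Z (a, b) \<cdot> fmor Z (a', a) \<cdot> p a'"
            using comp_assoc[OF pa[OF a(2)] R.functorD(3)[OF Z a(3)] R.functorD(3)[OF Z a(4)]] by simp
          finally show "fmor Z (a, b) \<cdot> p a \<cdot> fmor X (a', a) = fmor Z (a', b) \<cdot> p a'"
            using R.functorD(4)[OF Z a(3,4)] by simp
        qed
        then obtain q where q: "q \<in> hom C c (fob Z b)"
          and q\<iota>: "\<And>a. a \<in> R.below b \<Longrightarrow> q \<cdot> \<iota> a = fmor Z (a, b) \<cdot> p a"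
          using colimit_desc[OF c] by (auto simp: R.Field_below)
        define m where "m a = (if a = b then Ident C c else \<iota> a)" for a
        have m: "m a = \<iota> a" if "a \<in> R.below b" for a using that by (auto simp: m_def R.below_iff)
        have "is_colimit (ord_cat (Restr r (R.below b))) C X c m"
          by (rule is_colimit_cong[OF c category_ord_cat[OF B.Refl B.trans]])
            (auto simp: m R.Field_below)
        moreover have "\<iota> a' = \<iota> a \<cdot> fmor X (a', a)" if "a \<in> R.below b" "a' \<in> R.below a" for a a'
          using cc Restr[OF that(2,1)] by metis
        moreover have "\<not> zero_in r b" "\<not> succ_in r a b" for a using limit by (auto simp: limit_in_def)
        ultimately have "good (XF (upto f b (c, m, q))) (PF (upto f b (c, m, q))) b"
          using q cc q\<iota> m[OF R.below_trans] by (intro mk) (auto simp: m m_def[of b])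
        then show ?thesis by blast
      qed
      then show ?thesis by blast
    qed blast
  qed
  then obtain f where f: "\<And>b. b \<in> Field r \<Longrightarrow> good (XF (upto f b (f b))) (PF (upto f b (f b))) b" by blast
  have g: "good (XF f) (PF f) b" if b: "b \<in> Field r" for b
    using good_cong[OF f[OF b] _ b] by (auto simp: upto_def R.below_iff)
  have "Restr r (Field r) = r" by (auto intro: FieldI1 FieldI2)
  then have XP: "cat_functor (ord_cat r) C (XF f)" "natural r C (XF f) Z (PF f)"
    using R.coherent_functor[OF Cc Z, of "Field r" "XF f" "PF f"] g unfolding good_def by auto
  show ?thesis
  proof (rule that[of "XF f" "PF f"])
    show "lambda_sequence r C (XF f)"
      unfolding lambda_sequence_def using wo XP(1) g unfolding good_def limit_in_def by blast
    show "natural r C (XF f) Z (PF f)" by (rule XP(2))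
    show "fob (XF f) a = xi \<and> PF f a = pi" if "zero_in r a" for a
      using g[of a] that unfolding good_def zero_in_def by blast
    show "Step b (XF f) (PF f) (fmor (XF f) (b, c)) (PF f c)" if "succ_in r b c" for b c
      using g[of c] that R.below_Field[OF R.succ_below[OF that]] unfolding good_def by blast
  qed
qed

text \<open>
  Natural transformations out of a sequence that lift a given one can likewise be built step by step:
  at limit stages the universal property of the colimit leaves no choice.
\<close>

theorem natural_lift:
  fixes r :: "'i rel" and C :: "('o, 'm) cat" (structure)
  assumes C: "category C" and X: "lambda_sequence r C X"
    and Y: "cat_functor (ord_cat r) C Y" and W: "cat_functor (ord_cat r) C W"
    and q: "natural r C X W q" and p: "natural r C Y W p"
    and start: "\<And>a. zero_in r a \<Longrightarrow> s0 \<in> hom C (fob X a) (fob Y a) \<and> p a \<cdot> s0 = q a"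
    and step: "\<And>b c s. \<lbrakk>succ_in r b c; s \<in> hom C (fob X b) (fob Y b); p b \<cdot> s = q b\<rbrakk> \<Longrightarrow>
      \<exists>s' \<in> hom C (fob X c) (fob Y c).
        s' \<cdot> fmor X (b, c) = fmor Y (b, c) \<cdot> s \<and> p c \<cdot> s' = q c"
  obtains s where "natural r C X Y s" "\<And>a. a \<in> Field r \<Longrightarrow> p a \<cdot> s a = q a"
    "\<And>a. zero_in r a \<Longrightarrow> s a = s0"
proof -
  interpret category C by fact
  interpret R: well_ordering r using X unfolding lambda_sequence_def by unfold_locales blast
  have XF: "cat_functor (ord_cat r) C X" using X unfolding lambda_sequence_def by blast
  note X' = R.functorD[OF XF] and Y' = R.functorD[OF Y] and W' = R.functorD[OF W]
  have ph: "p a \<in> hom C (fob Y a) (fob W a)" and qh: "q a \<in> hom C (fob X a) (fob W a)"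
    if "a \<in> Field r" for a
    using p q that unfolding natural_def by blast+
  define good where "good s b y \<longleftrightarrow> y \<in> hom C (fob X b) (fob Y b) \<and> p b \<cdot> y = q b \<and>
      (zero_in r b \<longrightarrow> y = s0) \<and>
      (\<forall>a \<in> R.below b. y \<cdot> fmor X (a, b) = fmor Y (a, b) \<cdot> s a)" for s b y
  have "\<exists>s. \<forall>b. b \<in> Field r \<longrightarrow> good s b (s b)"
  proof (rule dependent_wf_choice[OF R.wf_below])
    fix f g :: "'i \<Rightarrow> 'm" and b y
    assume "\<And>z. (z, b) \<in> {(a, b). a \<in> R.below b} \<Longrightarrow> f z = g z"
    then show "(b \<in> Field r \<longrightarrow> good f b y) = (b \<in> Field r \<longrightarrow> good g b y)"
      unfolding good_def by simp
  next
    fix b s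
    assume "\<And>y. (y, b) \<in> {(a, b). a \<in> R.below b} \<Longrightarrow> y \<in> Field r \<longrightarrow> good s y (s y)"
    then have IH: "good s a (s a)" if "a \<in> R.below b" for a
      using that R.below_Field by blast
    have sh: "s a \<in> hom C (fob X a) (fob Y a)" if "a \<in> R.below b" for a
      using IH[OF that] unfolding good_def by blast
    show "\<exists>y. b \<in> Field r \<longrightarrow> good s b y"
    proof (cases "b \<in> Field r")
      case b: True
      then have "\<exists>y. good s b y"
      proof (cases rule: R.trichotomy)
        case zero
        then have "good s b s0" unfolding good_def using start[OF zero] by (simp add: zero_in_def)
        then show ?thesis ..
      next
        case (succ c)
        have c: "c \<in> R.below b" by (rule R.succ_below[OF succ])
        have cb: "(c, b) \<in> r" using c by (simp add: R.below_iff)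
        obtain y where y: "y \<in> hom C (fob X b) (fob Y b)" "p b \<cdot> y = q b"
          and yc: "y \<cdot> fmor X (c, b) = fmor Y (c, b) \<cdot> s c"
          using step[OF succ] IH[OF c] unfolding good_def by blast
        have "y \<cdot> fmor X (a, b) = fmor Y (a, b) \<cdot> s a" if a: "a \<in> R.below b" for a
        proof (cases "a = c")
          case False
          have ac: "(a, c) \<in> r" using a R.below_succ_iff[OF succ] by blast
          then have "a \<in> R.below c" using False by (simp add: R.below_iff)
          then have n: "s c \<cdot> fmor X (a, c) = fmor Y (a, c) \<cdot> s a"
            using IH[OF c] unfolding good_def by blast
          have "y \<cdot> fmor X (a, b) = y \<cdot> fmor X (c, b) \<cdot> fmor X (a, c)"
            using comp_assoc[OF X'(3)[OF ac] X'(3)[OF cb] y(1)] X'(4)[OF ac cb] by simp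
          also have "\<dots> = fmor Y (c, b) \<cdot> (fmor Y (a, c) \<cdot> s a)"
            unfolding yc n[symmetric] by (rule comp_assoc[OF X'(3)[OF ac] sh[OF c] Y'(3)[OF cb]])
          also have "\<dots> = fmor Y (a, b) \<cdot> s a"
            using comp_assoc[OF sh[OF a] Y'(3)[OF ac] Y'(3)[OF cb]] Y'(4)[OF ac cb] by simp
          finally show ?thesis .
        qed (simp add: yc)
        moreover have "\<not> zero_in r b" using c by (auto simp: zero_in_def)
        ultimately show ?thesis unfolding good_def using y by blast
      next
        case limit
        have c: "is_colimit (ord_cat (Restr r (R.below b))) C X (fob X b) (\<lambda>a. fmor X (a, b))"
          using X limit unfolding lambda_sequence_def by blast
        have ab: "(a, b) \<in> r" if "a \<in> R.below b" for a using that by (simp add: R.below_iff)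
        have "cocone (ord_cat (Restr r (R.below b))) C X (fob Y b) (\<lambda>a. fmor Y (a, b) \<cdot> s a)"
          unfolding cocone_ord_iff R.Field_below
        proof (intro conjI ballI allI impI)
          show "fob Y b \<in> Ob C" using Y'(1)[OF b] .
          show "fmor Y (a, b) \<cdot> s a \<in> hom C (fob X a) (fob Y b)" if a: "a \<in> R.below b" for a
            by (rule comp_closed[OF sh[OF a] Y'(3)[OF ab[OF a]]])
          fix a' a assume r: "(a', a) \<in> Restr r (R.below b)"
          then have a: "a \<in> R.below b" "a' \<in> R.below b" "(a', a) \<in> r" by auto
          have n: "s a \<cdot> fmor X (a', a) = fmor Y (a', a) \<cdot> s a'"
          proof (cases "a' = a")
            case True
            have "a \<in> Field r" using a R.below_Field by blast
            then show ?thesis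
              using True X'(2) Y'(2) sh[OF a(1)] ident_left ident_right by auto
          next
            case False
            then have "a' \<in> R.below a" using a by (simp add: R.below_iff)
            then show ?thesis using IH[OF a(1)] unfolding good_def by blast
          qed
          have "fmor Y (a, b) \<cdot> s a \<cdot> fmor X (a', a) = fmor Y (a, b) \<cdot> (s a \<cdot> fmor X (a', a))"
            by (rule comp_assoc[OF X'(3)[OF a(3)] sh[OF a(1)] Y'(3)[OF ab[OF a(1)]]])
          also have "\<dots> = fmor Y (a, b) \<cdot> fmor Y (a', a) \<cdot> s a'"
            unfolding n using comp_assoc[OF sh[OF a(2)] Y'(3)[OF a(3)] Y'(3)[OF ab[OF a(1)]]] by simp
          finally show "fmor Y (a, b) \<cdot> s a \<cdot> fmor X (a', a) = fmor Y (a', b) \<cdot> s a'"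
            using Y'(4)[OF a(3) ab[OF a(1)]] by simp
        qed
        then obtain y where y: "y \<in> hom C (fob X b) (fob Y b)"
          and yX: "\<And>a. a \<in> R.below b \<Longrightarrow> y \<cdot> fmor X (a, b) = fmor Y (a, b) \<cdot> s a"
          using colimit_desc[OF c] by (auto simp: R.Field_below)
        have "p b \<cdot> y = q b"
        proof (rule colimit_ext[OF C R.functor_Restr[OF XF] c])
          show "p b \<cdot> y \<in> hom C (fob X b) (fob W b)" by (rule comp_closed[OF y ph[OF b]])
          show "q b \<in> hom C (fob X b) (fob W b)" by (rule qh[OF b])
          fix a assume "a \<in> Ob (ord_cat (Restr r (R.below b)))"
          then have a: "a \<in> R.below b" by (simp add: R.Field_below)
          have aF: "a \<in> Field r" using a R.below_Field by blast
          have "p b \<cdot> y \<cdot> fmor X (a, b) = p b \<cdot> (fmor Y (a, b) \<cdot> s a)"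
            unfolding yX[OF a, symmetric] by (rule comp_assoc[OF X'(3)[OF ab[OF a]] y ph[OF b]])
          also have "\<dots> = fmor W (a, b) \<cdot> p a \<cdot> s a"
            using comp_assoc[OF sh[OF a] Y'(3)[OF ab[OF a]] ph[OF b]] p ab[OF a]
            unfolding natural_def by simp
          also have "\<dots> = fmor W (a, b) \<cdot> q a"
            using comp_assoc[OF sh[OF a] ph[OF aF] W'(3)[OF ab[OF a]]] IH[OF a]
            unfolding good_def by simp
          also have "\<dots> = q b \<cdot> fmor X (a, b)"
            using q ab[OF a] unfolding natural_def by simp
          finally show "p b \<cdot> y \<cdot> fmor X (a, b) = q b \<cdot> fmor X (a, b)" .
        qed
        then show ?thesis unfolding good_def using y yX limit by (auto simp: limit_in_def)
      qed
      then show ?thesis by blast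
    qed blast
  qed
  then obtain s where s: "\<And>b. b \<in> Field r \<Longrightarrow> good s b (s b)" by blast
  show ?thesis
  proof (rule that[of s])
    show "natural r C X Y s" unfolding natural_def
    proof (intro conjI ballI allI impI)
      show sh: "s a \<in> hom C (fob X a) (fob Y a)" if "a \<in> Field r" for a
        using s[OF that] unfolding good_def by blast
      fix a b assume ab: "(a, b) \<in> r"
      then have F: "a \<in> Field r" "b \<in> Field r" using R.in_Field by blast+
      show "s b \<cdot> fmor X (a, b) = fmor Y (a, b) \<cdot> s a"
      proof (cases "a = b")
        case True
        then show ?thesis
          using X'(2)[OF F(1)] Y'(2)[OF F(1)] ident_left[OF sh[OF F(1)]] ident_right[OF sh[OF F(1)]]
          by simp
      next
        case False
        then show ?thesis using s[OF F(2)] ab unfolding good_def by (simp add: R.below_iff)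
      qed
    qed
    show "p a \<cdot> s a = q a" if "a \<in> Field r" for a using s[OF that] unfolding good_def by blast
    show "s a = s0" if "zero_in r a" for a
      using s[of a] that unfolding good_def zero_in_def by blast
  qed
qed

section \<open>Lifting properties\<close>

definition llp :: "('o, 'm) cat \<Rightarrow> 'm set \<Rightarrow> 'm set" where
  "llp C K = {i \<in> Arr C. \<forall>p \<in> K. lifts_against C i p}"

lemma lifts_againstE:
  fixes C :: "('o, 'm) cat" (structure)
  assumes "lifts_against C i p" "i \<in> hom C a b" "p \<in> hom C x y"
    and "f \<in> hom C a x" "g \<in> hom C b y" "p \<cdot> f = g \<cdot> i"
  obtains h where "h \<in> hom C b x" "h \<cdot> i = f" "p \<cdot> h = g"
proof -
  have "\<exists>h \<in> hom C b x. h \<cdot> i = f \<and> p \<cdot> h = g"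
    using assms homD[OF assms(2)] homD[OF assms(3)] unfolding lifts_against_def by auto
  then show ?thesis using that by blast
qed

lemma lifts_againstI:
  fixes C :: "('o, 'm) cat" (structure)
  assumes "i \<in> hom C a b" "p \<in> hom C x y"
    and "\<And>f g. \<lbrakk>f \<in> hom C a x; g \<in> hom C b y; p \<cdot> f = g \<cdot> i\<rbrakk> \<Longrightarrow>
      \<exists>h \<in> hom C b x. h \<cdot> i = f \<and> p \<cdot> h = g"
  shows "lifts_against C i p"
  using assms(3) homD[OF assms(1)] homD[OF assms(2)] unfolding lifts_against_def by auto

context category
begin

lemma pushout_lifts:
  assumes po: "is_pushout C i u f v" and lift: "lifts_against C i p" and p: "p \<in> Arr C"
  shows "lifts_against C f p"
proof -
  define a b x y where "a = Dom C i" and "b = Cod C i" and "x = Cod C u" and "y = Cod C f"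
  have i: "i \<in> hom C a b" and u: "u \<in> hom C a x" and f: "f \<in> hom C x y" and v: "v \<in> hom C b y"
    and sq: "f \<cdot> u = v \<cdot> i"
    using po unfolding is_pushout_def a_def b_def x_def y_def by (auto simp: hom_def)
  have p': "p \<in> hom C (Dom C p) (Cod C p)" using p by (rule Arr_hom)
  show ?thesis
  proof (rule lifts_againstI[OF f p'])
    fix s t assume s: "s \<in> hom C x (Dom C p)" and t: "t \<in> hom C y (Cod C p)" and st: "p \<cdot> s = t \<cdot> f"
    have su: "s \<cdot> u \<in> hom C a (Dom C p)" and tv: "t \<cdot> v \<in> hom C b (Cod C p)"
      using comp_closed[OF u s] comp_closed[OF v t] by auto
    have "p \<cdot> (s \<cdot> u) = t \<cdot> v \<cdot> i"
      using comp_assoc[OF u s p'] comp_assoc[OF u f t] comp_assoc[OF i v t] st sq by simp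
    then obtain k where k: "k \<in> hom C b (Dom C p)" "k \<cdot> i = s \<cdot> u" "p \<cdot> k = t \<cdot> v"
      using lifts_againstE[OF lift i p' su tv] by blast
    have "\<exists>h. h \<in> hom C y (Dom C p) \<and> h \<cdot> f = s \<and> h \<cdot> v = k"
      using po s k unfolding is_pushout_def a_def b_def x_def y_def by metis
    then obtain h where h: "h \<in> hom C y (Dom C p)" "h \<cdot> f = s" "h \<cdot> v = k" by blast
    have "p \<cdot> h = t"
    proof (rule pushout_ext[OF po _ _ category_axioms])
      show "p \<cdot> h \<in> hom C (Cod C f) (Cod C p)" "t \<in> hom C (Cod C f) (Cod C p)"
        using comp_closed[OF h(1) p'] t unfolding y_def by auto
      show "p \<cdot> h \<cdot> f = t \<cdot> f" using comp_assoc[OF f h(1) p'] h st by simp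
      show "p \<cdot> h \<cdot> v = t \<cdot> v" using comp_assoc[OF v h(1) p'] h k by simp
    qed
    then show "\<exists>h \<in> hom C y (Dom C p). h \<cdot> f = s \<and> p \<cdot> h = t" using h by blast
  qed
qed

text \<open>
  A square from the transfinite composition of \<open>X\<close> to \<open>p\<close> restricts to a compatible family of arrows from
  the stages \<open>X b\<close> to the codomain of \<open>p\<close>. Lifting this family along \<open>p\<close> is a case of \<open>natural_lift\<close>, for
  constant diagrams.
\<close>

lemma transfinite_composition_lifts:
  assumes f: "f \<in> transfinite_compositions U C K" and p: "p \<in> Arr C"
    and lift: "\<And>k. k \<in> K \<Longrightarrow> lifts_against C k p"
  shows "f \<in> Arr C \<and> lifts_against C f p"
proof -
  obtain r :: "'a rel" and X c \<iota> a where X: "lambda_sequence_of r C K X"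
    and c: "is_colimit (ord_cat r) C X c \<iota>" and a: "zero_in r a" and f_eq: "f = \<iota> a"
    using f unfolding transfinite_compositions_def by blast
  have lam: "lambda_sequence r C X" and K: "\<And>b c. succ_in r b c \<Longrightarrow> fmor X (b, c) \<in> K"
    using X unfolding lambda_sequence_of_def by blast+
  then have XF: "cat_functor (ord_cat r) C X" unfolding lambda_sequence_def by blast
  interpret R: well_ordering r using lam unfolding lambda_sequence_def by unfold_locales blast
  note cc = colimit_cocone[OF c, unfolded cocone_ord_iff]
  have \<iota>: "\<iota> b \<in> hom C (fob X b) c" if "b \<in> Field r" for b using cc that by blast
  have aF: "a \<in> Field r" using a unfolding zero_in_def by blast
  have fh: "f \<in> hom C (fob X a) c" using \<iota>[OF aF] f_eq by simp
  have p': "p \<in> hom C (Dom C p) (Cod C p)" using p by (rule Arr_hom)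
  have pO: "Dom C p \<in> Ob C" "Cod C p \<in> Ob C" using hom_Ob[OF p'] by auto
  have "lifts_against C f p"
  proof (rule lifts_againstI[OF fh p'])
    fix s t assume s: "s \<in> hom C (fob X a) (Dom C p)" and t: "t \<in> hom C c (Cod C p)"
      and st: "p \<cdot> s = t \<cdot> f"
    let ?Y = "const_functor C (Dom C p)" and ?W = "const_functor C (Cod C p)"
    have th: "t \<cdot> \<iota> b \<in> hom C (fob X b) (Cod C p)" if "b \<in> Field r" for b
      using comp_closed[OF \<iota>[OF that] t] .
    have t\<iota>: "t \<cdot> \<iota> b \<cdot> fmor X (b', b) = t \<cdot> \<iota> b'" if b: "(b', b) \<in> r" for b b'
    proof -
      have "b \<in> Field r" using R.in_Field[OF b] by blast
      then show ?thesis
        using comp_assoc[OF R.functorD(3)[OF XF b] \<iota> t] cc b by auto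
    qed
    have Y: "cat_functor (ord_cat r) C ?Y" and W: "cat_functor (ord_cat r) C ?W"
      using R.const_functor[OF category_axioms] pO by blast+
    have q: "natural r C X ?W (\<lambda>b. t \<cdot> \<iota> b)" unfolding natural_def
      using th t\<iota> ident_left[OF th] R.in_Field by (auto simp: const_functor_def)
    have pn: "natural r C ?Y ?W (\<lambda>_. p)" unfolding natural_def
      using p' ident_left[OF p'] ident_right[OF p'] by (simp add: const_functor_def)
    have "\<exists>k. natural r C X ?Y k \<and> (\<forall>b \<in> Field r. p \<cdot> k b = t \<cdot> \<iota> b) \<and>
      (\<forall>b. zero_in r b \<longrightarrow> k b = s)"
    proof (rule natural_lift[OF category_axioms lam Y W q pn])
      fix b assume "zero_in r b"
      then have "b = a" using R.zero_le[OF a] R.zero_le[OF _ aF] R.le_antisym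
        unfolding zero_in_def by blast
      then show "s \<in> hom C (fob X b) (fob ?Y b) \<and> p \<cdot> s = t \<cdot> \<iota> b"
        using s st f_eq by (simp add: const_functor_def)
    next
      fix b c' y assume sc: "succ_in r b c'" and y: "y \<in> hom C (fob X b) (fob ?Y b)" "p \<cdot> y = t \<cdot> \<iota> b"
      have bc: "(b, c') \<in> r" using sc unfolding succ_in_def by blast
      have y': "y \<in> hom C (fob X b) (Dom C p)" using y by (simp add: const_functor_def)
      have cF: "c' \<in> Field r" using R.in_Field[OF bc] by blast
      have "p \<cdot> y = t \<cdot> \<iota> c' \<cdot> fmor X (b, c')" using t\<iota>[OF bc] y by simp
      then obtain y'' where "y'' \<in> hom C (fob X c') (Dom C p)" "y'' \<cdot> fmor X (b, c') = y" "p \<cdot> y'' = t \<cdot> \<iota> c'"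
        using lifts_againstE[OF lift[OF K[OF sc]] R.functorD(3)[OF XF bc] p' y' th[OF cF]] by blast
      then show "\<exists>s' \<in> hom C (fob X c') (fob ?Y c').
          s' \<cdot> fmor X (b, c') = fmor ?Y (b, c') \<cdot> y \<and> p \<cdot> s' = t \<cdot> \<iota> c'"
        using ident_left[OF y'] by (auto simp: const_functor_def)
    qed blast
    then obtain k where k: "natural r C X ?Y k" "\<And>b. b \<in> Field r \<Longrightarrow> p \<cdot> k b = t \<cdot> \<iota> b"
      "\<And>b. zero_in r b \<Longrightarrow> k b = s" by blast
    have kh: "k b \<in> hom C (fob X b) (Dom C p)" if "b \<in> Field r" for b
      using k(1) that unfolding natural_def by (simp add: const_functor_def)
    have "cocone (ord_cat r) C X (Dom C p) k"
      unfolding cocone_ord_iff using k(1) pO kh ident_left[OF kh] R.in_Field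
      unfolding natural_def by (auto simp: const_functor_def)
    then obtain h where h: "h \<in> hom C c (Dom C p)" "\<And>b. b \<in> Field r \<Longrightarrow> h \<cdot> \<iota> b = k b"
      using colimit_desc[OF c] by auto
    have "p \<cdot> h = t"
    proof (rule colimit_ext[OF category_axioms XF c comp_closed[OF h(1) p'] t])
      fix b assume "b \<in> Ob (ord_cat r)"
      then have "b \<in> Field r" by simp
      then show "p \<cdot> h \<cdot> \<iota> b = t \<cdot> \<iota> b"
        using comp_assoc[OF \<iota> h(1) p'] h(2) k(2) by simp
    qed
    moreover have "h \<cdot> f = s" using h(2)[OF aF] k(3)[OF a] f_eq by simp
    ultimately show "\<exists>h \<in> hom C c (Dom C p). h \<cdot> f = s \<and> p \<cdot> h = t" using h(1) by blast
  qed
  then show ?thesis using homD[OF fh] by blast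
qed

lemma relative_cell_complex_lifts:
  assumes "f \<in> relative_cell_complexes U C K" "p \<in> Arr C" "\<And>k. k \<in> K \<Longrightarrow> lifts_against C k p"
  shows "lifts_against C f p"
  using transfinite_composition_lifts[of f U "pushouts C K" p] assms pushout_lifts
  unfolding relative_cell_complexes_def pushouts_def by blast

lemma relative_cell_complex_Arr:
  assumes "f \<in> relative_cell_complexes U C K"
  shows "f \<in> Arr C"
proof -
  obtain r :: "'a rel" and X c \<iota> a where
    c: "is_colimit (ord_cat r) C X c \<iota>" and a: "zero_in r a" and f_eq: "f = \<iota> a"
    using assms unfolding relative_cell_complexes_def transfinite_compositions_def by blast
  have "a \<in> Field r" using a unfolding zero_in_def by blast
  then have "\<iota> a \<in> hom C (fob X a) c" using colimit_cocone[OF c, unfolded cocone_ord_iff] by blast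
  then show ?thesis using f_eq homD by metis
qed

lemma relative_cell_complexes_subset_llp: "relative_cell_complexes U C K \<subseteq> llp C (rlp C K)"
  using relative_cell_complex_lifts relative_cell_complex_Arr
  unfolding llp_def rlp_def by blast

text \<open>
  The retract argument: a lift in the square with left side \<open>q \<cdot> j\<close>, right side \<open>q\<close>, upper side \<open>j\<close> and
  an identity below is a section of \<open>q\<close> under the domain of \<open>j\<close>.
\<close>

lemma retract_of_factor:
  assumes j: "j \<in> hom C x z" and q: "q \<in> hom C z y" and lift: "lifts_against C (q \<cdot> j) q"
  shows "is_retract C (q \<cdot> j) j"
proof -
  have x: "x \<in> Ob C" and y: "y \<in> Ob C" using hom_Ob j q by blast+
  have f: "q \<cdot> j \<in> hom C x y" using j q by (rule comp_closed)
  have "q \<cdot> j = Ident C y \<cdot> (q \<cdot> j)" using ident_left[OF f] by simp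
  then obtain h where h: "h \<in> hom C y z" "h \<cdot> (q \<cdot> j) = j" "q \<cdot> h = Ident C y"
    using lifts_againstE[OF lift f q j ident_closed[OF y]] by blast
  have "Dom C (q \<cdot> j) = x" "Cod C (q \<cdot> j) = y" "Dom C j = x" "Cod C j = z" "q \<cdot> j \<in> Arr C" "j \<in> Arr C"
    using homD[OF f] homD[OF j] by auto
  moreover have "Ident C x \<cdot> Ident C x = Ident C x" "j \<cdot> Ident C x = h \<cdot> (q \<cdot> j)"
    "(q \<cdot> j) \<cdot> Ident C x = q \<cdot> j"
    using ident_comp_ident[OF x] h(2) ident_right[OF j] ident_right[OF f] by auto
  ultimately show ?thesis unfolding is_retract_def
    using ident_closed[OF x] h(1,3) q by metis
qed

lemma retract_lifts:
  assumes ret: "is_retract C f g" and lift: "lifts_against C g p" and p: "p \<in> Arr C"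
  shows "lifts_against C f p"
proof -
  define a b a' b' where "a = Dom C f" and "b = Cod C f" and "a' = Dom C g" and "b' = Cod C g"
  have f: "f \<in> hom C a b" and g: "g \<in> hom C a' b'"
    using ret unfolding is_retract_def a_def b_def a'_def b'_def by (auto simp: hom_def)
  obtain s r s' r' where s: "s \<in> hom C a a'" and r: "r \<in> hom C a' a" and s': "s' \<in> hom C b b'"
    and r': "r' \<in> hom C b' b" and id: "r \<cdot> s = Ident C a" "r' \<cdot> s' = Ident C b"
    and sq: "g \<cdot> s = s' \<cdot> f" "f \<cdot> r = r' \<cdot> g"
    using ret unfolding is_retract_def a_def b_def a'_def b'_def by auto
  have p': "p \<in> hom C (Dom C p) (Cod C p)" using p by (rule Arr_hom)
  show ?thesis
  proof (rule lifts_againstI[OF f p'])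
    fix k l assume k: "k \<in> hom C a (Dom C p)" and l: "l \<in> hom C b (Cod C p)" and kl: "p \<cdot> k = l \<cdot> f"
    have kr: "k \<cdot> r \<in> hom C a' (Dom C p)" and lr: "l \<cdot> r' \<in> hom C b' (Cod C p)"
      using comp_closed[OF r k] comp_closed[OF r' l] by auto
    have "p \<cdot> (k \<cdot> r) = l \<cdot> r' \<cdot> g"
      using comp_assoc[OF r k p'] comp_assoc[OF r f l] comp_assoc[OF g r' l] kl sq by simp
    then obtain h where h: "h \<in> hom C b' (Dom C p)" "h \<cdot> g = k \<cdot> r" "p \<cdot> h = l \<cdot> r'"
      using lifts_againstE[OF lift g p' kr lr] by blast
    have "h \<cdot> s' \<in> hom C b (Dom C p)" using comp_closed[OF s' h(1)] .
    moreover have "h \<cdot> s' \<cdot> f = k"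
      using comp_assoc[OF f s' h(1)] comp_assoc[OF s g h(1)] comp_assoc[OF s r k] h sq id
        ident_right[OF k] by simp
    moreover have "p \<cdot> (h \<cdot> s') = l"
      using comp_assoc[OF s' h(1) p'] comp_assoc[OF s' r' l] h id ident_right[OF l] by simp
    ultimately show "\<exists>h \<in> hom C b (Dom C p). h \<cdot> f = k \<and> p \<cdot> h = l" by blast
  qed
qed

end


section \<open>Subsequences and intervals of transfinite sequences\<close>

definition reindex ::
    "('i, 'i \<times> 'i, 'o, 'm) fnctr \<Rightarrow> ('j \<Rightarrow> 'i) \<Rightarrow> ('j, 'j \<times> 'j, 'o, 'm) fnctr" where
  "reindex X h = \<lparr>fob = fob X \<circ> h, fmor = (\<lambda>(a, b). fmor X (h a, h b))\<rparr>"

lemma reindex_simps [simp]: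
  "fob (reindex X h) a = fob X (h a)" "fmor (reindex X h) (a, b) = fmor X (h a, h b)"
  by (simp_all add: reindex_def)

context well_ordering
begin

lemma functor_reindex:
  assumes "well_ordering r'" "cat_functor (ord_cat r) C X" "\<And>a b. (a, b) \<in> r' \<Longrightarrow> (h a, h b) \<in> r"
  shows "cat_functor (ord_cat r') C (reindex X h)"
proof -
  interpret R': well_ordering r' by fact
  have C: "category C" using assms(2) unfolding cat_functor_def by blast
  have "h a \<in> Field r" if "a \<in> Field r'" for a
    using in_Field[OF assms(3)[OF R'.le_refl[OF that]]] by blast
  then show ?thesis
    unfolding R'.functor_iff[OF C] using functorD[OF assms(2)] assms(3) by simp
qed

text \<open>
  A cocone \<open>\<iota>\<close> on the subsequence extends to all of \<open>A\<close>: at \<open>a\<close> take the composite of \<open>X a \<rightarrow> X (h b)\<close> with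
  \<open>\<iota> b\<close> for any \<open>b\<close> with \<open>a \<le> h b\<close>. This does not depend on \<open>b\<close> because \<open>r'\<close> is linear.
\<close>

lemma cofinal_colimit:
  fixes C :: "('o, 'm) cat" (structure)
  assumes X: "cat_functor (ord_cat r) C X" and A: "A \<subseteq> Field r"
    and colim: "is_colimit (ord_cat (Restr r A)) C X x \<kappa>"
    and r': "well_ordering r'" and h: "\<And>a b. (a, b) \<in> r' \<Longrightarrow> (h a, h b) \<in> r"
    and hA: "\<And>a. a \<in> Field r' \<Longrightarrow> h a \<in> A"
    and cofinal: "\<And>a. a \<in> A \<Longrightarrow> \<exists>b \<in> Field r'. (a, h b) \<in> r"
  shows "is_colimit (ord_cat r') C (reindex X h) x (\<kappa> \<circ> h)"
proof -
  interpret R': well_ordering r' by fact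
  interpret category C using X unfolding cat_functor_def by blast
  have F: "Field (Restr r A) = A" by (rule Field_Restr_subset[OF Refl A])
  note X' = functorD[OF X]
  note cc = colimit_cocone[OF colim, unfolded cocone_ord_iff F]
  have \<kappa>: "\<kappa> a \<in> hom C (fob X a) x" if "a \<in> A" for a using cc that by blast
  have \<kappa>X: "\<kappa> b \<cdot> fmor X (a, b) = \<kappa> a" if "a \<in> A" "b \<in> A" "(a, b) \<in> r" for a b
    using cc that by blast
  have 1: "cocone (ord_cat r') C (reindex X h) x (\<kappa> \<circ> h)"
    unfolding cocone_ord_iff using cc \<kappa> \<kappa>X hA h R'.in_Field by auto
  have "\<exists>!k. k \<in> hom C x c' \<and> (\<forall>b \<in> Ob (ord_cat r'). k \<cdot> (\<kappa> \<circ> h) b = \<iota> b)"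
    if \<iota>: "cocone (ord_cat r') C (reindex X h) c' \<iota>" for c' \<iota>
  proof -
    have \<iota>h: "\<iota> b \<in> hom C (fob X (h b)) c'" if "b \<in> Field r'" for b
      using \<iota> that unfolding cocone_ord_iff by simp
    have \<iota>X: "\<iota> b' \<cdot> fmor X (h b, h b') = \<iota> b" if "(b, b') \<in> r'" for b b'
      using \<iota> that unfolding cocone_ord_iff by simp
    define \<beta> where "\<beta> a = (SOME b. b \<in> Field r' \<and> (a, h b) \<in> r)" for a
    have \<beta>: "\<beta> a \<in> Field r'" "(a, h (\<beta> a)) \<in> r" if "a \<in> A" for a
      using someI_ex[of "\<lambda>b. b \<in> Field r' \<and> (a, h b) \<in> r"] cofinal[OF that] unfolding \<beta>_def by blast+
    define \<kappa>' where "\<kappa>' a = \<iota> (\<beta> a) \<cdot> fmor X (a, h (\<beta> a))" for a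
    have up: "\<iota> b \<cdot> fmor X (a, h b) = \<iota> b' \<cdot> fmor X (a, h b')"
      if "(b, b') \<in> r'" "(a, h b) \<in> r" for a b b'
    proof -
      have b': "b' \<in> Field r'" using R'.in_Field that by blast
      have "\<iota> b \<cdot> fmor X (a, h b) = \<iota> b' \<cdot> (fmor X (h b, h b') \<cdot> fmor X (a, h b))"
        unfolding \<iota>X[OF that(1), symmetric]
        by (rule comp_assoc[OF X'(3)[OF that(2)] X'(3)[OF h[OF that(1)]] \<iota>h[OF b']])
      then show ?thesis using X'(4)[OF that(2) h[OF that(1)]] by simp
    qed
    have \<kappa>'_eq: "\<kappa>' a = \<iota> b \<cdot> fmor X (a, h b)"
      if "a \<in> A" "b \<in> Field r'" "(a, h b) \<in> r" for a b
      using R'.le_total[OF \<beta>(1)[OF that(1)] that(2)] up[OF _ that(3)] up[OF _ \<beta>(2)[OF that(1)]]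
      unfolding \<kappa>'_def by metis
    have \<kappa>'_h: "\<kappa>' a \<in> hom C (fob X a) c'" if "a \<in> A" for a
      unfolding \<kappa>'_def by (rule comp_closed[OF X'(3)[OF \<beta>(2)[OF that]] \<iota>h[OF \<beta>(1)[OF that]]])
    have "cocone (ord_cat (Restr r A)) C X c' \<kappa>'" unfolding cocone_ord_iff F
    proof (intro conjI ballI allI impI)
      show "c' \<in> Ob C" using \<iota> unfolding cocone_ord_iff by blast
      show "\<kappa>' a \<in> hom C (fob X a) c'" if "a \<in> A" for a by (rule \<kappa>'_h[OF that])
      fix a b assume "(a, b) \<in> Restr r A"
      then have ab: "(a, b) \<in> r" "a \<in> A" "b \<in> A" by auto
      have ah: "(a, h (\<beta> b)) \<in> r" using le_trans[OF ab(1) \<beta>(2)[OF ab(3)]] .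
      have "\<kappa>' b \<cdot> fmor X (a, b) = \<iota> (\<beta> b) \<cdot> (fmor X (b, h (\<beta> b)) \<cdot> fmor X (a, b))"
        unfolding \<kappa>'_def
        by (rule comp_assoc[OF X'(3)[OF ab(1)] X'(3)[OF \<beta>(2)[OF ab(3)]] \<iota>h[OF \<beta>(1)[OF ab(3)]]])
      also have "\<dots> = \<kappa>' a"
        using X'(4)[OF ab(1) \<beta>(2)[OF ab(3)]] \<kappa>'_eq[OF ab(2) \<beta>(1)[OF ab(3)] ah] by simp
      finally show "\<kappa>' b \<cdot> fmor X (a, b) = \<kappa>' a" .
    qed
    then have "\<exists>!k. k \<in> hom C x c' \<and> (\<forall>a \<in> Ob (ord_cat (Restr r A)). k \<cdot> \<kappa> a = \<kappa>' a)"
      using colim unfolding is_colimit_def by blast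
    moreover have "(\<forall>a \<in> Ob (ord_cat (Restr r A)). k \<cdot> \<kappa> a = \<kappa>' a) \<longleftrightarrow>
        (\<forall>b \<in> Ob (ord_cat r'). k \<cdot> (\<kappa> \<circ> h) b = \<iota> b)" if k: "k \<in> hom C x c'" for k
    proof
      assume L: "\<forall>a \<in> Ob (ord_cat (Restr r A)). k \<cdot> \<kappa> a = \<kappa>' a"
      show "\<forall>b \<in> Ob (ord_cat r'). k \<cdot> (\<kappa> \<circ> h) b = \<iota> b"
      proof
        fix b assume "b \<in> Ob (ord_cat r')"
        then have b: "b \<in> Field r'" by simp
        have hb: "(h b, h b) \<in> r" by (rule h[OF R'.le_refl[OF b]])
        have "k \<cdot> (\<kappa> \<circ> h) b = \<kappa>' (h b)" using L hA[OF b] by (simp add: F)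
        also have "\<dots> = \<iota> b"
          using \<kappa>'_eq[OF hA[OF b] b hb] X'(2) A hA[OF b] ident_right[OF \<iota>h[OF b]] by auto
        finally show "k \<cdot> (\<kappa> \<circ> h) b = \<iota> b" .
      qed
    next
      assume L: "\<forall>b \<in> Ob (ord_cat r'). k \<cdot> (\<kappa> \<circ> h) b = \<iota> b"
      show "\<forall>a \<in> Ob (ord_cat (Restr r A)). k \<cdot> \<kappa> a = \<kappa>' a"
      proof
        fix a assume "a \<in> Ob (ord_cat (Restr r A))"
        then have a: "a \<in> A" by (simp add: F)
        note b = \<beta>[OF a]
        have "k \<cdot> \<kappa> a = k \<cdot> (\<kappa> (h (\<beta> a)) \<cdot> fmor X (a, h (\<beta> a)))"
          using \<kappa>X[OF a hA[OF b(1)] b(2)] by simp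
        also have "\<dots> = k \<cdot> \<kappa> (h (\<beta> a)) \<cdot> fmor X (a, h (\<beta> a))"
          using comp_assoc[OF X'(3)[OF b(2)] \<kappa>[OF hA[OF b(1)]] k] by simp
        also have "\<dots> = \<kappa>' a" using L b(1) unfolding \<kappa>'_def by simp
        finally show "k \<cdot> \<kappa> a = \<kappa>' a" .
      qed
    qed
    ultimately show ?thesis by metis
  qed
  then show ?thesis unfolding is_colimit_def using 1 by blast
qed

lemma top_colimit:
  fixes C :: "('o, 'm) cat" (structure)
  assumes X: "cat_functor (ord_cat r) C X" and d: "d \<in> Field r" and top: "\<And>b. b \<in> Field r \<Longrightarrow> (b, d) \<in> r"
  shows "is_colimit (ord_cat r) C X (fob X d) (\<lambda>b. fmor X (b, d))"
proof -
  interpret category C using X unfolding cat_functor_def by blast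
  note X' = functorD[OF X]
  show ?thesis unfolding is_colimit_def
  proof (intro conjI allI impI)
    show "cocone (ord_cat r) C X (fob X d) (\<lambda>b. fmor X (b, d))"
      unfolding cocone_ord_iff using X' d top in_Field by blast
    fix c \<iota> assume \<iota>: "cocone (ord_cat r) C X c \<iota>"
    then have \<iota>d: "\<iota> d \<in> hom C (fob X d) c" and \<iota>X: "\<And>b. b \<in> Field r \<Longrightarrow> \<iota> d \<cdot> fmor X (b, d) = \<iota> b"
      using d top unfolding cocone_ord_iff by blast+
    show "\<exists>!h. h \<in> hom C (fob X d) c \<and> (\<forall>b \<in> Ob (ord_cat r). h \<cdot> fmor X (b, d) = \<iota> b)"
    proof (rule ex1I[of _ "\<iota> d"])
      show "\<iota> d \<in> hom C (fob X d) c \<and> (\<forall>b \<in> Ob (ord_cat r). \<iota> d \<cdot> fmor X (b, d) = \<iota> b)"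
        using \<iota>d \<iota>X by simp
      fix h assume h: "h \<in> hom C (fob X d) c \<and> (\<forall>b \<in> Ob (ord_cat r). h \<cdot> fmor X (b, d) = \<iota> b)"
      then show "h = \<iota> d" using X'(2)[OF d] ident_right[of h "fob X d" c] d by auto
    qed
  qed
qed

end

text \<open>
  The arrow \<open>X (a, d)\<close> is the transfinite composition of the restriction of \<open>X\<close> to \<open>{a..d}\<close>. Including \<open>d\<close>
  makes the colimit trivial, whether \<open>d\<close> is a limit or a successor.
\<close>

lemma interval_transfinite_composition:
  fixes U :: "'u itself" and r :: "'u rel"
  assumes X: "lambda_sequence r C X" and ad: "(a, d) \<in> r"
    and small: "small U {b. (a, b) \<in> r \<and> (b, d) \<in> r}"
    and K: "\<And>b c. \<lbrakk>succ_in r b c; (a, b) \<in> r; (c, d) \<in> r\<rbrakk> \<Longrightarrow> fmor X (b, c) \<in> K"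
  shows "fmor X (a, d) \<in> transfinite_compositions U C K"
proof -
  interpret R: well_ordering r using X unfolding lambda_sequence_def by unfold_locales blast
  have XF: "cat_functor (ord_cat r) C X" using X unfolding lambda_sequence_def by blast
  define E where "E = {b. (a, b) \<in> r \<and> (b, d) \<in> r}"
  define r' where "r' = Restr r E"
  interpret E: well_ordering r' unfolding r'_def by (rule R.well_ordering_Restr)
  have E_Field: "E \<subseteq> Field r" unfolding E_def using R.in_Field by blast
  have F: "Field r' = E" unfolding r'_def by (rule Field_Restr_subset[OF R.Refl E_Field])
  have r'_iff: "(b, c) \<in> r' \<longleftrightarrow> (b, c) \<in> r \<and> b \<in> E \<and> c \<in> E" for b c unfolding r'_def by auto
  have aF: "a \<in> Field r" "d \<in> Field r" using R.in_Field[OF ad] by auto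
  have aE: "a \<in> E" "d \<in> E" unfolding E_def using ad R.le_refl aF by auto
  have convex: "b \<in> E" if "(a, b) \<in> r" "(b, c) \<in> r" "c \<in> E" for b c
    using that R.le_trans unfolding E_def by blast
  have succ: "succ_in r b c" "b \<in> E" "c \<in> E" if s: "succ_in r' b c" for b c
  proof -
    show bc: "b \<in> E" "c \<in> E" using s r'_iff unfolding succ_in_def by blast+
    show "succ_in r b c" unfolding succ_in_def
    proof (intro conjI allI impI)
      show "(b, c) \<in> r" "b \<noteq> c" using s r'_iff unfolding succ_in_def by blast+
      fix e assume e: "(b, e) \<in> r \<and> (e, c) \<in> r"
      then have "e \<in> E" using bc convex[of e c] R.le_trans[of a b e] unfolding E_def by blast
      then show "e = b \<or> e = c" using s e bc r'_iff unfolding succ_in_def by blast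
    qed
  qed
  have XF': "cat_functor (ord_cat r') C X" unfolding r'_def by (rule R.functor_Restr[OF XF])
  have zero: "zero_in r' a"
    unfolding zero_in_def F using aE R.le_antisym by (auto simp: E.below_iff r'_iff E_def)
  have lim: "is_colimit (ord_cat (Restr r' (E.below c))) C X (fob X c) (\<lambda>b. fmor X (b, c))"
    if l: "limit_in r' c" for c
  proof -
    have c: "c \<in> E" using l F unfolding limit_in_def by blast
    have ca: "c \<noteq> a" using l zero unfolding limit_in_def by blast
    then have ac: "a \<in> R.below c" using c unfolding E_def by (auto simp: R.below_iff)
    have "\<not> succ_in r b c" for b
    proof
      assume s: "succ_in r b c"
      then have "(a, b) \<in> r" using ac R.below_succ_iff by blast
      then have b: "b \<in> E" using s c convex unfolding succ_in_def by blast
      then have "succ_in r' b c" using s c unfolding succ_in_def r'_iff by blast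
      then show False using l unfolding limit_in_def by blast
    qed
    then have "limit_in r c"
      using ac c E_Field unfolding limit_in_def zero_in_def by blast
    then have colim: "is_colimit (ord_cat (Restr r (R.below c))) C X (fob X c) (\<lambda>b. fmor X (b, c))"
      using X unfolding lambda_sequence_def by blast
    define r2 where "r2 = Restr r' (E.below c)"
    interpret E2: well_ordering r2 unfolding r2_def by (rule E.well_ordering_Restr)
    have F2: "Field r2 = E.below c" unfolding r2_def by (rule E.Field_below)
    have below: "b \<in> E.below c \<longleftrightarrow> b \<in> R.below c \<and> (a, b) \<in> r" for b
      using c convex R.in_Field by (auto simp: E.below_iff R.below_iff r'_iff E_def)
    have "is_colimit (ord_cat r2) C (reindex X id) (fob X c) ((\<lambda>b. fmor X (b, c)) \<circ> id)"
    proof (rule R.cofinal_colimit[OF XF _ colim E2.well_ordering_axioms])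
      show "R.below c \<subseteq> Field r" using R.below_Field by blast
      show "(id b, id b') \<in> r" if "(b, b') \<in> r2" for b b' using that unfolding r2_def r'_def by auto
      show "id b \<in> R.below c" if "b \<in> Field r2" for b using that unfolding F2 below by simp
      show "\<exists>b' \<in> Field r2. (b, id b') \<in> r" if b: "b \<in> R.below c" for b
      proof (cases "(a, b) \<in> r")
        case True
        then show ?thesis
          using b R.le_refl[of b] R.below_Field[OF b] by (intro bexI[of _ b]) (auto simp: F2 below)
      next
        case False
        then have "(b, a) \<in> r" using R.le_total aF b R.below_Field by blast
        then show ?thesis
          using ac R.le_refl[OF aF(1)] by (intro bexI[of _ a]) (auto simp: F2 below)
      qed
    qed
    then show ?thesis unfolding r2_def[symmetric]
      by (rule is_colimit_cong[OF _ category_ord_cat[OF E2.Refl E2.trans]]) auto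
  qed
  have "lambda_sequence_of r' C K X"
    unfolding lambda_sequence_of_def lambda_sequence_def
    using E.wo XF' lim succ K unfolding E_def by blast
  moreover have "is_colimit (ord_cat r') C X (fob X d) (\<lambda>b. fmor X (b, d))"
    by (rule E.top_colimit[OF XF']) (use aE in \<open>auto simp: F r'_iff E_def\<close>)
  moreover have "small U (Field r')" unfolding F E_def by (rule small)
  ultimately show ?thesis unfolding transfinite_compositions_def using zero
    by (intro CollectI exI[of _ r'] exI[of _ X] exI[of _ "fob X d"] exI[of _ "\<lambda>b. fmor X (b, d)"]
        exI[of _ a]) simp
qed


section \<open>Smallness\<close>

text \<open>
  The elementary meaning of bijectivity of the comparison map: each arrow into the colimit factors
  through some stage, and essentially uniquely so.
\<close>

definition hom_preserved ::
    "'i rel \<Rightarrow> ('o, 'm) cat \<Rightarrow> ('i, 'i \<times> 'i, 'o, 'm) fnctr \<Rightarrow> 'o \<Rightarrow> ('i \<Rightarrow> 'm) \<Rightarrow> 'o \<Rightarrow> bool" where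
  "hom_preserved r C X c \<iota> w \<longleftrightarrow>
     (\<forall>u \<in> hom C w c. \<exists>b \<in> Field r. \<exists>f \<in> hom C w (fob X b). \<iota> b \<cdot>\<^bsub>C\<^esub> f = u) \<and>
     (\<forall>b \<in> Field r. \<forall>b' \<in> Field r. \<forall>f \<in> hom C w (fob X b). \<forall>g \<in> hom C w (fob X b').
        \<iota> b \<cdot>\<^bsub>C\<^esub> f = \<iota> b' \<cdot>\<^bsub>C\<^esub> g \<longrightarrow>
        (\<exists>d. (b, d) \<in> r \<and> (b', d) \<in> r \<and> fmor X (b, d) \<cdot>\<^bsub>C\<^esub> f = fmor X (b', d) \<cdot>\<^bsub>C\<^esub> g))"

lemma hom_colim_map_bij_iff:
  fixes C :: "('o, 'm) cat" (structure)
  assumes r: "well_ordering r" and X: "cat_functor (ord_cat r) C X"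
    and c: "cocone (ord_cat r) C X c \<iota>"
  shows "bij_betw (hom_colim_map C \<iota>) (hom_colim r C X w) (hom C w c) \<longleftrightarrow> hom_preserved r C X c \<iota> w"
proof -
  interpret R: well_ordering r by fact
  interpret category C using X unfolding cat_functor_def by blast
  note X' = R.functorD[OF X]
  note cc = c[unfolded cocone_ord_iff]
  define S where "S = hom_sum r C X w"
  define E where "E = {((b, f), (c, g)). (b, f) \<in> S \<and> (c, g) \<in> S \<and>
          (\<exists>d. (b, d) \<in> r \<and> (c, d) \<in> r \<and> fmor X (b, d) \<cdot> f = fmor X (c, d) \<cdot> g)}"
  define \<tau> where "\<tau> = (\<lambda>(b, f). \<iota> b \<cdot> f)"
  have S: "(b, f) \<in> S \<longleftrightarrow> b \<in> Field r \<and> f \<in> hom C w (fob X b)" for b f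
    unfolding S_def hom_sum_def by simp
  have E: "((b, f), (b', g)) \<in> E \<longleftrightarrow> (b, f) \<in> S \<and> (b', g) \<in> S \<and>
      (\<exists>d. (b, d) \<in> r \<and> (b', d) \<in> r \<and> fmor X (b, d) \<cdot> f = fmor X (b', d) \<cdot> g)" for b f b' g
    unfolding E_def by simp
  have push: "fmor X (b, e) \<cdot> f = fmor X (b', e) \<cdot> g"
    if "(b, f) \<in> S" "(b', g) \<in> S" "(b, d) \<in> r" "(b', d) \<in> r" "(d, e) \<in> r"
      and eq: "fmor X (b, d) \<cdot> f = fmor X (b', d) \<cdot> g" for b b' d e f g
  proof -
    have f: "f \<in> hom C w (fob X b)" and g: "g \<in> hom C w (fob X b')" using that(1,2) S by auto
    have "fmor X (b, e) \<cdot> f = fmor X (d, e) \<cdot> (fmor X (b, d) \<cdot> f)"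
      using comp_assoc[OF f X'(3)[OF that(3)] X'(3)[OF that(5)]] X'(4)[OF that(3,5)] by simp
    moreover have "fmor X (b', e) \<cdot> g = fmor X (d, e) \<cdot> (fmor X (b', d) \<cdot> g)"
      using comp_assoc[OF g X'(3)[OF that(4)] X'(3)[OF that(5)]] X'(4)[OF that(4,5)] by simp
    ultimately show ?thesis using eq by simp
  qed
  have equiv: "equiv S E"
  proof (rule equivI)
    show "E \<subseteq> S \<times> S" using E by auto
    show "refl_on S E"
    proof (rule refl_onI)
      fix x assume x: "x \<in> S"
      obtain b f where bf: "x = (b, f)" by (cases x) blast
      then have "(b, b) \<in> r" using x S R.le_refl by simp
      then show "(x, x) \<in> E" using x unfolding bf E by (intro conjI exI[of _ b]) simp_all
    qed
    show "sym E"
    proof (rule symI)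
      fix x y assume xy: "(x, y) \<in> E"
      obtain b f b' g where x: "x = (b, f)" "y = (b', g)" by (cases x, cases y) blast
      obtain d where "(b, f) \<in> S" "(b', g) \<in> S" "(b, d) \<in> r" "(b', d) \<in> r"
        "fmor X (b, d) \<cdot> f = fmor X (b', d) \<cdot> g"
        using xy unfolding x E by blast
      then show "(y, x) \<in> E" unfolding x E by (intro conjI exI[of _ d]) simp_all
    qed
    show "trans E" unfolding trans_def
    proof (intro allI impI)
      fix x y z assume xy: "(x, y) \<in> E" and yz: "(y, z) \<in> E"
      obtain b f b' g b'' h where x: "x = (b, f)" "y = (b', g)" "z = (b'', h)" by (cases x, cases y, cases z) blast
      obtain d where S1: "(b, f) \<in> S" "(b', g) \<in> S" and
        d: "(b, d) \<in> r" "(b', d) \<in> r" "fmor X (b, d) \<cdot> f = fmor X (b', d) \<cdot> g"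
        using xy unfolding x E by blast
      obtain e where S2: "(b'', h) \<in> S" and
        e: "(b', e) \<in> r" "(b'', e) \<in> r" "fmor X (b', e) \<cdot> g = fmor X (b'', e) \<cdot> h"
        using yz unfolding x E by blast
      have dF: "d \<in> Field r" "e \<in> Field r" using d e R.in_Field by blast+
      then obtain k where k: "(d, k) \<in> r" "(e, k) \<in> r" using R.le_total R.le_refl by blast
      have "fmor X (b, k) \<cdot> f = fmor X (b'', k) \<cdot> h"
        using push[OF S1 d(1,2) k(1) d(3)] push[OF S1(2) S2 e(1,2) k(2) e(3)] by simp
      then show "(x, z) \<in> E"
        unfolding x E using S1 S2 R.le_trans[OF d(1) k(1)] R.le_trans[OF e(2) k(2)] by blast
    qed
  qed
  have resp: "\<tau> z = \<tau> z'" if zz: "(z, z') \<in> E" for z z'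
  proof -
    obtain b f b' g where z: "z = (b, f)" "z' = (b', g)" by (cases z, cases z') blast
    obtain d where d: "(b, d) \<in> r" "(b', d) \<in> r" "fmor X (b, d) \<cdot> f = fmor X (b', d) \<cdot> g"
      and f: "f \<in> hom C w (fob X b)" and g: "g \<in> hom C w (fob X b')"
      using zz unfolding z E S by blast
    have \<iota>: "\<iota> d \<in> hom C (fob X d) c" using cc R.in_Field[OF d(1)] by blast
    have eq: "\<iota> d \<cdot> fmor X (b, d) = \<iota> b" "\<iota> d \<cdot> fmor X (b', d) = \<iota> b'" using cc d(1,2) by blast+
    show ?thesis
      using comp_assoc[OF f X'(3)[OF d(1)] \<iota>] comp_assoc[OF g X'(3)[OF d(2)] \<iota>] d(3) eq
      unfolding z \<tau>_def by simp
  qed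
  have colim: "hom_colim r C X w = S // E" unfolding hom_colim_def S_def E_def by simp
  have map: "hom_colim_map C \<iota> (E `` {z}) = \<tau> z" if "z \<in> S" for z
  proof -
    have "z \<in> E `` {z}" using equiv that by (rule equiv_class_self)
    moreover have "\<tau> z' = \<tau> z" if "z' \<in> E `` {z}" for z'
      using resp[of z z'] that by simp
    ultimately have "\<tau> ` (E `` {z}) = {\<tau> z}" by blast
    then show ?thesis unfolding hom_colim_map_def \<tau>_def by simp
  qed
  have inj: "inj_on (hom_colim_map C \<iota>) (S // E) \<longleftrightarrow> (\<forall>z \<in> S. \<forall>z' \<in> S. \<tau> z = \<tau> z' \<longrightarrow> (z, z') \<in> E)"
  proof
    assume inj: "inj_on (hom_colim_map C \<iota>) (S // E)"
    show "\<forall>z \<in> S. \<forall>z' \<in> S. \<tau> z = \<tau> z' \<longrightarrow> (z, z') \<in> E"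
    proof (intro ballI impI)
      fix z z' assume z: "z \<in> S" "z' \<in> S" "\<tau> z = \<tau> z'"
      then have "E `` {z} = E `` {z'}"
        using inj_onD[OF inj, of "E `` {z}" "E `` {z'}"] map quotientI by metis
      then show "(z, z') \<in> E" using eq_equiv_class_iff[OF equiv z(1,2)] by blast
    qed
  next
    assume R: "\<forall>z \<in> S. \<forall>z' \<in> S. \<tau> z = \<tau> z' \<longrightarrow> (z, z') \<in> E"
    show "inj_on (hom_colim_map C \<iota>) (S // E)"
    proof (rule inj_onI)
      fix A B assume A: "A \<in> S // E" and B: "B \<in> S // E" and eq: "hom_colim_map C \<iota> A = hom_colim_map C \<iota> B"
      obtain z where z: "z \<in> S" "A = E `` {z}" using A by (rule quotientE)
      obtain z' where z': "z' \<in> S" "B = E `` {z'}" using B by (rule quotientE)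
      have "(z, z') \<in> E" using R z z' eq map by auto
      then show "A = B" using equiv_class_eq[OF equiv] z z' by simp
    qed
  qed
  have img: "hom_colim_map C \<iota> ` (S // E) = \<tau> ` S"
  proof -
    have "S // E = (\<lambda>z. E `` {z}) ` S" unfolding quotient_def by blast
    then show ?thesis using map by (simp add: image_image)
  qed
  have sub: "\<tau> ` S \<subseteq> hom C w c"
    using S cc comp_closed unfolding \<tau>_def by auto
  have "bij_betw (hom_colim_map C \<iota>) (hom_colim r C X w) (hom C w c) \<longleftrightarrow>
      hom C w c \<subseteq> \<tau> ` S \<and> (\<forall>z \<in> S. \<forall>z' \<in> S. \<tau> z = \<tau> z' \<longrightarrow> (z, z') \<in> E)"
    unfolding bij_betw_def colim inj img using sub by blast
  also have "\<dots> \<longleftrightarrow> hom_preserved r C X c \<iota> w"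
  proof -
    have 1: "hom C w c \<subseteq> \<tau> ` S \<longleftrightarrow> (\<forall>u \<in> hom C w c. \<exists>b \<in> Field r. \<exists>f \<in> hom C w (fob X b). \<iota> b \<cdot> f = u)"
    proof -
      have "u \<in> \<tau> ` S \<longleftrightarrow> (\<exists>b \<in> Field r. \<exists>f \<in> hom C w (fob X b). \<iota> b \<cdot> f = u)" for u
        unfolding \<tau>_def S_def hom_sum_def by (auto simp: image_iff)
      then show ?thesis by blast
    qed
    have 2: "(\<forall>z \<in> S. \<forall>z' \<in> S. \<tau> z = \<tau> z' \<longrightarrow> (z, z') \<in> E) \<longleftrightarrow>
      (\<forall>b \<in> Field r. \<forall>b' \<in> Field r. \<forall>f \<in> hom C w (fob X b). \<forall>g \<in> hom C w (fob X b').
        \<iota> b \<cdot> f = \<iota> b' \<cdot> g \<longrightarrow>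
        (\<exists>d. (b, d) \<in> r \<and> (b', d) \<in> r \<and> fmor X (b, d) \<cdot> f = fmor X (b', d) \<cdot> g))"
      unfolding \<tau>_def split_paired_all Ball_def by (simp add: S E) blast
    show ?thesis unfolding hom_preserved_def 1 2 ..
  qed
  finally show ?thesis .
qed

section \<open>The small object argument\<close>

definition squares :: "('o, 'm) cat \<Rightarrow> 'm set \<Rightarrow> 'o \<Rightarrow> 'o \<Rightarrow> 'm \<Rightarrow> ('m \<times> 'm \<times> 'm) set" where
  "squares C K y w q = {(i, u, v). i \<in> K \<and> u \<in> hom C (Dom C i) w \<and> v \<in> hom C (Cod C i) y \<and>
     q \<cdot>\<^bsub>C\<^esub> u = v \<cdot>\<^bsub>C\<^esub> i}"

lemma (in bicomplete_category) small_squares: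
  assumes K: "K \<subseteq> Arr C" "small U K" and w: "w \<in> Ob C" "y \<in> Ob C"
  shows "small U (squares C K y w q)"
proof -
  have "Dom C i \<in> Ob C" "Cod C i \<in> Ob C" if "i \<in> K" for i
    using that K(1) dom_closed cod_closed by blast+
  then have "small U (SIGMA i : K. hom C (Dom C i) w \<times> hom C (Cod C i) y)"
    using K(2) w by (intro small_Sigma small_hom) auto
  then show ?thesis by (rule small_subset) (auto simp: squares_def)
qed

definition enumeration :: "'a set \<Rightarrow> 'u \<Rightarrow> 'a" where
  "enumeration A = (SOME e. range e = A)"

lemma (in universe) range_enumeration:
  assumes "small U A" "A \<noteq> {}"
  shows "range (enumeration A :: 'u \<Rightarrow> 'a) = A"
  using someI_ex[OF small_surj_ex[OF assms]] unfolding enumeration_def .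

text \<open>
  The stage \<open>b\<close> is extended by one cell. The bookkeeping function says which square of a stage
  \<open>\<gamma> \<le> b\<close> the new cell has to solve; if its value is meaningless then any square will do. Only if there are
  no squares at all, so that the desired factorization has been reached, does nothing happen.
\<close>

definition attach ::
    "'u rel \<Rightarrow> ('u \<Rightarrow> 'u \<times> 'u) \<Rightarrow> ('o, 'm) cat \<Rightarrow> 'm set \<Rightarrow> 'o \<Rightarrow> 'u \<Rightarrow> ('u, 'u \<times> 'u, 'o, 'm) fnctr \<Rightarrow>
      ('u \<Rightarrow> 'm) \<Rightarrow> 'm \<Rightarrow> 'm \<Rightarrow> bool" where
  "attach r d C K y b X p g q \<longleftrightarrow>
     (squares C K y (fob X b) (p b) = {} \<and> g = Ident C (fob X b) \<and> q = p b) \<or>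
     (\<exists>i u v v'. (i, u, v) \<in> squares C K y (fob X b) (p b) \<and> is_pushout C i u g v' \<and> q \<cdot>\<^bsub>C\<^esub> v' = v \<and>
        (\<forall>\<gamma> t i0 u0 v0. d b = (\<gamma>, t) \<and> (\<gamma>, b) \<in> r \<and> squares C K y (fob X \<gamma>) (p \<gamma>) \<noteq> {} \<and>
           enumeration (squares C K y (fob X \<gamma>) (p \<gamma>)) t = (i0, u0, v0) \<longrightarrow>
           i = i0 \<and> u = fmor X (\<gamma>, b) \<cdot>\<^bsub>C\<^esub> u0 \<and> v = v0))"

text \<open>
  The sequence of the small object argument for an arrow into \<open>y\<close>; its length is that of the class of all
  small ordinals.
\<close>

locale attaching_sequence = bicomplete_category U C
  for U :: "'u itself" and C :: "('o, 'm) cat" (structure) +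
  fixes K :: "'m set" and y :: 'o and d :: "'u \<Rightarrow> 'u \<times> 'u"
    and X :: "('u, 'u \<times> 'u, 'o, 'm) fnctr" and p :: "'u \<Rightarrow> 'm"
  assumes K: "K \<subseteq> Arr C" "small U K" and y: "y \<in> Ob C"
    and d: "\<And>\<gamma> t \<alpha>. \<exists>\<beta>. (\<alpha>, \<beta>) \<in> ord \<and> d \<beta> = (\<gamma>, t)"
    and X: "lambda_sequence ord C X"
    and p: "natural ord C X (const_functor C y) p"
    and attach: "succ_in ord b c \<Longrightarrow> attach ord d C K y b X p (fmor X (b, c)) (p c)"
begin

abbreviation sq :: "'u \<Rightarrow> ('m \<times> 'm \<times> 'm) set" where "sq b \<equiv> squares C K y (fob X b) (p b)"

lemma K_hom: "i \<in> K \<Longrightarrow> i \<in> hom C (Dom C i) (Cod C i)"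
  using Arr_hom[of i C] K(1) by blast

lemma X_functor: "cat_functor (ord_cat ord) C X"
  using X unfolding lambda_sequence_def by blast

lemma X_Ob: "fob X b \<in> Ob C"
  using ord.functorD(1)[OF X_functor] by (simp add: Field_ord)

lemmas X_hom = ord.functorD(3)[OF X_functor]

lemmas X_comp = ord.functorD(4)[OF X_functor]

lemma p_hom: "p b \<in> hom C (fob X b) y"
  using p unfolding natural_def by (simp add: const_functor_def Field_ord)

lemma p_X: "(a, b) \<in> ord \<Longrightarrow> p b \<cdot> fmor X (a, b) = p a"
  using p ident_left[OF p_hom] unfolding natural_def by (simp add: const_functor_def)

lemma cell_complex:
  assumes ae: "(a, e) \<in> ord" and ne: "\<And>b. b \<in> ord.below e \<Longrightarrow> sq b \<noteq> {}"
  shows "fmor X (a, e) \<in> relative_cell_complexes U C K"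
  unfolding relative_cell_complexes_def
proof (rule interval_transfinite_composition[OF X ae])
  have "{b. (a, b) \<in> ord \<and> (b, e) \<in> ord} \<subseteq> ord.below e \<union> {e}" by (auto simp: ord.below_iff)
  then show "small U {b. (a, b) \<in> ord \<and> (b, e) \<in> ord}"
    by (rule small_subset[OF small_Un[OF small_below small_finite], rotated]) simp
  fix b c assume s: "succ_in ord b c" and "(c, e) \<in> ord"
  then have "b \<in> ord.below e" using ord.below_le_trans[OF ord.succ_below] by blast
  then have "\<exists>i u v v'. (i, u, v) \<in> sq b \<and> is_pushout C i u (fmor X (b, c)) v'"
    using attach[OF s] ne unfolding attach_def by blast
  then show "fmor X (b, c) \<in> pushouts C K" unfolding pushouts_def squares_def by blast
qed

definition solved :: "'u \<Rightarrow> 'u \<Rightarrow> 'm \<times> 'm \<times> 'm \<Rightarrow> bool" where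
  "solved \<gamma> \<delta> = (\<lambda>(i, u, v). \<exists>h \<in> hom C (Cod C i) (fob X \<delta>). h \<cdot> i = fmor X (\<gamma>, \<delta>) \<cdot> u \<and> p \<delta> \<cdot> h = v)"

text \<open>
  That \<open>\<gamma>\<close> lies strictly below \<open>\<delta>\<close> makes sequences of stages handling each other strictly increasing.
\<close>

definition handled :: "'u \<Rightarrow> 'u \<Rightarrow> bool" where
  "handled \<gamma> \<delta> \<longleftrightarrow> \<gamma> \<in> ord.below \<delta> \<and> (\<forall>s \<in> sq \<gamma>. solved \<gamma> \<delta> s)"

lemma solved_mono:
  assumes "solved \<gamma> \<delta> s" "s \<in> sq \<gamma>" "(\<gamma>, \<delta>) \<in> ord" "(\<delta>, \<epsilon>) \<in> ord"
  shows "solved \<gamma> \<epsilon> s"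
proof -
  obtain i u v where s: "s = (i, u, v)" by (cases s) blast
  then obtain h where h: "h \<in> hom C (Cod C i) (fob X \<delta>)" "h \<cdot> i = fmor X (\<gamma>, \<delta>) \<cdot> u" "p \<delta> \<cdot> h = v"
    using assms(1) unfolding solved_def by auto
  have i: "i \<in> hom C (Dom C i) (Cod C i)" and u: "u \<in> hom C (Dom C i) (fob X \<gamma>)"
    using assms(2) s K_hom unfolding squares_def by auto
  show ?thesis unfolding solved_def s prod.case
  proof (intro bexI conjI)
    show "fmor X (\<delta>, \<epsilon>) \<cdot> h \<in> hom C (Cod C i) (fob X \<epsilon>)"
      using h(1) X_hom[OF assms(4)] by (rule comp_closed)
    show "fmor X (\<delta>, \<epsilon>) \<cdot> h \<cdot> i = fmor X (\<gamma>, \<epsilon>) \<cdot> u"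
      using comp_assoc[OF i h(1) X_hom[OF assms(4)]] h(2)
        comp_assoc[OF u X_hom[OF assms(3)] X_hom[OF assms(4)]] X_comp[OF assms(3,4)] by simp
    show "p \<epsilon> \<cdot> (fmor X (\<delta>, \<epsilon>) \<cdot> h) = v"
      using comp_assoc[OF h(1) X_hom[OF assms(4)] p_hom] p_X[OF assms(4)] h(3) by simp
  qed
qed

lemma handled_mono:
  assumes "handled \<gamma> \<delta>" "(\<delta>, \<epsilon>) \<in> ord"
  shows "handled \<gamma> \<epsilon>"
  using assms solved_mono[of \<gamma> \<delta> _ \<epsilon>] ord.below_le_trans[of \<gamma> \<delta> \<epsilon>] ord.below_iff[of \<gamma> \<delta>]
  unfolding handled_def by blast

lemma succ_exists: obtains c where "succ_in ord b c"
proof -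
  have "small U {b}" by (rule small_finite) simp
  then obtain b' where "b \<in> ord.below b'" using small_bounded by blast
  then show ?thesis using that ord.succ_ex by metis
qed

text \<open>
  The bookkeeping function proposes \<open>s\<close> at some stage \<open>b \<ge> \<gamma>\<close>; the cell attached to \<open>X b\<close> is then the
  lift.
\<close>

lemma eventually_solved:
  assumes s: "s \<in> sq \<gamma>"
  shows "\<exists>\<delta>. \<gamma> \<in> ord.below \<delta> \<and> solved \<gamma> \<delta> s"
proof -
  have ne: "sq \<gamma> \<noteq> {}" using s by blast
  obtain i u v where siuv: "s = (i, u, v)" by (cases s) blast
  have i: "i \<in> hom C (Dom C i) (Cod C i)" and u: "u \<in> hom C (Dom C i) (fob X \<gamma>)"
    and v: "v \<in> hom C (Cod C i) y" and sqr: "p \<gamma> \<cdot> u = v \<cdot> i" and iK: "i \<in> K"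
    using s siuv K_hom unfolding squares_def by auto
  obtain t :: 'u where t: "enumeration (sq \<gamma>) t = s"
    using range_enumeration[OF small_squares[OF K X_Ob y] ne] s by (metis imageE)
  obtain b where b: "(\<gamma>, b) \<in> ord" "d b = (\<gamma>, t)" using d by blast
  obtain c where c: "succ_in ord b c" by (rule succ_exists)
  have bc: "(b, c) \<in> ord" "b \<in> ord.below c" using c ord.succ_below[OF c] unfolding succ_in_def by auto
  have "(i, fmor X (\<gamma>, b) \<cdot> u, v) \<in> sq b"
    using iK v comp_closed[OF u X_hom[OF b(1)]] comp_assoc[OF u X_hom[OF b(1)] p_hom] p_X[OF b(1)] sqr
    unfolding squares_def by simp
  then have "sq b \<noteq> {}" by blast
  then obtain v' where po: "is_pushout C i (fmor X (\<gamma>, b) \<cdot> u) (fmor X (b, c)) v'" "p c \<cdot> v' = v"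
    using attach[OF c] b ne t siuv unfolding attach_def by blast
  have v': "v' \<in> hom C (Cod C i) (fob X c)"
    using po(1) X_hom[OF bc(1)] unfolding is_pushout_def hom_def by simp
  have "v' \<cdot> i = fmor X (b, c) \<cdot> (fmor X (\<gamma>, b) \<cdot> u)" using po(1) unfolding is_pushout_def by simp
  also have "\<dots> = fmor X (\<gamma>, c) \<cdot> u"
    using comp_assoc[OF u X_hom[OF b(1)] X_hom[OF bc(1)]] X_comp[OF b(1) bc(1)] by simp
  finally have "solved \<gamma> c s" unfolding solved_def siuv using v' po(2) by auto
  moreover have "\<gamma> \<in> ord.below c" using b(1) bc(2) by (rule ord.le_below_trans)
  ultimately show ?thesis by blast
qed

lemma eventually_handled: "\<exists>\<delta>. handled \<gamma> \<delta>"
proof -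
  have "\<forall>s \<in> sq \<gamma>. \<exists>\<delta>. \<gamma> \<in> ord.below \<delta> \<and> solved \<gamma> \<delta> s" using eventually_solved by blast
  from bchoice[OF this] obtain D where
    D: "\<And>s. s \<in> sq \<gamma> \<Longrightarrow> \<gamma> \<in> ord.below (D s) \<and> solved \<gamma> (D s) s" by blast
  obtain c where c: "succ_in ord \<gamma> c" by (rule succ_exists)
  have "small U (D ` sq \<gamma>)" by (rule small_surj[OF small_squares[OF K X_Ob y] order_refl])
  then obtain \<delta>0 where \<delta>0: "D ` sq \<gamma> \<subseteq> ord.below \<delta>0" by (rule small_bounded)
  have "small U {c, \<delta>0}" by (rule small_finite) simp
  then obtain \<delta> where \<delta>: "{c, \<delta>0} \<subseteq> ord.below \<delta>" by (rule small_bounded)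
  have "\<gamma> \<in> ord.below \<delta>" using ord.below_trans[OF ord.succ_below[OF c]] \<delta> by blast
  moreover have "solved \<gamma> \<delta> s" if s: "s \<in> sq \<gamma>" for s
  proof (rule solved_mono[OF _ s])
    show "solved \<gamma> (D s) s" "(\<gamma>, D s) \<in> ord" using D[OF s] by (auto simp: ord.below_iff)
    have "D s \<in> ord.below \<delta>" using ord.below_trans[of "D s" \<delta>0 \<delta>] \<delta>0 \<delta> s by blast
    then show "(D s, \<delta>) \<in> ord" by (simp add: ord.below_iff)
  qed
  ultimately show ?thesis unfolding handled_def by blast
qed

definition least_handling :: "'u set \<Rightarrow> 'u \<Rightarrow> bool" where
  "least_handling A \<delta> \<longleftrightarrow> (\<forall>\<gamma> \<in> A. handled \<gamma> \<delta>) \<and> (\<forall>\<epsilon>. (\<forall>\<gamma> \<in> A. handled \<gamma> \<epsilon>) \<longrightarrow> (\<delta>, \<epsilon>) \<in> ord)"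

lemma least_handling_ex:
  assumes "small U A"
  shows "\<exists>\<delta>. least_handling A \<delta>"
proof -
  obtain G where G: "\<And>\<gamma>. handled \<gamma> (G \<gamma>)" using eventually_handled by metis
  have "small U (G ` A)" by (rule small_surj[OF assms order_refl])
  then obtain \<delta> where \<delta>: "G ` A \<subseteq> ord.below \<delta>" by (rule small_bounded)
  have "handled \<gamma> \<delta>" if "\<gamma> \<in> A" for \<gamma>
  proof (rule handled_mono[OF G])
    show "(G \<gamma>, \<delta>) \<in> ord" using \<delta> that ord.below_iff[of "G \<gamma>" \<delta>] by blast
  qed
  then have ne: "{\<delta>. \<forall>\<gamma> \<in> A. handled \<gamma> \<delta>} \<noteq> {}" by blast
  have "{\<delta>. \<forall>\<gamma> \<in> A. handled \<gamma> \<delta>} \<subseteq> Field ord" by (simp add: Field_ord)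
  from ord.least_ex[OF this ne] obtain m where
    "m \<in> {\<delta>. \<forall>\<gamma> \<in> A. handled \<gamma> \<delta>}" "\<forall>a \<in> {\<delta>. \<forall>\<gamma> \<in> A. handled \<gamma> \<delta>}. (m, a) \<in> ord" .
  then show ?thesis unfolding least_handling_def by blast
qed

text \<open>
  Any upper bound \<open>a\<close> of the \<open>h b\<close> handles all of them, since \<open>h b\<close> is handled by some \<open>h b' \<le> a\<close>. So the
  least stage \<open>\<delta>\<close> to do so is their supremum; it is a limit, at which \<open>X\<close> is continuous, and the \<open>h b\<close> are
  cofinal in it. This is what makes \<open>X \<circ> h\<close> a continuous sequence.
\<close>

lemma supremum_colimit:
  fixes r :: "'i rel"
  assumes r: "well_ordering r" and A: "A \<subseteq> Field r" "A \<noteq> {}"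
    and unbounded: "\<And>b. b \<in> A \<Longrightarrow> \<exists>b' \<in> A. b \<in> Order_Relation.underS r b'"
    and h: "\<And>b b'. b \<in> Order_Relation.underS r b' \<Longrightarrow> handled (h b) (h b')"
    and \<delta>: "least_handling (h ` A) \<delta>"
  shows "is_colimit (ord_cat (Restr r A)) C (reindex X h) (fob X \<delta>) (\<lambda>b. fmor X (h b, \<delta>))"
proof -
  interpret R: well_ordering r by (rule r)
  have h\<delta>: "h b \<in> ord.below \<delta>" if "b \<in> A" for b
    using \<delta> that unfolding least_handling_def handled_def by blast
  have sup: "\<exists>b \<in> A. a \<in> ord.below (h b)" if a: "a \<in> ord.below \<delta>" for a
  proof (rule ccontr)
    assume "\<not> (\<exists>b \<in> A. a \<in> ord.below (h b))"
    then have le: "(h b, a) \<in> ord" if "b \<in> A" for b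
      using that ord.not_le[of "h b" a] by (auto simp: Field_ord)
    have "handled (h b) a" if b: "b \<in> A" for b
    proof -
      obtain b' where b': "b' \<in> A" "b \<in> R.below b'" using unbounded[OF b] by blast
      show ?thesis by (rule handled_mono[OF h[OF b'(2)] le[OF b'(1)]])
    qed
    then have "(\<delta>, a) \<in> ord" using \<delta> unfolding least_handling_def by blast
    then show False using a ord.le_antisym by (auto simp: ord.below_iff)
  qed
  have "limit_in ord \<delta>" unfolding limit_in_def
  proof (intro conjI notI)
    show "\<delta> \<in> Field ord" by (simp add: Field_ord)
    show False if "zero_in ord \<delta>" using that A(2) h\<delta> unfolding zero_in_def by blast
    assume "\<exists>b. succ_in ord b \<delta>"
    then obtain b where b: "succ_in ord b \<delta>" by blast
    obtain b' where b': "b' \<in> A" "b \<in> ord.below (h b')" using sup[OF ord.succ_below[OF b]] by blast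
    have "(h b', b) \<in> ord" using h\<delta>[OF b'(1)] ord.below_succ_iff[OF b] by blast
    then show False using b'(2) ord.le_antisym by (auto simp: ord.below_iff)
  qed
  then have colim: "is_colimit (ord_cat (Restr ord (ord.below \<delta>))) C X (fob X \<delta>) (\<lambda>b. fmor X (b, \<delta>))"
    using X unfolding lambda_sequence_def by blast
  have F: "Field (Restr r A) = A" by (rule Field_Restr_subset[OF R.Refl A(1)])
  have "is_colimit (ord_cat (Restr r A)) C (reindex X h) (fob X \<delta>) ((\<lambda>b. fmor X (b, \<delta>)) \<circ> h)"
  proof (rule ord.cofinal_colimit[OF X_functor _ colim R.well_ordering_Restr])
    show "ord.below \<delta> \<subseteq> Field ord" by (simp add: Field_ord)
    show "(h a, h b) \<in> ord" if ab: "(a, b) \<in> Restr r A" for a b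
    proof (cases "a = b")
      case True
      then show ?thesis using ord.le_refl by (simp add: Field_ord)
    next
      case False
      then have "a \<in> R.below b" using ab by (simp add: R.below_iff)
      then show ?thesis using h unfolding handled_def by (auto simp: ord.below_iff)
    qed
    show "h a \<in> ord.below \<delta>" if "a \<in> Field (Restr r A)" for a using that h\<delta> unfolding F by blast
    show "\<exists>b \<in> Field (Restr r A). (a, h b) \<in> ord" if "a \<in> ord.below \<delta>" for a
      using sup[OF that] unfolding F by (auto simp: ord.below_iff)
  qed
  then show ?thesis by (simp add: comp_def)
qed

lemma handling_sequence:
  fixes r :: "'u rel"
  assumes r: "well_ordering r" and small: "small U (Field r)"
  obtains h where "\<forall>c \<in> Field r. least_handling (h ` Order_Relation.underS r c) (h c)"
proof -
  interpret R: well_ordering r by (rule r)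
  have "\<exists>h. \<forall>c. c \<in> Field r \<longrightarrow> least_handling (h ` R.below c) (h c)"
  proof (rule dependent_wf_choice[OF R.wf_below])
    fix f g :: "'u \<Rightarrow> 'u" and c e
    assume "\<And>z. (z, c) \<in> {(a, b). a \<in> R.below b} \<Longrightarrow> f z = g z"
    then have "f ` R.below c = g ` R.below c" by (auto intro!: image_cong)
    then show "(c \<in> Field r \<longrightarrow> least_handling (f ` R.below c) e) =
        (c \<in> Field r \<longrightarrow> least_handling (g ` R.below c) e)" by simp
  next
    fix c and f :: "'u \<Rightarrow> 'u"
    have "R.below c \<subseteq> Field r" using R.below_Field by blast
    then have "small U (f ` R.below c)" using small_subset[OF small] small_surj[OF _ order_refl] by blast
    then show "\<exists>e. c \<in> Field r \<longrightarrow> least_handling (f ` R.below c) e" using least_handling_ex by blast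
  qed
  then show ?thesis using that by blast
qed

text \<open>
  Let \<open>r\<close> be a regular cardinal for which the domains of \<open>K\<close> are small, and \<open>\<beta>\<close> the supremum of an \<open>r\<close>-sequence
  of stages \<open>h b\<close>, each of them handled by the later ones. An arrow from such a domain to \<open>X \<beta>\<close> factors through some
  \<open>X (h b)\<close>, and the resulting square over \<open>h b\<close> is solved at \<open>\<beta>\<close>.
\<close>

theorem rlp_stage_exists:
  assumes soa: "permits_small_object_argument U C K" and ne: "\<And>b. sq b \<noteq> {}"
  obtains \<beta> where "p \<beta> \<in> rlp C K"
proof -
  let ?cells = "relative_cell_complexes U C K"
  have "\<exists>\<kappa>. \<forall>i \<in> K. Card_order (\<kappa> i) \<and> small U (Field (\<kappa> i)) \<and>
      kappa_small_relative U (\<kappa> i :: 'u rel) C ?cells (Dom C i)"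
    using soa unfolding permits_small_object_argument_def small_relative_def by (rule bchoice)
  then obtain \<kappa> where \<kappa>: "\<And>i. i \<in> K \<Longrightarrow> Card_order (\<kappa> i) \<and> small U (Field (\<kappa> i))"
    "\<And>i. i \<in> K \<Longrightarrow> kappa_small_relative U (\<kappa> i :: 'u rel) C ?cells (Dom C i)" by blast
  obtain r :: "'u rel" where r: "Card_order r" "cinfinite r" "regularCard r" "small U (Field r)"
    "\<forall>i \<in> K. \<kappa> i \<le>o r" using regular_cardinal_above[OF K(2) \<kappa>(1)] .
  interpret R: well_ordering r by unfold_locales (use r(1) in \<open>auto simp: card_order_on_def\<close>)
  have unbounded: "\<exists>b' \<in> Field r. b \<in> R.below b'" if "b \<in> Field r" for b
    using infinite_Card_order_limit[OF r(1) _ that] r(2) unfolding cinfinite_def R.below_iff by blast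
  obtain h where "\<forall>c \<in> Field r. least_handling (h ` R.below c) (h c)"
    using handling_sequence[OF R.well_ordering_axioms r(4)] .
  then have h: "\<And>c. c \<in> Field r \<Longrightarrow> least_handling (h ` R.below c) (h c)" by blast
  have hh: "handled (h b) (h b')" if "b \<in> R.below b'" for b b'
    using h[of b'] that R.below_Field[OF that] unfolding least_handling_def by blast
  have h_mono: "(h b, h b') \<in> ord" if bb: "(b, b') \<in> r" for b b'
  proof (cases "b = b'")
    case True
    then show ?thesis using ord.le_refl by (simp add: Field_ord)
  next
    case False
    then have "b \<in> R.below b'" using bb by (simp add: R.below_iff)
    then show ?thesis using hh unfolding handled_def by (auto simp: ord.below_iff)
  qed
  have "small U (h ` Field r)" by (rule small_surj[OF r(4) order_refl])
  then obtain \<beta> where \<beta>: "least_handling (h ` Field r) \<beta>" using least_handling_ex by blast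
  have Fr: "Restr r (Field r) = r" by (auto intro: FieldI1 FieldI2)
  have "Field r \<noteq> {}" using r(2) unfolding cinfinite_def by auto
  then have colim: "is_colimit (ord_cat r) C (reindex X h) (fob X \<beta>) (\<lambda>b. fmor X (h b, \<beta>))"
    using supremum_colimit[OF R.well_ordering_axioms order_refl _ unbounded hh \<beta>] unfolding Fr by blast
  have Xh: "cat_functor (ord_cat r) C (reindex X h)"
    using ord.functor_reindex[OF R.well_ordering_axioms X_functor h_mono] .
  have "lambda_sequence_of r C ?cells (reindex X h)"
    unfolding lambda_sequence_of_def lambda_sequence_def
  proof (intro conjI allI impI R.wo Xh)
    fix c assume c: "limit_in r c"
    have cF: "c \<in> Field r" using c unfolding limit_in_def by blast
    show "is_colimit (ord_cat (Restr r (R.below c))) C (reindex X h) (fob (reindex X h) c)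
        (\<lambda>b. fmor (reindex X h) (b, c))"
      unfolding reindex_simps
    proof (rule supremum_colimit[OF R.well_ordering_axioms _ _ _ hh h[OF cF]])
      show "R.below c \<subseteq> Field r" using R.below_Field by blast
      show "R.below c \<noteq> {}" using c unfolding limit_in_def zero_in_def by blast
      show "\<exists>b' \<in> R.below c. b \<in> R.below b'" if "b \<in> R.below c" for b
        using R.limit_dense[OF c that] by blast
    qed
  next
    fix b c assume "succ_in r b c"
    then have "(b, c) \<in> r" unfolding succ_in_def by blast
    then show "fmor (reindex X h) (b, c) \<in> ?cells"
      unfolding reindex_simps using cell_complex[OF h_mono ne] by blast
  qed
  then have pres: "hom_preserved r C (reindex X h) (fob X \<beta>) (\<lambda>b. fmor X (h b, \<beta>)) (Dom C i)"
    if i: "i \<in> K" for i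
    using \<kappa>(2)[OF i] r i colim hom_colim_map_bij_iff[OF R.well_ordering_axioms Xh colimit_cocone[OF colim]]
    unfolding kappa_small_relative_def by blast
  have "p \<beta> \<in> rlp C K" unfolding rlp_def
  proof (intro CollectI conjI ballI)
    show "p \<beta> \<in> Arr C" using homD[OF p_hom] by blast
    fix i assume i: "i \<in> K"
    then have ih: "i \<in> hom C (Dom C i) (Cod C i)" using K(1) Arr_hom[of i C] by blast
    show "lifts_against C i (p \<beta>)"
    proof (rule lifts_againstI[OF ih p_hom])
      fix u v assume u: "u \<in> hom C (Dom C i) (fob X \<beta>)" and v: "v \<in> hom C (Cod C i) y"
        and uv: "p \<beta> \<cdot> u = v \<cdot> i"
      obtain b u' where b: "b \<in> Field r" and u': "u' \<in> hom C (Dom C i) (fob X (h b))"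
        and u_eq: "fmor X (h b, \<beta>) \<cdot> u' = u"
        using pres[OF i] u unfolding hom_preserved_def reindex_simps by blast
      have hb: "handled (h b) \<beta>" using \<beta> b unfolding least_handling_def by blast
      then have hb\<beta>: "(h b, \<beta>) \<in> ord" unfolding handled_def by (simp add: ord.below_iff)
      have "p (h b) \<cdot> u' = v \<cdot> i"
        using comp_assoc[OF u' X_hom[OF hb\<beta>] p_hom] p_X[OF hb\<beta>] u_eq uv by simp
      then have "(i, u', v) \<in> sq (h b)" using i u' v unfolding squares_def by simp
      then show "\<exists>k \<in> hom C (Cod C i) (fob X \<beta>). k \<cdot> i = u \<and> p \<beta> \<cdot> k = v"
        using hb u_eq unfolding handled_def solved_def by auto
    qed
  qed
  then show ?thesis by (rule that)
qed

end

text \<open>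
  Either the construction stops at the first stage without squares, where \<open>p\<close> has the lifting property
  vacuously, or there are squares at every stage and \<open>rlp_stage_exists\<close> applies.
\<close>

theorem (in bicomplete_category) small_object_argument:
  assumes K: "K \<subseteq> Arr C" "small U K" and soa: "permits_small_object_argument U C K"
    and f: "f \<in> hom C x y"
  obtains z i p where "i \<in> hom C x z" "p \<in> hom C z y" "f = p \<cdot> i"
    "i \<in> relative_cell_complexes U C K" "p \<in> rlp C K"
proof -
  obtain d :: "'u \<Rightarrow> 'u \<times> 'u" where d: "\<And>\<gamma> t \<alpha>. \<exists>\<beta>. (\<alpha>, \<beta>) \<in> ord \<and> d \<beta> = (\<gamma>, t)"
    using bookkeeping by blast
  have y: "y \<in> Ob C" using hom_Ob[OF f] by blast
  let ?Z = "const_functor C y :: ('u, 'u \<times> 'u, 'o, 'm) fnctr"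
  have Z: "cat_functor (ord_cat ord) C ?Z" by (rule ord.const_functor[OF category_axioms y])
  obtain X :: "('u, 'u \<times> 'u, 'o, 'm) fnctr" and p where X: "lambda_sequence ord C X"
    and p: "natural ord C X ?Z p" and zero: "\<And>a. zero_in ord a \<Longrightarrow> fob X a = x \<and> p a = f"
    and att: "\<And>b c. succ_in ord b c \<Longrightarrow> attach ord d C K y b X p (fmor X (b, c)) (p c)"
  proof (rule transfinite_construction[OF ord.wo small_below Z, where Step = "attach ord d C K y"
        and xi = x and pi = f])
    show "f \<in> hom C x (fob ?Z a)" for a using f by (simp add: const_functor_def)
  next
    fix b and X X' :: "('u, 'u \<times> 'u, 'o, 'm) fnctr" and p p' g q
    assume eq: "\<And>a. (a, b) \<in> ord \<Longrightarrow> fob X a = fob X' a \<and> p a = p' a \<and> fmor X (a, b) = fmor X' (a, b)"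
      and step: "attach ord d C K y b X p g q"
    have "(b, b) \<in> ord" using ord.le_refl by (simp add: Field_ord)
    then show "attach ord d C K y b X' p' g q"
      using step eq unfolding attach_def by (simp cong: conj_cong)
  next
    fix b c and X :: "('u, 'u \<times> 'u, 'o, 'm) fnctr" and p
    assume s: "succ_in ord b c" and X: "cat_functor (ord_cat (Restr ord (ord.below c))) C X"
      and p: "natural (Restr ord (ord.below c)) C X ?Z p"
    interpret B: well_ordering "Restr ord (ord.below c)" by (rule ord.well_ordering_Restr)
    let ?sq = "\<lambda>\<gamma>. squares C K y (fob X \<gamma>) (p \<gamma>)"
    have b: "b \<in> ord.below c" by (rule ord.succ_below[OF s])
    have Xb: "fob X \<gamma> \<in> Ob C" if "\<gamma> \<in> ord.below c" for \<gamma>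
      using B.functorD(1)[OF X] that by (simp add: ord.Field_below)
    have ph: "p \<gamma> \<in> hom C (fob X \<gamma>) y" if "\<gamma> \<in> ord.below c" for \<gamma>
      using p that unfolding natural_def ord.Field_below by (simp add: const_functor_def)
    have "\<exists>z. \<exists>g \<in> hom C (fob X b) z. \<exists>q \<in> hom C z y. q \<cdot> g = p b \<and> attach ord d C K y b X p g q"
    proof (cases "?sq b = {}")
      case True
      then have "attach ord d C K y b X p (Ident C (fob X b)) (p b)" unfolding attach_def by blast
      then show ?thesis using ident_closed[OF Xb[OF b]] ph[OF b] ident_right[OF ph[OF b]] by blast
    next
      case False
      have "\<exists>i u v. (i, u, v) \<in> ?sq b \<and>
        (\<forall>\<gamma> t i0 u0 v0. d b = (\<gamma>, t) \<and> (\<gamma>, b) \<in> ord \<and> ?sq \<gamma> \<noteq> {} \<and>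
           enumeration (?sq \<gamma>) t = (i0, u0, v0) \<longrightarrow>
           i = i0 \<and> u = fmor X (\<gamma>, b) \<cdot> u0 \<and> v = v0)"
      proof -
        obtain \<gamma> t where \<gamma>t: "d b = (\<gamma>, t)" by (cases "d b") blast
        show ?thesis
        proof (cases "(\<gamma>, b) \<in> ord \<and> ?sq \<gamma> \<noteq> {}")
          case True
          then have \<gamma>b: "(\<gamma>, b) \<in> Restr ord (ord.below c)" and \<gamma>: "\<gamma> \<in> ord.below c"
            using b ord.below_succ_iff[OF s] by auto
          obtain i u v where iuv: "enumeration (?sq \<gamma>) t = (i, u, v)"
            by (cases "enumeration (?sq \<gamma>) t") blast
          have "(i, u, v) \<in> ?sq \<gamma>"
            using range_enumeration[OF small_squares[OF K Xb[OF \<gamma>] y]] True iuv by (metis rangeI)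
          then have iuv': "i \<in> K" "u \<in> hom C (Dom C i) (fob X \<gamma>)" "v \<in> hom C (Cod C i) y" "p \<gamma> \<cdot> u = v \<cdot> i"
            unfolding squares_def by auto
          have "p b \<cdot> fmor X (\<gamma>, b) = p \<gamma>"
            using p \<gamma>b ident_left[OF ph[OF \<gamma>]] unfolding natural_def by (simp add: const_functor_def)
          then have "(i, fmor X (\<gamma>, b) \<cdot> u, v) \<in> ?sq b"
            using iuv' comp_closed[OF iuv'(2) B.functorD(3)[OF X \<gamma>b]]
              comp_assoc[OF iuv'(2) B.functorD(3)[OF X \<gamma>b] ph[OF b]] unfolding squares_def by simp
          then show ?thesis using \<gamma>t iuv by auto
        next
          case no: False
          obtain i u v where "(i, u, v) \<in> ?sq b" using False by auto
          then show ?thesis using \<gamma>t no by auto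
        qed
      qed
      then obtain i u v where iuv: "(i, u, v) \<in> ?sq b" and book:
        "\<forall>\<gamma> t i0 u0 v0. d b = (\<gamma>, t) \<and> (\<gamma>, b) \<in> ord \<and> ?sq \<gamma> \<noteq> {} \<and>
           enumeration (?sq \<gamma>) t = (i0, u0, v0) \<longrightarrow> i = i0 \<and> u = fmor X (\<gamma>, b) \<cdot> u0 \<and> v = v0" by blast
      have i: "i \<in> hom C (Dom C i) (Cod C i)" and u: "u \<in> hom C (Dom C i) (fob X b)"
        and v: "v \<in> hom C (Cod C i) y" and sqr: "p b \<cdot> u = v \<cdot> i"
        using iuv K(1) Arr_hom[of i C] unfolding squares_def by auto
      obtain g v' z where po: "is_pushout C i u g v'" and g: "g \<in> hom C (fob X b) z"
        and v': "v' \<in> hom C (Cod C i) z" using pushout_ex[OF i u] by blast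
      have "Cod C u = fob X b" "Cod C g = z" using u g by (auto simp: hom_def)
      then obtain q where q: "q \<in> hom C z y" "q \<cdot> g = p b" "q \<cdot> v' = v"
        using po ph[OF b] v sqr unfolding is_pushout_def by metis
      have "attach ord d C K y b X p g q" unfolding attach_def using iuv po q(3) book by blast
      then show ?thesis using g q by blast
    qed
    moreover have "fmor ?Z (b, c) \<cdot> p b = p b"
      using ident_left[OF ph[OF b]] by (simp add: const_functor_def)
    moreover have "fob ?Z c = y" by (simp add: const_functor_def)
    ultimately show "\<exists>z. \<exists>g \<in> hom C (fob X b) z. \<exists>q \<in> hom C z (fob ?Z c).
        q \<cdot> g = fmor ?Z (b, c) \<cdot> p b \<and> attach ord d C K y b X p g q" by simp
  qed blast
  interpret attaching_sequence U C K y d X p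
    by unfold_locales (use K y d X p att in auto)
  have "Field ord \<noteq> {}" by (simp add: Field_ord)
  then obtain a where a: "zero_in ord a" by (rule ord.zero_ex)
  have a_le: "(a, b) \<in> ord" for b using ord.zero_le[OF a] by (simp add: Field_ord)
  have "\<exists>\<beta>. p \<beta> \<in> rlp C K \<and> (\<forall>b \<in> ord.below \<beta>. sq b \<noteq> {})"
  proof (cases "\<forall>b. sq b \<noteq> {}")
    case True
    then show ?thesis using rlp_stage_exists[OF soa] by blast
  next
    case False
    then have ne: "{b. sq b = {}} \<noteq> {}" by blast
    have sub: "{b. sq b = {}} \<subseteq> Field ord" by (simp add: Field_ord)
    obtain b where "b \<in> {b. sq b = {}}" "\<forall>b' \<in> {b. sq b = {}}. (b, b') \<in> ord"
      using ord.least_ex[OF sub ne] .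
    then have b: "sq b = {}" "\<And>b'. sq b' = {} \<Longrightarrow> (b, b') \<in> ord" by blast+
    have "p b \<in> rlp C K" unfolding rlp_def
    proof (intro CollectI conjI ballI)
      show "p b \<in> Arr C" using homD[OF p_hom] by blast
      fix i assume i: "i \<in> K"
      then have ih: "i \<in> hom C (Dom C i) (Cod C i)" using K(1) Arr_hom[of i C] by blast
      show "lifts_against C i (p b)"
        by (rule lifts_againstI[OF ih p_hom]) (use b(1) i in \<open>auto simp: squares_def\<close>)
    qed
    moreover have "sq b' \<noteq> {}" if "b' \<in> ord.below b" for b'
      using b(2)[of b'] that ord.le_antisym[of b b'] by (auto simp: ord.below_iff)
    ultimately show ?thesis by blast
  qed
  then obtain \<beta> where \<beta>: "p \<beta> \<in> rlp C K" "\<And>b. b \<in> ord.below \<beta> \<Longrightarrow> sq b \<noteq> {}" by blast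
  show ?thesis
  proof (rule that[of "fmor X (a, \<beta>)" "fob X \<beta>" "p \<beta>"])
    show "fmor X (a, \<beta>) \<in> hom C x (fob X \<beta>)" using X_hom[OF a_le] zero[OF a] by simp
    show "p \<beta> \<in> hom C (fob X \<beta>) y" by (rule p_hom)
    show "f = p \<beta> \<cdot> fmor X (a, \<beta>)" using p_X[OF a_le] zero[OF a] by simp
    show "fmor X (a, \<beta>) \<in> relative_cell_complexes U C K" by (rule cell_complex[OF a_le \<beta>(2)])
    show "p \<beta> \<in> rlp C K" by (rule \<beta>(1))
  qed
qed

section \<open>Smallness relative to cofibrations\<close>

text \<open>
  A sequence \<open>X\<close> of arrows with the left lifting property is a retract of a sequence \<open>Y\<close> of relative cell
  complexes: \<open>Y\<close> is obtained by factoring \<open>Y b \<rightarrow> X b \<rightarrow> X (b + 1)\<close>, and the section by lifting. The comparison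
  map of \<open>X\<close> is then a retract of the comparison map of \<open>Y\<close>.
\<close>

theorem (in bicomplete_category) small_relative_llp:
  assumes K: "K \<subseteq> Arr C" "small U K" and soa: "permits_small_object_argument U C K"
    and w: "small_relative U C (relative_cell_complexes U C K) w"
  shows "small_relative U C (llp C (rlp C K)) w"
proof -
  let ?cells = "relative_cell_complexes U C K"
  obtain \<kappa> :: "'u rel" where \<kappa>: "Card_order \<kappa>" "small U (Field \<kappa>)"
    and small_w: "kappa_small_relative U \<kappa> C ?cells w"
    using w unfolding small_relative_def by blast
  have "kappa_small_relative U \<kappa> C (llp C (rlp C K)) w"
    unfolding kappa_small_relative_def
  proof (intro allI impI)
    fix r :: "'u rel" and X c \<iota>
    assume r: "Card_order r \<and> cinfinite r \<and> regularCard r \<and> small U (Field r) \<and> \<kappa> \<le>o r"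
      and Xc: "lambda_sequence_of r C (llp C (rlp C K)) X \<and> is_colimit (ord_cat r) C X c \<iota>"
    interpret R: well_ordering r by unfold_locales (use r in \<open>auto simp: card_order_on_def\<close>)
    have X: "lambda_sequence r C X" and X_llp: "\<And>b c. succ_in r b c \<Longrightarrow> fmor X (b, c) \<in> llp C (rlp C K)"
      and c: "is_colimit (ord_cat r) C X c \<iota>"
      using Xc unfolding lambda_sequence_of_def by blast+
    have XF: "cat_functor (ord_cat r) C X" using X unfolding lambda_sequence_def by blast
    note X' = R.functorD[OF XF]
    note cc = colimit_cocone[OF c, unfolded cocone_ord_iff]
    have "Field r \<noteq> {}" using r unfolding cinfinite_def by auto
    then obtain a where a: "zero_in r a" by (rule R.zero_ex)
    have aF: "a \<in> Field r" using a unfolding zero_in_def by blast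
    have a_unique: "b = a" if "zero_in r b" for b
      using R.zero_le[OF a, of b] R.zero_le[OF that aF] R.le_antisym that unfolding zero_in_def by blast
    have idX: "Ident C (fob X b) \<in> hom C (fob X b) (fob X b)" if "b \<in> Field r" for b
      using ident_closed[OF X'(1)[OF that]] .
    have small: "small U (R.below b)" for b
      using r R.below_Field by (intro small_subset[of "Field r" "R.below b"]) blast+
    have "\<exists>Y p. lambda_sequence r C Y \<and> natural r C Y X p \<and>
        fob Y a = fob X a \<and> p a = Ident C (fob X a) \<and>
        (\<forall>b c. succ_in r b c \<longrightarrow> fmor Y (b, c) \<in> ?cells \<and> p c \<in> rlp C K)"
    proof (rule transfinite_construction[OF R.wo small XF, where xi = "fob X a" and
          pi = "Ident C (fob X a)" and Step = "\<lambda>b Y p g q. g \<in> ?cells \<and> q \<in> rlp C K"])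
      show "Ident C (fob X a) \<in> hom C (fob X a) (fob X b)" if "zero_in r b" for b
        using a_unique[OF that] idX[OF aF] by simp
      fix b c and Y :: "('u, 'u \<times> 'u, 'o, 'm) fnctr" and p
      assume s: "succ_in r b c" and Y: "cat_functor (ord_cat (Restr r (R.below c))) C Y"
        and p: "natural (Restr r (R.below c)) C Y X p"
      have b: "b \<in> R.below c" "(b, c) \<in> r"
        using R.succ_below[OF s] s unfolding succ_in_def by blast+
      have "p b \<in> hom C (fob Y b) (fob X b)"
        using p b(1) unfolding natural_def R.Field_below by blast
      then have "fmor X (b, c) \<cdot> p b \<in> hom C (fob Y b) (fob X c)" using X'(3)[OF b(2)] by (rule comp_closed)
      then obtain z g q where "g \<in> hom C (fob Y b) z" "q \<in> hom C z (fob X c)"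
        "fmor X (b, c) \<cdot> p b = q \<cdot> g" "g \<in> ?cells" "q \<in> rlp C K"
        using small_object_argument[OF K soa] by blast
      then show "\<exists>y. \<exists>g \<in> hom C (fob Y b) y. \<exists>q \<in> hom C y (fob X c).
          q \<cdot> g = fmor X (b, c) \<cdot> p b \<and> g \<in> ?cells \<and> q \<in> rlp C K" by metis
    next
      fix Y :: "('u, 'u \<times> 'u, 'o, 'm) fnctr" and p
      assume "lambda_sequence r C Y" "natural r C Y X p"
        and z: "\<And>a'. zero_in r a' \<Longrightarrow> fob Y a' = fob X a \<and> p a' = Ident C (fob X a)"
        and "\<And>b c. succ_in r b c \<Longrightarrow> fmor Y (b, c) \<in> ?cells \<and> p c \<in> rlp C K"
      then show ?thesis using z[OF a] by blast
    qed blast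
    then obtain Y p where Y: "lambda_sequence r C Y" and p: "natural r C Y X p"
      and Ya: "fob Y a = fob X a" "p a = Ident C (fob X a)"
      and Y_cells: "\<And>b c. succ_in r b c \<Longrightarrow> fmor Y (b, c) \<in> ?cells"
      and p_rlp: "\<And>b c. succ_in r b c \<Longrightarrow> p c \<in> rlp C K" by blast
    have YF: "cat_functor (ord_cat r) C Y" using Y unfolding lambda_sequence_def by blast
    note Y' = R.functorD[OF YF]
    have ph: "p b \<in> hom C (fob Y b) (fob X b)" if "b \<in> Field r" for b
      using p that unfolding natural_def by blast
    have pY: "p b' \<cdot> fmor Y (b, b') = fmor X (b, b') \<cdot> p b" if "(b, b') \<in> r" for b b'
      using p that unfolding natural_def by blast
    have id_nat: "natural r C X X (\<lambda>b. Ident C (fob X b))"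
      unfolding natural_def using idX ident_left[OF X'(3)] ident_right[OF X'(3)] by auto
    have "\<exists>s. natural r C X Y s \<and> (\<forall>b \<in> Field r. p b \<cdot> s b = Ident C (fob X b))"
    proof (rule natural_lift[OF category_axioms X YF XF id_nat p])
      show "Ident C (fob X a) \<in> hom C (fob X b) (fob Y b) \<and> p b \<cdot> Ident C (fob X a) = Ident C (fob X b)"
        if "zero_in r b" for b
        using a_unique[OF that] Ya idX[OF aF] X'(1)[OF aF] by simp
      fix b e s assume se: "succ_in r b e" and s: "s \<in> hom C (fob X b) (fob Y b)" "p b \<cdot> s = Ident C (fob X b)"
      have be: "(b, e) \<in> r" using se unfolding succ_in_def by blast
      have F: "b \<in> Field r" "e \<in> Field r" using R.in_Field[OF be] by auto
      have lift: "lifts_against C (fmor X (b, e)) (p e)"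
        using X_llp[OF se] p_rlp[OF se] unfolding llp_def by blast
      have "p e \<cdot> (fmor Y (b, e) \<cdot> s) = Ident C (fob X e) \<cdot> fmor X (b, e)"
        using comp_assoc[OF s(1) Y'(3)[OF be] ph[OF F(2)]] pY[OF be] s(2)
          comp_assoc[OF s(1) ph[OF F(1)] X'(3)[OF be]] ident_left[OF X'(3)[OF be]]
          ident_right[OF X'(3)[OF be]] by simp
      then show "\<exists>s' \<in> hom C (fob X e) (fob Y e).
          s' \<cdot> fmor X (b, e) = fmor Y (b, e) \<cdot> s \<and> p e \<cdot> s' = Ident C (fob X e)"
        using lifts_againstE[OF lift X'(3)[OF be] ph[OF F(2)] comp_closed[OF s(1) Y'(3)[OF be]] idX[OF F(2)]]
        by blast
    qed blast
    then obtain s where s: "natural r C X Y s" and ps: "\<And>b. b \<in> Field r \<Longrightarrow> p b \<cdot> s b = Ident C (fob X b)"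
      by blast
    have sh: "s b \<in> hom C (fob X b) (fob Y b)" if "b \<in> Field r" for b
      using s that unfolding natural_def by blast
    have sX: "s b' \<cdot> fmor X (b, b') = fmor Y (b, b') \<cdot> s b" if "(b, b') \<in> r" for b b'
      using s that unfolding natural_def by blast
    obtain e \<epsilon> where e: "is_colimit (ord_cat r) C Y e \<epsilon>" using ord_colimit_ex[OF R.Refl R.trans _ YF] r by blast
    note ee = colimit_cocone[OF e, unfolded cocone_ord_iff]
    have \<iota>: "\<iota> b \<in> hom C (fob X b) c" and \<epsilon>: "\<epsilon> b \<in> hom C (fob Y b) e" if "b \<in> Field r" for b
      using that cc ee by blast+
    have "lambda_sequence_of r C ?cells Y" unfolding lambda_sequence_of_def using Y Y_cells by blast
    then have preserved: "hom_preserved r C Y e \<epsilon> w"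
      using small_w r e hom_colim_map_bij_iff[OF R.well_ordering_axioms YF colimit_cocone[OF e]]
      unfolding kappa_small_relative_def by blast
    have "cocone (ord_cat r) C Y c (\<lambda>b. \<iota> b \<cdot> p b)" unfolding cocone_ord_iff
    proof (intro conjI ballI allI impI)
      show "c \<in> Ob C" using cc by blast
      show "\<iota> b \<cdot> p b \<in> hom C (fob Y b) c" if "b \<in> Field r" for b using comp_closed[OF ph \<iota>] that by blast
      fix b b' assume bb: "(b, b') \<in> r"
      then have F: "b \<in> Field r" "b' \<in> Field r" using R.in_Field by blast+
      have "\<iota> b' \<cdot> fmor X (b, b') = \<iota> b" using cc bb by blast
      then show "\<iota> b' \<cdot> p b' \<cdot> fmor Y (b, b') = \<iota> b \<cdot> p b"
        using comp_assoc[OF Y'(3)[OF bb] ph[OF F(2)] \<iota>[OF F(2)]] pY[OF bb]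
          comp_assoc[OF ph[OF F(1)] X'(3)[OF bb] \<iota>[OF F(2)]] by simp
    qed
    then obtain p' where p': "p' \<in> hom C e c" "\<And>b. b \<in> Field r \<Longrightarrow> p' \<cdot> \<epsilon> b = \<iota> b \<cdot> p b"
      using colimit_desc[OF e] by auto
    have "cocone (ord_cat r) C X e (\<lambda>b. \<epsilon> b \<cdot> s b)" unfolding cocone_ord_iff
    proof (intro conjI ballI allI impI)
      show "e \<in> Ob C" using ee by blast
      show "\<epsilon> b \<cdot> s b \<in> hom C (fob X b) e" if "b \<in> Field r" for b using comp_closed[OF sh \<epsilon>] that by blast
      fix b b' assume bb: "(b, b') \<in> r"
      then have F: "b \<in> Field r" "b' \<in> Field r" using R.in_Field by blast+
      have "\<epsilon> b' \<cdot> fmor Y (b, b') = \<epsilon> b" using ee bb by blast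
      then show "\<epsilon> b' \<cdot> s b' \<cdot> fmor X (b, b') = \<epsilon> b \<cdot> s b"
        using comp_assoc[OF X'(3)[OF bb] sh[OF F(2)] \<epsilon>[OF F(2)]] sX[OF bb]
          comp_assoc[OF sh[OF F(1)] Y'(3)[OF bb] \<epsilon>[OF F(2)]] by simp
    qed
    then obtain s' where s': "s' \<in> hom C c e" "\<And>b. b \<in> Field r \<Longrightarrow> s' \<cdot> \<iota> b = \<epsilon> b \<cdot> s b"
      using colimit_desc[OF c] by auto
    have cO: "c \<in> Ob C" using cc by blast
    have p's': "p' \<cdot> s' = Ident C c"
    proof (rule colimit_ext[OF category_axioms XF c comp_closed[OF s'(1) p'(1)] ident_closed[OF cO]])
      fix b assume "b \<in> Ob (ord_cat r)"
      then have b: "b \<in> Field r" by simp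
      have "p' \<cdot> s' \<cdot> \<iota> b = p' \<cdot> \<epsilon> b \<cdot> s b"
        using comp_assoc[OF \<iota>[OF b] s'(1) p'(1)] comp_assoc[OF sh[OF b] \<epsilon>[OF b] p'(1)] s'(2)[OF b] by simp
      also have "\<dots> = \<iota> b"
        unfolding p'(2)[OF b]
        using comp_assoc[OF sh[OF b] ph[OF b] \<iota>[OF b]] ps[OF b] ident_right[OF \<iota>[OF b]] by simp
      finally show "p' \<cdot> s' \<cdot> \<iota> b = Ident C c \<cdot> \<iota> b" using ident_left[OF \<iota>[OF b]] by simp
    qed
    have "hom_preserved r C X c \<iota> w" unfolding hom_preserved_def
    proof (intro conjI ballI impI)
      fix u assume u: "u \<in> hom C w c"
      have "s' \<cdot> u \<in> hom C w e" using comp_closed[OF u s'(1)] .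
      then obtain b f where b: "b \<in> Field r" and f: "f \<in> hom C w (fob Y b)" "\<epsilon> b \<cdot> f = s' \<cdot> u"
        using preserved unfolding hom_preserved_def by blast
      have "\<iota> b \<cdot> (p b \<cdot> f) = p' \<cdot> (\<epsilon> b \<cdot> f)"
        using comp_assoc[OF f(1) ph[OF b] \<iota>[OF b]] comp_assoc[OF f(1) \<epsilon>[OF b] p'(1)] p'(2)[OF b] by simp
      also have "\<dots> = u" unfolding f(2) using comp_assoc[OF u s'(1) p'(1)] p's' ident_left[OF u] by simp
      finally show "\<exists>b \<in> Field r. \<exists>f \<in> hom C w (fob X b). \<iota> b \<cdot> f = u"
        using b comp_closed[OF f(1) ph[OF b]] by blast
    next
      fix b b' f g assume b: "b \<in> Field r" "b' \<in> Field r" and f: "f \<in> hom C w (fob X b)"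
        and g: "g \<in> hom C w (fob X b')" and eq: "\<iota> b \<cdot> f = \<iota> b' \<cdot> g"
      have "\<epsilon> b \<cdot> (s b \<cdot> f) = \<epsilon> b' \<cdot> (s b' \<cdot> g)"
        using comp_assoc[OF f sh[OF b(1)] \<epsilon>[OF b(1)]] comp_assoc[OF g sh[OF b(2)] \<epsilon>[OF b(2)]]
          comp_assoc[OF f \<iota>[OF b(1)] s'(1)] comp_assoc[OF g \<iota>[OF b(2)] s'(1)] s'(2) b eq by simp
      then obtain d where d: "(b, d) \<in> r" "(b', d) \<in> r"
        and deq: "fmor Y (b, d) \<cdot> (s b \<cdot> f) = fmor Y (b', d) \<cdot> (s b' \<cdot> g)"
        using preserved b comp_closed[OF f sh[OF b(1)]] comp_closed[OF g sh[OF b(2)]]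
        unfolding hom_preserved_def by blast
      have dF: "d \<in> Field r" using R.in_Field[OF d(1)] by blast
      have X_via_Y: "fmor X (b, d) \<cdot> f = p d \<cdot> (fmor Y (b, d) \<cdot> (s b \<cdot> f))"
        if "b \<in> Field r" "f \<in> hom C w (fob X b)" "(b, d) \<in> r" for b f
      proof -
        note Y = Y'(3)[OF that(3)] and X = X'(3)[OF that(3)]
        have "p d \<cdot> (fmor Y (b, d) \<cdot> (s b \<cdot> f)) = p d \<cdot> fmor Y (b, d) \<cdot> (s b \<cdot> f)"
          using comp_assoc[OF comp_closed[OF that(2) sh[OF that(1)]] Y ph[OF dF]] by simp
        also have "\<dots> = fmor X (b, d) \<cdot> (p b \<cdot> (s b \<cdot> f))"
          unfolding pY[OF that(3)]
          by (rule comp_assoc[OF comp_closed[OF that(2) sh[OF that(1)]] ph[OF that(1)] X])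
        also have "p b \<cdot> (s b \<cdot> f) = f"
          using comp_assoc[OF that(2) sh[OF that(1)] ph[OF that(1)]] ps[OF that(1)] ident_left[OF that(2)]
          by simp
        finally show ?thesis by simp
      qed
      have "fmor X (b, d) \<cdot> f = fmor X (b', d) \<cdot> g"
        using X_via_Y[OF b(1) f d(1)] X_via_Y[OF b(2) g d(2)] deq by simp
      then show "\<exists>d. (b, d) \<in> r \<and> (b', d) \<in> r \<and> fmor X (b, d) \<cdot> f = fmor X (b', d) \<cdot> g" using d by blast
    qed
    then show "bij_betw (hom_colim_map C \<iota>) (hom_colim r C X w) (hom C w c)"
      using hom_colim_map_bij_iff[OF R.well_ordering_axioms XF colimit_cocone[OF c]] by blast
  qed
  then show ?thesis unfolding small_relative_def using \<kappa> by blast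
qed


section \<open>Adjunctions\<close>

lemma fcomp_simps [simp]:
  "fob (G \<circ>\<^sub>F F) x = fob G (fob F x)" "fmor (G \<circ>\<^sub>F F) f = fmor G (fmor F f)"
  by (simp_all add: fcomp_def)

lemma cat_functor_fcomp:
  assumes "cat_functor C D F" "cat_functor D E G"
  shows "cat_functor C E (G \<circ>\<^sub>F F)"
proof -
  interpret F: cat_functor C D F by fact
  interpret G: cat_functor D E G by fact
  show ?thesis
    by unfold_locales
      (simp_all add: F.fob_closed G.fob_closed F.fmor_ident G.fmor_ident
        G.fmor_closed[OF F.fmor_closed] F.fmor_comp G.fmor_comp[OF F.fmor_closed F.fmor_closed])
qed

lemma cat_functor_Arr:
  assumes "cat_functor C D F" "f \<in> Arr C"
  shows "fmor F f \<in> hom D (fob F (Dom C f)) (fob F (Cod C f))"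
  by (rule cat_functor.fmor_closed[OF assms(1) Arr_hom[OF assms(2)]])

lemma cat_functor_retract:
  assumes F: "cat_functor C D F" and ret: "is_retract C f g"
  shows "is_retract D (fmor F f) (fmor F g)"
proof -
  interpret cat_functor C D F by (rule F)
  obtain s r s' r' where fg: "f \<in> Arr C" "g \<in> Arr C"
    and s: "s \<in> hom C (Dom C f) (Dom C g)" and r: "r \<in> hom C (Dom C g) (Dom C f)"
    and s': "s' \<in> hom C (Cod C f) (Cod C g)" and r': "r' \<in> hom C (Cod C g) (Cod C f)"
    and id: "r \<cdot>\<^bsub>C\<^esub> s = Ident C (Dom C f)" "r' \<cdot>\<^bsub>C\<^esub> s' = Ident C (Cod C f)"
    and sq: "g \<cdot>\<^bsub>C\<^esub> s = s' \<cdot>\<^bsub>C\<^esub> f" "f \<cdot>\<^bsub>C\<^esub> r = r' \<cdot>\<^bsub>C\<^esub> g"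
    using ret unfolding is_retract_def by blast
  note f = Arr_hom[OF fg(1)] and g = Arr_hom[OF fg(2)]
  have DC: "Dom D (fmor F f) = fob F (Dom C f)" "Cod D (fmor F f) = fob F (Cod C f)" "fmor F f \<in> Arr D"
    "Dom D (fmor F g) = fob F (Dom C g)" "Cod D (fmor F g) = fob F (Cod C g)" "fmor F g \<in> Arr D"
    using homD[OF fmor_closed[OF f]] homD[OF fmor_closed[OF g]] by auto
  have "fmor F r \<cdot>\<^bsub>D\<^esub> fmor F s = Ident D (fob F (Dom C f))"
    "fmor F r' \<cdot>\<^bsub>D\<^esub> fmor F s' = Ident D (fob F (Cod C f))"
    "fmor F g \<cdot>\<^bsub>D\<^esub> fmor F s = fmor F s' \<cdot>\<^bsub>D\<^esub> fmor F f"
    "fmor F f \<cdot>\<^bsub>D\<^esub> fmor F r = fmor F r' \<cdot>\<^bsub>D\<^esub> fmor F g"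
    using fmor_comp[OF s r] fmor_comp[OF s' r'] fmor_comp[OF s g] fmor_comp[OF f s']
      fmor_comp[OF r f] fmor_comp[OF g r'] id sq fmor_ident source.hom_Ob[OF f] by simp_all
  then show ?thesis unfolding is_retract_def DC
    using DC fmor_closed[OF s] fmor_closed[OF r] fmor_closed[OF s'] fmor_closed[OF r'] by blast
qed

locale adjoint_functors =
  left: cat_functor C D L + right: cat_functor D C R
  for C :: "('o, 'm) cat" and D :: "('p, 'n) cat"
    and L :: "('o, 'm, 'p, 'n) fnctr" and R :: "('p, 'n, 'o, 'm) fnctr" +
  fixes \<phi> :: "'o \<Rightarrow> 'p \<Rightarrow> 'n \<Rightarrow> 'm"
  assumes transpose_bij: "\<lbrakk>x \<in> Ob C; y \<in> Ob D\<rbrakk> \<Longrightarrow>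
      bij_betw (\<phi> x y) (hom D (fob L x) y) (hom C x (fob R y))"
    and transpose_natural: "\<lbrakk>h \<in> hom C x' x; k \<in> hom D y y'; f \<in> hom D (fob L x) y\<rbrakk> \<Longrightarrow>
      \<phi> x' y' (k \<cdot>\<^bsub>D\<^esub> f \<cdot>\<^bsub>D\<^esub> fmor L h) = fmor R k \<cdot>\<^bsub>C\<^esub> \<phi> x y f \<cdot>\<^bsub>C\<^esub> h"

lemma adjunctionE:
  assumes "adjunction C D L R"
  obtains \<phi> where "adjoint_functors C D L R \<phi>"
proof -
  obtain \<phi> where LR: "cat_functor C D L" "cat_functor D C R"
    and bij: "\<forall>x \<in> Ob C. \<forall>y \<in> Ob D. bij_betw (\<phi> x y) (hom D (fob L x) y) (hom C x (fob R y))"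
    and nat: "\<forall>x \<in> Ob C. \<forall>x' \<in> Ob C. \<forall>y \<in> Ob D. \<forall>y' \<in> Ob D.
             \<forall>h \<in> hom C x' x. \<forall>k \<in> hom D y y'. \<forall>f \<in> hom D (fob L x) y.
               \<phi> x' y' (k \<cdot>\<^bsub>D\<^esub> f \<cdot>\<^bsub>D\<^esub> fmor L h) = fmor R k \<cdot>\<^bsub>C\<^esub> \<phi> x y f \<cdot>\<^bsub>C\<^esub> h"
    using assms unfolding adjunction_def by blast
  interpret L: cat_functor C D L by (rule LR)
  have "adjoint_functors_axioms C D L R \<phi>"
  proof
    show "bij_betw (\<phi> x y) (hom D (fob L x) y) (hom C x (fob R y))"
      if "x \<in> Ob C" "y \<in> Ob D" for x y using bij that by blast
    show "\<phi> x' y' (k \<cdot>\<^bsub>D\<^esub> f \<cdot>\<^bsub>D\<^esub> fmor L h) = fmor R k \<cdot>\<^bsub>C\<^esub> \<phi> x y f \<cdot>\<^bsub>C\<^esub> h"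
      if "h \<in> hom C x' x" "k \<in> hom D y y'" "f \<in> hom D (fob L x) y" for h x' x k y y' f
      using nat that L.source.hom_Ob[OF that(1)] L.target.hom_Ob[OF that(2)] by simp
  qed
  then have "adjoint_functors C D L R \<phi>" using LR by (intro adjoint_functors.intro)
  then show ?thesis by (rule that)
qed

context adjoint_functors
begin

lemma transpose_closed:
  "\<lbrakk>x \<in> Ob C; f \<in> hom D (fob L x) y\<rbrakk> \<Longrightarrow> \<phi> x y f \<in> hom C x (fob R y)"
  using bij_betwE[OF transpose_bij] left.target.hom_Ob by metis

lemma transpose_inj:
  assumes "x \<in> Ob C" "f \<in> hom D (fob L x) y" "g \<in> hom D (fob L x) y" "\<phi> x y f = \<phi> x y g"
  shows "f = g"
proof -
  have "y \<in> Ob D" using left.target.hom_Ob[OF assms(2)] by blast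
  then have "inj_on (\<phi> x y) (hom D (fob L x) y)"
    using transpose_bij[OF assms(1)] unfolding bij_betw_def by blast
  then show ?thesis using assms(4,2,3) by (rule inj_onD)
qed

lemma transpose_surj:
  assumes "x \<in> Ob C" "y \<in> Ob D" "g \<in> hom C x (fob R y)"
  obtains f where "f \<in> hom D (fob L x) y" "\<phi> x y f = g"
proof -
  have "g \<in> \<phi> x y ` hom D (fob L x) y"
    using transpose_bij[OF assms(1,2)] assms(3) unfolding bij_betw_def by simp
  then show ?thesis using that by blast
qed

lemma transpose_comp_left:
  assumes h: "h \<in> hom C x' x" and f: "f \<in> hom D (fob L x) y"
  shows "\<phi> x' y (f \<cdot>\<^bsub>D\<^esub> fmor L h) = \<phi> x y f \<cdot>\<^bsub>C\<^esub> h"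
proof -
  have x: "x \<in> Ob C" and y: "y \<in> Ob D" using left.source.hom_Ob[OF h] left.target.hom_Ob[OF f] by auto
  have "\<phi> x' y (Ident D y \<cdot>\<^bsub>D\<^esub> f \<cdot>\<^bsub>D\<^esub> fmor L h) = fmor R (Ident D y) \<cdot>\<^bsub>C\<^esub> \<phi> x y f \<cdot>\<^bsub>C\<^esub> h"
    by (rule transpose_natural[OF h left.target.ident_closed[OF y] f])
  then show ?thesis
    using left.target.ident_left[OF f] right.fmor_ident[OF y]
      left.source.ident_left[OF transpose_closed[OF x f]] by simp
qed

lemma transpose_comp_right:
  assumes k: "k \<in> hom D y y'" and f: "f \<in> hom D (fob L x) y" and x: "x \<in> Ob C"
  shows "\<phi> x y' (k \<cdot>\<^bsub>D\<^esub> f) = fmor R k \<cdot>\<^bsub>C\<^esub> \<phi> x y f"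
proof -
  have kf: "k \<cdot>\<^bsub>D\<^esub> f \<in> hom D (fob L x) y'" by (rule left.target.comp_closed[OF f k])
  have Rf: "fmor R k \<cdot>\<^bsub>C\<^esub> \<phi> x y f \<in> hom C x (fob R y')"
    by (rule left.source.comp_closed[OF transpose_closed[OF x f] right.fmor_closed[OF k]])
  have "\<phi> x y' (k \<cdot>\<^bsub>D\<^esub> f \<cdot>\<^bsub>D\<^esub> fmor L (Ident C x)) = fmor R k \<cdot>\<^bsub>C\<^esub> \<phi> x y f \<cdot>\<^bsub>C\<^esub> Ident C x"
    by (rule transpose_natural[OF left.source.ident_closed[OF x] k f])
  then show ?thesis
    using left.fmor_ident[OF x] left.target.ident_right[OF kf] left.source.ident_right[OF Rf] by simp
qed

lemma lifts_against_adjoint: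
  assumes i: "i \<in> Arr C" and p: "p \<in> Arr D"
  shows "lifts_against D (fmor L i) p \<longleftrightarrow> lifts_against C i (fmor R p)"
proof -
  define a b x y where "a = Dom C i" and "b = Cod C i" and "x = Dom D p" and "y = Cod D p"
  have ih: "i \<in> hom C a b" and ph: "p \<in> hom D x y"
    using Arr_hom[OF i] Arr_hom[OF p] unfolding a_def b_def x_def y_def .
  have O: "a \<in> Ob C" "b \<in> Ob C" "x \<in> Ob D" "y \<in> Ob D"
    using left.source.hom_Ob[OF ih] left.target.hom_Ob[OF ph] by auto
  note Li = left.fmor_closed[OF ih] and Rp = right.fmor_closed[OF ph]
  have square: "p \<cdot>\<^bsub>D\<^esub> f = g \<cdot>\<^bsub>D\<^esub> fmor L i \<longleftrightarrow> fmor R p \<cdot>\<^bsub>C\<^esub> \<phi> a x f = \<phi> b y g \<cdot>\<^bsub>C\<^esub> i"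
    if f: "f \<in> hom D (fob L a) x" and g: "g \<in> hom D (fob L b) y" for f g
    using transpose_inj[OF O(1) left.target.comp_closed[OF f ph] left.target.comp_closed[OF Li g]]
      transpose_comp_left[OF ih g] transpose_comp_right[OF ph f O(1)] by auto
  have upper: "h \<cdot>\<^bsub>D\<^esub> fmor L i = f \<longleftrightarrow> \<phi> b x h \<cdot>\<^bsub>C\<^esub> i = \<phi> a x f"
    if f: "f \<in> hom D (fob L a) x" and h: "h \<in> hom D (fob L b) x" for f h
    using transpose_inj[OF O(1) left.target.comp_closed[OF Li h] f] transpose_comp_left[OF ih h] by auto
  have lower: "p \<cdot>\<^bsub>D\<^esub> h = g \<longleftrightarrow> fmor R p \<cdot>\<^bsub>C\<^esub> \<phi> b x h = \<phi> b y g"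
    if g: "g \<in> hom D (fob L b) y" and h: "h \<in> hom D (fob L b) x" for g h
    using transpose_inj[OF O(2) left.target.comp_closed[OF h ph] g] transpose_comp_right[OF ph h O(2)]
    by auto
  show ?thesis
  proof
    assume lift: "lifts_against D (fmor L i) p"
    show "lifts_against C i (fmor R p)"
    proof (rule lifts_againstI[OF ih Rp])
      fix f' g' assume f': "f' \<in> hom C a (fob R x)" and g': "g' \<in> hom C b (fob R y)"
        and eq: "fmor R p \<cdot>\<^bsub>C\<^esub> f' = g' \<cdot>\<^bsub>C\<^esub> i"
      obtain f where f: "f \<in> hom D (fob L a) x" "\<phi> a x f = f'" using transpose_surj[OF O(1,3) f'] .
      obtain g where g: "g \<in> hom D (fob L b) y" "\<phi> b y g = g'" using transpose_surj[OF O(2,4) g'] .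
      have "p \<cdot>\<^bsub>D\<^esub> f = g \<cdot>\<^bsub>D\<^esub> fmor L i" using square[OF f(1) g(1)] f g eq by simp
      then obtain h where h: "h \<in> hom D (fob L b) x" "h \<cdot>\<^bsub>D\<^esub> fmor L i = f" "p \<cdot>\<^bsub>D\<^esub> h = g"
        using lifts_againstE[OF lift Li ph f(1) g(1)] by blast
      then show "\<exists>h' \<in> hom C b (fob R x). h' \<cdot>\<^bsub>C\<^esub> i = f' \<and> fmor R p \<cdot>\<^bsub>C\<^esub> h' = g'"
        using upper[OF f(1) h(1)] lower[OF g(1) h(1)] f g transpose_closed[OF O(2) h(1)] by blast
    qed
  next
    assume lift: "lifts_against C i (fmor R p)"
    show "lifts_against D (fmor L i) p"
    proof (rule lifts_againstI[OF Li ph])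
      fix f g assume f: "f \<in> hom D (fob L a) x" and g: "g \<in> hom D (fob L b) y"
        and eq: "p \<cdot>\<^bsub>D\<^esub> f = g \<cdot>\<^bsub>D\<^esub> fmor L i"
      have "fmor R p \<cdot>\<^bsub>C\<^esub> \<phi> a x f = \<phi> b y g \<cdot>\<^bsub>C\<^esub> i" using square[OF f g] eq by blast
      then obtain h' where h': "h' \<in> hom C b (fob R x)" "h' \<cdot>\<^bsub>C\<^esub> i = \<phi> a x f"
        "fmor R p \<cdot>\<^bsub>C\<^esub> h' = \<phi> b y g"
        using lifts_againstE[OF lift ih Rp transpose_closed[OF O(1) f] transpose_closed[OF O(2) g]] by blast
      obtain h where h: "h \<in> hom D (fob L b) x" "\<phi> b x h = h'" using transpose_surj[OF O(2,3) h'(1)] .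
      then show "\<exists>h \<in> hom D (fob L b) x. h \<cdot>\<^bsub>D\<^esub> fmor L i = f \<and> p \<cdot>\<^bsub>D\<^esub> h = g"
        using upper[OF f h(1)] lower[OF g h(1)] h' by blast
    qed
  qed
qed

lemma rlp_adjoint:
  assumes "K \<subseteq> Arr C" "p \<in> Arr D"
  shows "p \<in> rlp D (fmor L ` K) \<longleftrightarrow> fmor R p \<in> rlp C K"
proof -
  have "fmor R p \<in> Arr C" using homD[OF cat_functor_Arr[OF right.cat_functor_axioms assms(2)]] by blast
  then show ?thesis
    using assms lifts_against_adjoint unfolding rlp_def by (auto simp: subset_iff)
qed

text \<open>
  Transposition turns cocones under \<open>L X\<close> into cocones under \<open>X\<close>.
\<close>

lemma left_adjoint_colimit:
  assumes X: "cat_functor B C X" and c: "is_colimit B C X c \<iota>"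
  shows "is_colimit B D (L \<circ>\<^sub>F X) (fob L c) (\<lambda>b. fmor L (\<iota> b))"
proof -
  interpret X: cat_functor B C X by (rule X)
  note cc = colimit_cocone[OF c]
  have cO: "c \<in> Ob C" and \<iota>: "\<And>b. b \<in> Ob B \<Longrightarrow> \<iota> b \<in> hom C (fob X b) c"
    and \<iota>X: "\<And>f. f \<in> Arr B \<Longrightarrow> \<iota> (Cod B f) \<cdot>\<^bsub>C\<^esub> fmor X f = \<iota> (Dom B f)"
    using cc unfolding cocone_def by blast+
  have Xh: "fmor X f \<in> hom C (fob X (Dom B f)) (fob X (Cod B f))" if "f \<in> Arr B" for f
    using X.fmor_closed[OF Arr_hom[OF that]] .
  show ?thesis unfolding is_colimit_def
  proof (intro conjI allI impI)
    show "cocone B D (L \<circ>\<^sub>F X) (fob L c) (\<lambda>b. fmor L (\<iota> b))"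
      unfolding cocone_def fcomp_simps
      using left.fob_closed[OF cO] left.fmor_closed[OF \<iota>] \<iota>X left.fmor_comp[OF Xh \<iota>] X.source.cod_closed
      by metis
    fix z \<kappa> assume \<kappa>: "cocone B D (L \<circ>\<^sub>F X) z \<kappa>"
    have zO: "z \<in> Ob D" and \<kappa>h: "\<And>b. b \<in> Ob B \<Longrightarrow> \<kappa> b \<in> hom D (fob L (fob X b)) z"
      and \<kappa>X: "\<And>f. f \<in> Arr B \<Longrightarrow> \<kappa> (Cod B f) \<cdot>\<^bsub>D\<^esub> fmor L (fmor X f) = \<kappa> (Dom B f)"
      using \<kappa> unfolding cocone_def by auto
    define \<kappa>' where "\<kappa>' b = \<phi> (fob X b) z (\<kappa> b)" for b
    have "cocone B C X (fob R z) \<kappa>'" unfolding cocone_def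
    proof (intro conjI ballI)
      show "fob R z \<in> Ob C" by (rule right.fob_closed[OF zO])
      show "\<kappa>' b \<in> hom C (fob X b) (fob R z)" if "b \<in> Ob B" for b
        unfolding \<kappa>'_def by (rule transpose_closed[OF X.fob_closed[OF that] \<kappa>h[OF that]])
      show "\<kappa>' (Cod B f) \<cdot>\<^bsub>C\<^esub> fmor X f = \<kappa>' (Dom B f)" if f: "f \<in> Arr B" for f
        unfolding \<kappa>'_def
        using transpose_comp_left[OF Xh[OF f] \<kappa>h[OF X.source.cod_closed[OF f]]] \<kappa>X[OF f] by simp
    qed
    then have ex1: "\<exists>!k. k \<in> hom C c (fob R z) \<and> (\<forall>b \<in> Ob B. k \<cdot>\<^bsub>C\<^esub> \<iota> b = \<kappa>' b)"
      using c unfolding is_colimit_def by blast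
    have iff: "(\<forall>b \<in> Ob B. h \<cdot>\<^bsub>D\<^esub> fmor L (\<iota> b) = \<kappa> b) \<longleftrightarrow> (\<forall>b \<in> Ob B. \<phi> c z h \<cdot>\<^bsub>C\<^esub> \<iota> b = \<kappa>' b)"
      if h: "h \<in> hom D (fob L c) z" for h
    proof (intro ball_cong refl)
      fix b assume b: "b \<in> Ob B"
      show "h \<cdot>\<^bsub>D\<^esub> fmor L (\<iota> b) = \<kappa> b \<longleftrightarrow> \<phi> c z h \<cdot>\<^bsub>C\<^esub> \<iota> b = \<kappa>' b"
        using transpose_inj[OF X.fob_closed[OF b]
            left.target.comp_closed[OF left.fmor_closed[OF \<iota>[OF b]] h] \<kappa>h[OF b]]
          transpose_comp_left[OF \<iota>[OF b] h] unfolding \<kappa>'_def by auto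
    qed
    show "\<exists>!h. h \<in> hom D (fob L c) z \<and> (\<forall>b \<in> Ob B. h \<cdot>\<^bsub>D\<^esub> fmor L (\<iota> b) = \<kappa> b)"
    proof -
      obtain k where k: "k \<in> hom C c (fob R z)" "\<forall>b \<in> Ob B. k \<cdot>\<^bsub>C\<^esub> \<iota> b = \<kappa>' b"
        and uniq: "\<And>k'. k' \<in> hom C c (fob R z) \<Longrightarrow> \<forall>b \<in> Ob B. k' \<cdot>\<^bsub>C\<^esub> \<iota> b = \<kappa>' b \<Longrightarrow> k' = k"
        using ex1 by blast
      obtain h where h: "h \<in> hom D (fob L c) z" "\<phi> c z h = k" using transpose_surj[OF cO zO k(1)] .
      show ?thesis
      proof (rule ex1I[of _ h])
        show "h \<in> hom D (fob L c) z \<and> (\<forall>b \<in> Ob B. h \<cdot>\<^bsub>D\<^esub> fmor L (\<iota> b) = \<kappa> b)"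
          using h k iff[OF h(1)] by blast
        fix h' assume h': "h' \<in> hom D (fob L c) z \<and> (\<forall>b \<in> Ob B. h' \<cdot>\<^bsub>D\<^esub> fmor L (\<iota> b) = \<kappa> b)"
        then have "\<phi> c z h' = k" using uniq[OF transpose_closed[OF cO]] iff by blast
        then show "h' = h" using transpose_inj[OF cO] h h' by blast
      qed
    qed
  qed
qed

lemma left_adjoint_lambda_sequence:
  assumes X: "lambda_sequence r C X"
  shows "lambda_sequence r D (L \<circ>\<^sub>F X)"
proof -
  interpret R: well_ordering r using X unfolding lambda_sequence_def by unfold_locales blast
  have XF: "cat_functor (ord_cat r) C X" using X unfolding lambda_sequence_def by blast
  have "is_colimit (ord_cat (Restr r (R.below c))) D (L \<circ>\<^sub>F X) (fob L (fob X c)) (\<lambda>b. fmor L (fmor X (b, c)))"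
    if "limit_in r c" for c
    using X that left_adjoint_colimit[OF R.functor_Restr[OF XF]] unfolding lambda_sequence_def by blast
  then show ?thesis
    unfolding lambda_sequence_def
    using R.wo cat_functor_fcomp[OF XF left.cat_functor_axioms] by simp
qed

text \<open>Arrows \<open>L w \<rightarrow> X b\<close> are arrows \<open>w \<rightarrow> R (X b)\<close>, compatibly in \<open>b\<close>.\<close>

lemma hom_preserved_adjoint:
  assumes r: "well_ordering r" and X: "cat_functor (ord_cat r) D X" and c: "cocone (ord_cat r) D X c \<iota>"
    and w: "w \<in> Ob C"
    and preserved: "hom_preserved r C (R \<circ>\<^sub>F X) (fob R c) (\<lambda>b. fmor R (\<iota> b)) w"
  shows "hom_preserved r D X c \<iota> (fob L w)"
proof -
  interpret W: well_ordering r by (rule r)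
  note X' = W.functorD[OF X]
  have cO: "c \<in> Ob D" and \<iota>: "\<And>b. b \<in> Field r \<Longrightarrow> \<iota> b \<in> hom D (fob X b) c"
    using c unfolding cocone_ord_iff by blast+
  show ?thesis unfolding hom_preserved_def
  proof (intro conjI ballI impI)
    fix u assume u: "u \<in> hom D (fob L w) c"
    obtain b g where b: "b \<in> Field r" and g: "g \<in> hom C w (fob R (fob X b))"
      and eq: "fmor R (\<iota> b) \<cdot>\<^bsub>C\<^esub> g = \<phi> w c u"
      using preserved transpose_closed[OF w u] unfolding hom_preserved_def fcomp_simps by blast
    obtain f where f: "f \<in> hom D (fob L w) (fob X b)" "\<phi> w (fob X b) f = g"
      using transpose_surj[OF w X'(1)[OF b] g] .
    have "\<phi> w c (\<iota> b \<cdot>\<^bsub>D\<^esub> f) = \<phi> w c u" using transpose_comp_right[OF \<iota>[OF b] f(1) w] f(2) eq by simp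
    then have "\<iota> b \<cdot>\<^bsub>D\<^esub> f = u"
      using transpose_inj[OF w left.target.comp_closed[OF f(1) \<iota>[OF b]] u] by blast
    then show "\<exists>b \<in> Field r. \<exists>f \<in> hom D (fob L w) (fob X b). \<iota> b \<cdot>\<^bsub>D\<^esub> f = u" using b f(1) by blast
  next
    fix b b' f g assume b: "b \<in> Field r" "b' \<in> Field r" and f: "f \<in> hom D (fob L w) (fob X b)"
      and g: "g \<in> hom D (fob L w) (fob X b')" and eq: "\<iota> b \<cdot>\<^bsub>D\<^esub> f = \<iota> b' \<cdot>\<^bsub>D\<^esub> g"
    have "fmor R (\<iota> b) \<cdot>\<^bsub>C\<^esub> \<phi> w (fob X b) f = fmor R (\<iota> b') \<cdot>\<^bsub>C\<^esub> \<phi> w (fob X b') g"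
      using transpose_comp_right[OF \<iota>[OF b(1)] f w] transpose_comp_right[OF \<iota>[OF b(2)] g w] eq by simp
    then obtain d where d: "(b, d) \<in> r" "(b', d) \<in> r"
      and deq: "fmor R (fmor X (b, d)) \<cdot>\<^bsub>C\<^esub> \<phi> w (fob X b) f = fmor R (fmor X (b', d)) \<cdot>\<^bsub>C\<^esub> \<phi> w (fob X b') g"
      using preserved b transpose_closed[OF w f] transpose_closed[OF w g]
      unfolding hom_preserved_def fcomp_simps by blast
    have "\<phi> w (fob X d) (fmor X (b, d) \<cdot>\<^bsub>D\<^esub> f) = \<phi> w (fob X d) (fmor X (b', d) \<cdot>\<^bsub>D\<^esub> g)"
      using transpose_comp_right[OF X'(3)[OF d(1)] f w] transpose_comp_right[OF X'(3)[OF d(2)] g w] deq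
      by simp
    then have "fmor X (b, d) \<cdot>\<^bsub>D\<^esub> f = fmor X (b', d) \<cdot>\<^bsub>D\<^esub> g"
      using transpose_inj[OF w left.target.comp_closed[OF f X'(3)[OF d(1)]]
          left.target.comp_closed[OF g X'(3)[OF d(2)]]] by blast
    then show "\<exists>d. (b, d) \<in> r \<and> (b', d) \<in> r \<and> fmor X (b, d) \<cdot>\<^bsub>D\<^esub> f = fmor X (b', d) \<cdot>\<^bsub>D\<^esub> g"
      using d by blast
  qed
qed

end

section \<open>Cell complexes under the adjunctions\<close>

text \<open>
  \<open>F f\<close> lifts against \<open>p\<close> if \<open>f\<close> lifts against \<open>R p\<close>, and for this it suffices that the generators \<open>L k\<close> do. They
  do because \<open>F L k\<close> lifts against \<open>p\<close>.
\<close>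

lemma cell_complexes_image_llp:
  assumes LF: "adjunction M N L F" and FR: "adjunction N M F R" and K: "K \<subseteq> Arr M"
    and FL: "\<And>k. k \<in> K \<Longrightarrow> fmor F (fmor L k) \<in> llp M (rlp M K)"
    and f: "f \<in> relative_cell_complexes U N (fmor L ` K)"
  shows "fmor F f \<in> llp M (rlp M K)"
proof -
  interpret N: category N using LF unfolding adjunction_def cat_functor_def by blast
  obtain \<phi> where "adjoint_functors M N L F \<phi>" using adjunctionE[OF LF] .
  then interpret LF: adjoint_functors M N L F \<phi> .
  obtain \<psi> where "adjoint_functors N M F R \<psi>" using adjunctionE[OF FR] .
  then interpret FR: adjoint_functors N M F R \<psi> .
  have fA: "f \<in> Arr N" by (rule N.relative_cell_complex_Arr[OF f])
  have FfA: "fmor F f \<in> Arr M"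
    using homD[OF cat_functor_Arr[OF LF.right.cat_functor_axioms fA]] by blast
  have "lifts_against M (fmor F f) p" if p: "p \<in> rlp M K" for p
  proof -
    have pA: "p \<in> Arr M" using p unfolding rlp_def by blast
    have RpA: "fmor R p \<in> Arr N"
      using homD[OF cat_functor_Arr[OF FR.right.cat_functor_axioms pA]] by blast
    have "lifts_against N k (fmor R p)" if k: "k \<in> fmor L ` K" for k
    proof -
      obtain k' where k': "k' \<in> K" "k = fmor L k'" using k by blast
      have kA: "k \<in> Arr N"
        using homD[OF cat_functor_Arr[OF LF.left.cat_functor_axioms, of k']] k' K by blast
      have "lifts_against M (fmor F k) p" using FL[OF k'(1)] p k'(2) unfolding llp_def by blast
      then show ?thesis using FR.lifts_against_adjoint[OF kA pA] by blast
    qed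
    then have "lifts_against N f (fmor R p)"
      using N.relative_cell_complex_lifts[OF f RpA] by blast
    then show ?thesis using FR.lifts_against_adjoint[OF fA pA] by blast
  qed
  then show ?thesis unfolding llp_def using FfA by blast
qed

text \<open>
  For a sequence \<open>X\<close> of relative \<open>L K\<close>-cell complexes with colimit \<open>c\<close>, the sequence \<open>F X\<close> has colimit \<open>F c\<close>
  and, by \<open>cell_complexes_image_llp\<close>, its arrows lift against whatever \<open>K\<close> lifts against. By \<open>small_relative_llp\<close> the
  domain \<open>w\<close> of a generator is small relative to such sequences, which transposes to the smallness of \<open>L w\<close>.
\<close>

theorem permits_small_object_argument_image:
  assumes univ: "grothendieck_universe U" and M: "bicomplete U M"
    and LF: "adjunction M N L F" and FR: "adjunction N M F R"
    and K: "K \<subseteq> Arr M" "small U K" and soa: "permits_small_object_argument U M K"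
    and FL: "\<And>k. k \<in> K \<Longrightarrow> fmor F (fmor L k) \<in> llp M (rlp M K)"
  shows "permits_small_object_argument U N (fmor L ` K)"
proof -
  interpret M: category M using M unfolding bicomplete_def by blast
  interpret M: bicomplete_category U M
    by unfold_locales (rule univ, rule M)
  obtain \<phi> where "adjoint_functors M N L F \<phi>" using adjunctionE[OF LF] .
  then interpret LF: adjoint_functors M N L F \<phi> .
  obtain \<psi> where "adjoint_functors N M F R \<psi>" using adjunctionE[OF FR] .
  then interpret FR: adjoint_functors N M F R \<psi> .
  let ?cells = "relative_cell_complexes U N (fmor L ` K)"
  show ?thesis unfolding permits_small_object_argument_def
  proof (rule ballI)
    fix i assume "i \<in> fmor L ` K"
    then obtain k where k: "k \<in> K" "i = fmor L k" by blast
    define w where "w = Dom M k"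
    have kA: "k \<in> Arr M" using k(1) K(1) by blast
    have w: "w \<in> Ob M" unfolding w_def by (rule M.dom_closed[OF kA])
    have Dom: "Dom N i = fob L w"
      using homD[OF cat_functor_Arr[OF LF.left.cat_functor_axioms kA]] k(2) unfolding w_def by simp
    have "small_relative U M (relative_cell_complexes U M K) w"
      using soa k(1) unfolding permits_small_object_argument_def w_def by blast
    then have "small_relative U M (llp M (rlp M K)) w" by (rule M.small_relative_llp[OF K soa])
    then obtain \<kappa> :: "'a rel" where \<kappa>: "Card_order \<kappa>" "small U (Field \<kappa>)"
      and small_w: "kappa_small_relative U \<kappa> M (llp M (rlp M K)) w"
      unfolding small_relative_def by blast
    have "kappa_small_relative U \<kappa> N ?cells (fob L w)" unfolding kappa_small_relative_def
    proof (intro allI impI)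
      fix r :: "'a rel" and X c \<iota>
      assume r: "Card_order r \<and> cinfinite r \<and> regularCard r \<and> small U (Field r) \<and> \<kappa> \<le>o r"
        and Xc: "lambda_sequence_of r N ?cells X \<and> is_colimit (ord_cat r) N X c \<iota>"
      interpret W: well_ordering r by unfold_locales (use r in \<open>auto simp: card_order_on_def\<close>)
      have X: "lambda_sequence r N X" and X_cells: "\<And>b c. succ_in r b c \<Longrightarrow> fmor X (b, c) \<in> ?cells"
        and c: "is_colimit (ord_cat r) N X c \<iota>"
        using Xc unfolding lambda_sequence_of_def by blast+
      have XF: "cat_functor (ord_cat r) N X" using X unfolding lambda_sequence_def by blast
      have FXF: "cat_functor (ord_cat r) M (F \<circ>\<^sub>F X)"
        by (rule cat_functor_fcomp[OF XF LF.right.cat_functor_axioms])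
      have FX: "lambda_sequence_of r M (llp M (rlp M K)) (F \<circ>\<^sub>F X)"
        unfolding lambda_sequence_of_def fcomp_simps
        using FR.left_adjoint_lambda_sequence[OF X] cell_complexes_image_llp[OF LF FR K(1) FL X_cells]
        by blast
      have Fc: "is_colimit (ord_cat r) M (F \<circ>\<^sub>F X) (fob F c) (\<lambda>b. fmor F (\<iota> b))"
        by (rule FR.left_adjoint_colimit[OF XF c])
      have "hom_preserved r M (F \<circ>\<^sub>F X) (fob F c) (\<lambda>b. fmor F (\<iota> b)) w"
        using small_w r FX Fc
          hom_colim_map_bij_iff[OF W.well_ordering_axioms FXF colimit_cocone[OF Fc]]
        unfolding kappa_small_relative_def by blast
      then have "hom_preserved r N X c \<iota> (fob L w)"
        by (rule LF.hom_preserved_adjoint[OF W.well_ordering_axioms XF colimit_cocone[OF c] w])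
      then show "bij_betw (hom_colim_map N \<iota>) (hom_colim r N X (fob L w)) (hom N (fob L w) c)"
        using hom_colim_map_bij_iff[OF W.well_ordering_axioms XF colimit_cocone[OF c]] by blast
    qed
    then show "small_relative U N ?cells (Dom N i)"
      unfolding small_relative_def Dom using \<kappa> by blast
  qed
qed


section \<open>The right-induced model structure\<close>

context cofibrantly_generated_model_category
begin

lemma is_category: "category C"
  using bicomplete unfolding bicomplete_def by blast

text \<open>
  An arrow with the lifting property is, by the retract argument, a retract of the left factor of its
  factorization.
\<close>

lemma cofs_eq: "cofs S = llp C (rlp C I)"
proof
  show "cofs S \<subseteq> llp C (rlp C I)"
    using classes_closed(2) lifting(1) acyclic_fibs_eq unfolding llp_def by blast
  show "llp C (rlp C I) \<subseteq> cofs S"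
  proof
    interpret category C by (rule is_category)
    fix f assume f: "f \<in> llp C (rlp C I)"
    then have "f \<in> hom C (Dom C f) (Cod C f)" using Arr_hom[of f C] unfolding llp_def by blast
    then obtain z j q where j: "j \<in> hom C (Dom C f) z" and q: "q \<in> hom C z (Cod C f)" and fq: "f = q \<cdot> j"
      and jq: "j \<in> cofs S" "q \<in> fibs S \<inter> weqs S"
      using factorization(1) by blast
    have "lifts_against C (q \<cdot> j) q" using f jq(2) acyclic_fibs_eq unfolding llp_def fq by blast
    then have "is_retract C f j" unfolding fq by (rule retract_of_factor[OF j q])
    then show "f \<in> cofs S" using retracts(2) jq(1) by blast
  qed
qed

lemma acyclic_cofs_eq: "cofs S \<inter> weqs S = llp C (rlp C J)"
proof
  show "cofs S \<inter> weqs S \<subseteq> llp C (rlp C J)"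
    using classes_closed(2) lifting(2) fibs_eq unfolding llp_def by blast
  show "llp C (rlp C J) \<subseteq> cofs S \<inter> weqs S"
  proof
    interpret category C by (rule is_category)
    fix f assume f: "f \<in> llp C (rlp C J)"
    then have "f \<in> hom C (Dom C f) (Cod C f)" using Arr_hom[of f C] unfolding llp_def by blast
    then obtain z j q where j: "j \<in> hom C (Dom C f) z" and q: "q \<in> hom C z (Cod C f)" and fq: "f = q \<cdot> j"
      and jq: "j \<in> cofs S \<inter> weqs S" "q \<in> fibs S"
      using factorization(2) by blast
    have "lifts_against C (q \<cdot> j) q" using f jq(2) fibs_eq unfolding llp_def fq by blast
    then have "is_retract C f j" unfolding fq by (rule retract_of_factor[OF j q])
    then show "f \<in> cofs S \<inter> weqs S" using retracts(1,2) jq(1) by blast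
  qed
qed

lemma I_cofs: "I \<subseteq> cofs S"
  using generators_closed(1) unfolding cofs_eq llp_def rlp_def by blast

lemma J_acyclic_cofs: "J \<subseteq> cofs S \<inter> weqs S"
  using generators_closed(2) unfolding acyclic_cofs_eq llp_def rlp_def by blast

end

theorem theorem2p3:
  fixes U :: "'u itself"
    and M :: "('o, 'm) cat" and S :: "'m model_structure" and I J :: "'m set"
    and N :: "('p, 'n) cat"
    and F :: "('p, 'n, 'o, 'm) fnctr" and L R :: "('o, 'm, 'p, 'n) fnctr"
  assumes "grothendieck_universe U"
    and "cofibrantly_generated_model_category U M S I J"
    and "bicomplete U N"
    and "adjunction M N L F"
    and "adjunction N M F R"
    and "quillen_adjunction M S M S (F \<circ>\<^sub>F L) (F \<circ>\<^sub>F R)"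
  shows "\<exists>T :: 'n model_structure.
           cofibrantly_generated_model_category U N T (fmor L ` I) (fmor L ` J) \<and>
           weqs T = {f \<in> Arr N. fmor F f \<in> weqs S} \<and>
           right_induced N T S F \<and>
           quillen_adjunction M S N T L F \<and>
           quillen_adjunction N T M S F R"
proof -
  note LF_adj = assms(4) and FR_adj = assms(5)
  interpret M: cofibrantly_generated_model_category U M S I J by (rule assms(2))
  interpret N: category N using assms(3) unfolding bicomplete_def by blast
  interpret N: bicomplete_category U N
    by unfold_locales (rule assms(1), rule assms(3))
  obtain \<phi> where "adjoint_functors M N L F \<phi>" using adjunctionE[OF LF_adj] .
  then interpret LF: adjoint_functors M N L F \<phi> .
  obtain \<psi> where "adjoint_functors N M F R \<psi>" using adjunctionE[OF FR_adj] .
  then interpret FR: adjoint_functors N M F R \<psi> .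
  have FL_cofs: "fmor F (fmor L f) \<in> cofs S" if "f \<in> cofs S" for f
    using assms(6) that unfolding quillen_adjunction_def by simp
  have FL_acyclic: "fmor F (fmor L f) \<in> cofs S \<inter> weqs S" if "f \<in> cofs S \<inter> weqs S" for f
    using assms(6) that unfolding quillen_adjunction_def by simp
  have F_hom: "fmor F f \<in> hom M (fob F (Dom N f)) (fob F (Cod N f))" if "f \<in> Arr N" for f
    by (rule cat_functor_Arr[OF LF.right.cat_functor_axioms that])
  have F_Arr: "fmor F f \<in> Arr M" if "f \<in> Arr N" for f using homD[OF F_hom[OF that]] by blast
  have L_Arr: "fmor L f \<in> Arr N" if "f \<in> Arr M" for f
    using homD[OF cat_functor_Arr[OF LF.left.cat_functor_axioms that]] by blast
  let ?LI = "fmor L ` I" and ?LJ = "fmor L ` J"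
  have LI: "?LI \<subseteq> Arr N" "small U ?LI" and LJ: "?LJ \<subseteq> Arr N" "small U ?LJ"
    using M.generators_closed L_Arr N.small_surj[OF M.generators_small(1) order_refl]
      N.small_surj[OF M.generators_small(2) order_refl] by auto
  have FLI: "fmor F (fmor L k) \<in> llp M (rlp M I)" if "k \<in> I" for k
    using FL_cofs M.I_cofs that M.cofs_eq by blast
  have FLJ: "fmor F (fmor L k) \<in> llp M (rlp M J)" if "k \<in> J" for k
    using FL_acyclic M.J_acyclic_cofs that M.acyclic_cofs_eq by blast
  have soa_I: "permits_small_object_argument U N ?LI"
    by (rule permits_small_object_argument_image[OF assms(1) M.bicomplete LF_adj FR_adj
          M.generators_closed(1) M.generators_small(1) M.small_object_argument(1) FLI])
  have soa_J: "permits_small_object_argument U N ?LJ"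
    by (rule permits_small_object_argument_image[OF assms(1) M.bicomplete LF_adj FR_adj
          M.generators_closed(2) M.generators_small(2) M.small_object_argument(2) FLJ])
  have rlp_LI: "p \<in> rlp N ?LI \<longleftrightarrow> fmor F p \<in> fibs S \<inter> weqs S" if "p \<in> Arr N" for p
    unfolding M.acyclic_fibs_eq by (rule LF.rlp_adjoint[OF M.generators_closed(1) that])
  have rlp_LJ: "p \<in> rlp N ?LJ \<longleftrightarrow> fmor F p \<in> fibs S" if "p \<in> Arr N" for p
    unfolding M.fibs_eq by (rule LF.rlp_adjoint[OF M.generators_closed(2) that])
  \<comment> \<open>Given the weak equivalences and fibrations, lifting leaves no choice for the cofibrations.\<close>
  define T where "T = \<lparr>weqs = {f \<in> Arr N. fmor F f \<in> weqs S}, cofs = llp N (rlp N ?LI), fibs = rlp N ?LJ\<rparr>"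
  have weqs: "weqs T = {f \<in> Arr N. fmor F f \<in> weqs S}" and cofs: "cofs T = llp N (rlp N ?LI)"
    and fibs: "fibs T = rlp N ?LJ" by (simp_all add: T_def)
  have rlp_Arr: "rlp N K \<subseteq> Arr N" for K unfolding rlp_def by blast
  have acyclic_fibs: "fibs T \<inter> weqs T = rlp N ?LI"
    unfolding weqs fibs using rlp_LI rlp_LJ rlp_Arr by blast
  have cells_J: "relative_cell_complexes U N ?LJ \<subseteq> cofs T \<inter> weqs T"
  proof
    fix f assume f: "f \<in> relative_cell_complexes U N ?LJ"
    have fA: "f \<in> Arr N" by (rule N.relative_cell_complex_Arr[OF f])
    have "f \<in> llp N (rlp N ?LJ)" using N.relative_cell_complexes_subset_llp f by blast
    then have "f \<in> cofs T" using acyclic_fibs unfolding cofs fibs llp_def by blast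
    moreover have "fmor F f \<in> weqs S"
      using cell_complexes_image_llp[OF LF_adj FR_adj M.generators_closed(2) FLJ f] M.acyclic_cofs_eq by blast
    ultimately show "f \<in> cofs T \<inter> weqs T" using fA unfolding weqs by blast
  qed
  have lift_I: "lifts_against N i p" if "i \<in> cofs T" "p \<in> fibs T \<inter> weqs T" for i p
    using that acyclic_fibs unfolding cofs llp_def by blast
  have weqs_cancel: "g \<in> weqs T"
    if f: "f \<in> hom N x y" and g: "g \<in> hom N y z" and fg: "f \<in> weqs T" "g \<cdot>\<^bsub>N\<^esub> f \<in> weqs T" for f g x y z
  proof -
    have "fmor F g \<in> weqs S"
      using fg M.two_of_three(2)[OF LF.right.fmor_closed[OF f] LF.right.fmor_closed[OF g]]
        LF.right.fmor_comp[OF f g] unfolding weqs by simp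
    then show ?thesis using homD[OF g] unfolding weqs by blast
  qed
  have weqs_cancel': "f \<in> weqs T"
    if f: "f \<in> hom N x y" and g: "g \<in> hom N y z" and fg: "g \<in> weqs T" "g \<cdot>\<^bsub>N\<^esub> f \<in> weqs T" for f g x y z
  proof -
    have "fmor F f \<in> weqs S"
      using fg M.two_of_three(3)[OF LF.right.fmor_closed[OF f] LF.right.fmor_closed[OF g]]
        LF.right.fmor_comp[OF f g] unfolding weqs by simp
    then show ?thesis using homD[OF f] unfolding weqs by blast
  qed
  have model: "cofibrantly_generated_model_category U N T ?LI ?LJ"
  proof unfold_locales
    show "bicomplete U N" by (rule assms(3))
    show "weqs T \<subseteq> Arr N" unfolding weqs by blast
    show "cofs T \<subseteq> Arr N" unfolding cofs llp_def by blast
    show "fibs T \<subseteq> Arr N" unfolding fibs by (rule rlp_Arr)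
    show "g \<cdot>\<^bsub>N\<^esub> f \<in> weqs T"
      if f: "f \<in> hom N x y" and g: "g \<in> hom N y z" and fg: "f \<in> weqs T" "g \<in> weqs T" for f g x y z
    proof -
      have "fmor F (g \<cdot>\<^bsub>N\<^esub> f) \<in> weqs S"
        using fg M.two_of_three(1)[OF LF.right.fmor_closed[OF f] LF.right.fmor_closed[OF g]]
          LF.right.fmor_comp[OF f g] unfolding weqs by simp
      then show ?thesis using homD[OF N.comp_closed[OF f g]] unfolding weqs by blast
    qed
    show "g \<in> weqs T"
      if "f \<in> hom N x y" "g \<in> hom N y z" "f \<in> weqs T" "g \<cdot>\<^bsub>N\<^esub> f \<in> weqs T" for f g x y z
      by (rule weqs_cancel[OF that])
    show "f \<in> weqs T"
      if "f \<in> hom N x y" "g \<in> hom N y z" "g \<in> weqs T" "g \<cdot>\<^bsub>N\<^esub> f \<in> weqs T" for f g x y z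
      by (rule weqs_cancel'[OF that])
    show "f \<in> weqs T" if r: "is_retract N f g" and g: "g \<in> weqs T" for f g
    proof -
      have "fmor F f \<in> weqs S"
        using M.retracts(1)[OF cat_functor_retract[OF LF.right.cat_functor_axioms r]] g unfolding weqs by blast
      moreover have "f \<in> Arr N" using r unfolding is_retract_def by blast
      ultimately show ?thesis unfolding weqs by blast
    qed
    show "f \<in> cofs T" if r: "is_retract N f g" and g: "g \<in> cofs T" for f g
    proof -
      have "f \<in> Arr N" using r unfolding is_retract_def by blast
      then show ?thesis using g N.retract_lifts[OF r] rlp_Arr unfolding cofs llp_def by blast
    qed
    show "f \<in> fibs T" if r: "is_retract N f g" and g: "g \<in> fibs T" for f g
    proof -
      have fg: "f \<in> Arr N" "g \<in> Arr N" using r unfolding is_retract_def by blast+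
      have "fmor F f \<in> fibs S"
        using M.retracts(3)[OF cat_functor_retract[OF LF.right.cat_functor_axioms r]] g rlp_LJ[OF fg(2)]
        unfolding fibs by blast
      then show ?thesis using rlp_LJ[OF fg(1)] unfolding fibs by blast
    qed
    show "lifts_against N i p" if "i \<in> cofs T" "p \<in> fibs T \<inter> weqs T" for i p by (rule lift_I[OF that])
    show "lifts_against N i p" if i: "i \<in> cofs T \<inter> weqs T" and p: "p \<in> fibs T" for i p
    proof -
      have iA: "i \<in> Arr N" using i unfolding weqs by blast
      \<comment> \<open>An acyclic cofibration is a retract of a relative \<open>LJ\<close>-cell complex.\<close>
      obtain z j q where j: "j \<in> hom N (Dom N i) z" and q: "q \<in> hom N z (Cod N i)" and ijq: "i = q \<cdot>\<^bsub>N\<^esub> j"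
        and cell: "j \<in> relative_cell_complexes U N ?LJ" and q_rlp: "q \<in> rlp N ?LJ"
        using N.small_object_argument[OF LJ soa_J Arr_hom[OF iA]] .
      have "q \<in> weqs T" using weqs_cancel[OF j q] cells_J cell i ijq by blast
      then have "lifts_against N (q \<cdot>\<^bsub>N\<^esub> j) q" using lift_I[of i q] i q_rlp ijq unfolding fibs by blast
      then have "is_retract N i j" unfolding ijq by (rule N.retract_of_factor[OF j q])
      moreover have "lifts_against N j p"
        using N.relative_cell_complexes_subset_llp cell p unfolding fibs llp_def by blast
      ultimately show ?thesis using N.retract_lifts p rlp_Arr unfolding fibs by blast
    qed
    show "\<exists>z. \<exists>i \<in> hom N x z. \<exists>p \<in> hom N z y. f = p \<cdot>\<^bsub>N\<^esub> i \<and> i \<in> cofs T \<and> p \<in> fibs T \<inter> weqs T"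
      if f: "f \<in> hom N x y" for f x y
    proof -
      obtain z i p where "i \<in> hom N x z" "p \<in> hom N z y" "f = p \<cdot>\<^bsub>N\<^esub> i"
        "i \<in> relative_cell_complexes U N ?LI" "p \<in> rlp N ?LI"
        using N.small_object_argument[OF LI soa_I f] .
      then show ?thesis
        using N.relative_cell_complexes_subset_llp[of U ?LI] acyclic_fibs unfolding cofs by blast
    qed
    show "\<exists>z. \<exists>i \<in> hom N x z. \<exists>p \<in> hom N z y. f = p \<cdot>\<^bsub>N\<^esub> i \<and> i \<in> cofs T \<inter> weqs T \<and> p \<in> fibs T"
      if f: "f \<in> hom N x y" for f x y
    proof -
      obtain z i p where "i \<in> hom N x z" "p \<in> hom N z y" "f = p \<cdot>\<^bsub>N\<^esub> i"
        "i \<in> relative_cell_complexes U N ?LJ" "p \<in> rlp N ?LJ"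
        using N.small_object_argument[OF LJ soa_J f] .
      then show ?thesis using cells_J unfolding fibs by blast
    qed
    show "?LI \<subseteq> Arr N" "?LJ \<subseteq> Arr N" "small U ?LI" "small U ?LJ" using LI LJ by blast+
    show "permits_small_object_argument U N ?LI" "permits_small_object_argument U N ?LJ"
      by (rule soa_I, rule soa_J)
    show "fibs T = rlp N ?LJ" by (rule fibs)
    show "fibs T \<inter> weqs T = rlp N ?LI" by (rule acyclic_fibs)
  qed
  have induced: "right_induced N T S F"
    unfolding right_induced_def weqs fibs using rlp_LJ by blast
  have LF_quillen: "quillen_adjunction M S N T L F"
    unfolding quillen_adjunction_def
  proof (intro conjI ballI LF_adj)
    have L_cofs: "fmor L f \<in> cofs T" if f: "f \<in> cofs S" for f
    proof -
      have fA: "f \<in> Arr M" using f M.classes_closed(2) by blast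
      have "lifts_against N (fmor L f) p" if p: "p \<in> rlp N ?LI" for p
      proof -
        have pA: "p \<in> Arr N" using p rlp_Arr by blast
        have "lifts_against M f (fmor F p)" using M.lifting(1)[OF f] rlp_LI[OF pA] p by blast
        then show ?thesis using LF.lifts_against_adjoint[OF fA pA] by blast
      qed
      then show ?thesis unfolding cofs llp_def using L_Arr[OF fA] by blast
    qed
    show "fmor L f \<in> cofs T" if "f \<in> cofs S" for f by (rule L_cofs[OF that])
    show "fmor L f \<in> cofs T \<inter> weqs T" if f: "f \<in> cofs S \<inter> weqs S" for f
      using L_cofs FL_acyclic[OF f] L_Arr M.classes_closed(2) f unfolding weqs by blast
  qed
  have FR_quillen: "quillen_adjunction N T M S F R"
    unfolding quillen_adjunction_def
  proof (intro conjI ballI FR_adj)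
    have F_cofs: "fmor F f \<in> cofs S" if f: "f \<in> cofs T" for f
    proof -
      have fA: "f \<in> Arr N" using f unfolding cofs llp_def by blast
      have "lifts_against M (fmor F f) p" if p: "p \<in> rlp M I" for p
      proof -
        have pA: "p \<in> Arr M" using p unfolding rlp_def by blast
        have RpA: "fmor R p \<in> Arr N"
          using homD[OF cat_functor_Arr[OF FR.right.cat_functor_axioms pA]] by blast
        \<comment> \<open>\<open>R p\<close> is an acyclic fibration because \<open>F L\<close> preserves cofibrations.\<close>
        have "lifts_against N (fmor L k) (fmor R p)" if k: "k \<in> I" for k
          using FLI[OF k] p FR.lifts_against_adjoint[OF L_Arr pA] k M.generators_closed(1)
          unfolding llp_def by blast
        then have "fmor R p \<in> rlp N ?LI" unfolding rlp_def using RpA by blast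
        then have "lifts_against N f (fmor R p)" using f unfolding cofs llp_def by blast
        then show ?thesis using FR.lifts_against_adjoint[OF fA pA] by blast
      qed
      then show ?thesis unfolding M.cofs_eq llp_def using F_Arr[OF fA] by blast
    qed
    show "fmor F f \<in> cofs S" if "f \<in> cofs T" for f by (rule F_cofs[OF that])
    show "fmor F f \<in> cofs S \<inter> weqs S" if "f \<in> cofs T \<inter> weqs T" for f
      using F_cofs that unfolding weqs by blast
  qed
  show ?thesis using model weqs induced LF_quillen FR_quillen by blast
qed

end
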